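(* Let $1\le p<\infty$, let $a>1$ and $N\in\mathbb{N}$, $N\ge1$, and let $\phi_j=\mathcal{F}_{\alpha_j}\varphi^a$, $\alpha_j=\pi j/N$, $j=1,\dots,N$. Let $f\in L^2(\mathbb{R})$ be the true signal, normalized so that $f(0)=|f(0)|>0$, and such that, with $$u(x):=\int_{\mathbb{R}}\mathcal{A}f(x,y)e^{\pi i x y}\,dy,$$ the reconstruction formula $u(x)=f(x)\overline{f(0)}$ holds for almost every $x\in\mathbb{R}$ and for $x=0$ (so $u(0)=|f(0)|^2>0$). Let $\eta_1,\dots,\eta_N\in L^1(\mathbb{R}^2)$, $F_j=|V_{\phi_j}f|^2$, $F_j^\eta=|V_{\phi_j}f|^2+\eta_j$. For some $\varepsilon>0$, let $\Omega\subset\mathbb{R}^2$ be a measurable set with $\sum_{j=1}^N\mathcal{A}\phi_j>\varepsilon$ on $\Omega$. Let $$A(x,y)=\frac{\sum_{j=1}^N\mathcal{F}(F_j)(y,-x)}{\sum_{j=1}^N\mathcal{A}\phi_j(x,y)},\qquad A^\eta(x,y)=\frac{\sum_{j=1}^N\mathcal{F}(F_j^\eta)(y,-x)}{\sum_{j=1}^N\mathcal{A}\phi_j(x,y)}\qquad\text{for }(x,y)\in\Omega,$$ and $A=A^\eta=0$ on $\mathbb{R}^2\setminus\Omega$. Let $\widetilde u(x)=\int_{\mathbb{R}}A(x,y)e^{\pi i x y}\,dy$ and $\widetilde u^\eta(x)=\int_{\mathbb{R}}A^\eta(x,y)e^{\pi i x y}\,dy$, assume $\widetilde u(0)\ne0$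 and $\widetilde u^\eta(0)\ne0$, and set $k:=\sqrt{|\widetilde u(0)|}$, $k^\eta:=\sqrt{|\widetilde u^\eta(0)|}$, $k^{\mathrm{true}}:=\sqrt{u(0)}$ and $\widetilde f^{\,\eta}:=\widetilde u^\eta/k^\eta$. Let $C_p:=\|\mathbf{1}_\Omega\|_{L^{p,1}(\mathbb{R}^2)}$ and $C_{\mathbb{R},\Omega}:=|\{y\in\mathbb{R}:(0,y)\in\Omega\}|$ (one-dimensional Lebesgue measure). Then $$\begin{aligned}\|f-\widetilde f^{\,\eta}\|_{L^p(\mathbb{R})}\le{}&\frac1{k^{\mathrm{true}}}\|\mathcal{A}f\|_{L^{p,1}(\mathbb{R}^2\setminus\Omega)}+\frac{1}{2(k^{\mathrm{true}}\,k)^{3/2}}\|\mathcal{A}f(0,\cdot)\|_{L^1((\mathbb{R}^2\setminus\Omega)\cap(\{0\}\times\mathbb{R}))}\,\|A\|_{L^{p,1}(\mathbb{R}^2)}\\&+\left(\frac{1}{2(k\,k^\eta)^{3/2}}\|A\|_{L^{p,1}(\mathbb{R}^2)}+\frac1{k^\eta}\right)\frac1\varepsilon\max(C_{\mathbb{R},\Omega},C_p)\Big\|\sum_{j=1}^N\eta_j\Big\|_{L^1(\mathbb{R}^2)},\end{aligned}$$ and consequently, for some constant $C>0$ depending only on $\|A\|_{L^{p,1}(\mathbb{R}^2)},k,k^\eta,k^{\mathrm{true}},C_{\mathbb{R},\Omega}$ and $C_p$, $$\|f-\widetilde f^{\,\eta}\|_{L^p(\mathbb{R})}\le C\left(\|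\mathcal{A}f\|_{L^{p,1}(\mathbb{R}^2\setminus\Omega)}+\|\mathcal{A}f(0,\cdot)\|_{L^1((\mathbb{R}^2\setminus\Omega)\cap(\{0\}\times\mathbb{R}))}+\frac1\varepsilon\Big\|\sum_{j=1}^N\eta_j\Big\|_{L^1(\mathbb{R}^2)}\right).$$
   Context: The short-time Fourier transform of $f\in L^2(\mathbb{R})$ with window $g\in L^2(\mathbb{R})$ is $V_gf(x,y)=\int_{\mathbb{R}}f(t)\overline{g(t-x)}e^{-2\pi i t y}\,dt$. The ambiguity function of $f$ is $\mathcal{A}f(x,y)=\int_{\mathbb{R}}f(t+x/2)\overline{f(t-x/2)}e^{-2\pi i t y}\,dt=e^{\pi i x y}V_ff(x,y)$. $\mathcal{F}$ is the two-dimensional Fourier transform $\mathcal{F}(G)(\xi)=\int_{\mathbb{R}^2}G(z)e^{-2\pi i z\cdot\xi}\,dz$. Known relation (from the orthogonality relations of the STFT): $\mathcal{F}(|V_gf|^2)(y,-x)=\mathcal{A}f(x,y)\,\overline{\mathcal{A}g(x,y)}$ for $f,g\in L^2(\mathbb{R})$. Dilated Gaussian: $\varphi^a(t)=a^{1/4}e^{-a\pi t^2}$. The fractional Fourier transform by angle $\alpha\in\mathbb{R}\setminus\pi\mathbb{Z}$ is $\mathcal{F}_\alpha f(y)=c_\alpha e^{\pi i y^2\cot\alpha}\int_{\mathbb{R}}f(t)e^{\pi i t^2\cot\alpha}e^{-2\pi i t y/\sin\alpha}\,dt$ (extended to $L^2(\mathbb{R})$ by density), where $c_\alpha$ is the square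 root of $1-i\cot\alpha$ with positive real part; $\mathcal{F}_{k\pi}f(y)=f(y)$ for $k$ even and $f(-y)$ for $k$ odd. One has $\mathcal{A}\phi_j(x,y)=\mathcal{A}\varphi^a(R_{\alpha_j}(x,y))$ with $R_\alpha(x,y)=(x\cos\alpha-y\sin\alpha,\,x\sin\alpha+y\cos\alpha)$ and $\mathcal{A}\varphi^a(x,y)=\frac{1}{\sqrt2}e^{-\frac{\pi}{2}(ax^2+y^2/a)}$; in particular $\mathcal{A}\phi_j$ is real-valued and positive. Mixed norm: $\|U\|_{L^{p,1}(\mathbb{R}^2)}=\int_{\mathbb{R}}\big(\int_{\mathbb{R}}|U(x,y)|^p\,dx\big)^{1/p}dy$, and $\|U\|_{L^{p,1}(\mathbb{R}^2\setminus\Omega)}:=\|\mathbf{1}_{\mathbb{R}^2\setminus\Omega}U\|_{L^{p,1}(\mathbb{R}^2)}$, with $\mathbf{1}_E$ the characteristic function of $E$. Moreover $\|\mathcal{A}f(0,\cdot)\|_{L^1((\mathbb{R}^2\setminus\Omega)\cap(\{0\}\times\mathbb{R}))}=\int_{\{y:(0,y)\notin\Omega\}}|\mathcal{A}f(0,y)|\,dy$. The norms on the right-hand side may be $+\infty$, in which case the bound is trivial. *)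

theory Defs
  imports "HOL-Analysis.Analysis"
begin

text \<open>Elements of \<open>L\<^sup>p\<close> spaces are represented by functions, Lebesgue measurable on the line or the
  plane. A function of two variables is a function on pairs.\<close>

definition in_L2 :: "(real \<Rightarrow> complex) \<Rightarrow> bool" where
  "in_L2 f \<longleftrightarrow> f \<in> borel_measurable lebesgue \<and> integrable lebesgue (\<lambda>t. (cmod (f t))\<^sup>2)"

definition stft :: "(real \<Rightarrow> complex) \<Rightarrow> (real \<Rightarrow> complex) \<Rightarrow> real \<times> real \<Rightarrow> complex" where
  "stft g f = (\<lambda>(x, y). \<integral>t. f t * cnj (g (t - x)) * cis (- 2 * pi * t * y) \<partial>lebesgue)"

definition ambiguity :: "(real \<Rightarrow> complex) \<Rightarrow> real \<times> real \<Rightarrow> complex" where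
  "ambiguity f = (\<lambda>(x, y). \<integral>t. f (t + x / 2) * cnj (f (t - x / 2)) * cis (- 2 * pi * t * y) \<partial>lebesgue)"

definition fourier2 :: "(real \<times> real \<Rightarrow> complex) \<Rightarrow> real \<times> real \<Rightarrow> complex" where
  "fourier2 G \<xi> = (\<integral>z. G z * cis (- 2 * pi * (z \<bullet> \<xi>)) \<partial>lebesgue)"

definition dilated_gaussian :: "real \<Rightarrow> real \<Rightarrow> complex" where
  "dilated_gaussian a t = complex_of_real (a powr (1 / 4) * exp (- a * pi * t\<^sup>2))"

text \<open>The principal square root has positive real part here because \<open>1 - \<i> cot \<alpha>\<close> lies in the open
  right half plane.\<close>

definition frac_fourier_integral :: "real \<Rightarrow> (real \<Rightarrow> complex) \<Rightarrow> real \<Rightarrow> complex" where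
  "frac_fourier_integral \<alpha> f y =
    csqrt (1 - \<i> * complex_of_real (cot \<alpha>)) * cis (pi * y\<^sup>2 * cot \<alpha>) *
      (\<integral>t. f t * cis (pi * t\<^sup>2 * cot \<alpha>) * cis (- 2 * pi * t * y / sin \<alpha>) \<partial>lebesgue)"

text \<open>For integrable functions (such as Gaussians) the integral formula applies; the remaining elements
  of \<open>L\<^sup>2\<close> are reached as \<open>L\<^sup>2\<close> limits along the truncations to \<open>[-n, n]\<close>, which are integrable.\<close>

definition frac_fourier :: "real \<Rightarrow> (real \<Rightarrow> complex) \<Rightarrow> real \<Rightarrow> complex" where
  "frac_fourier \<alpha> f =
    (if \<exists>k::int. even k \<and> \<alpha> = of_int k * pi then f
     else if \<exists>k::int. odd k \<and> \<alpha> = of_int k * pi then (\<lambda>y. f (- y))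
     else if integrable lebesgue f then frac_fourier_integral \<alpha> f
     else (SOME h. in_L2 h \<and>
       (\<lambda>n. \<integral>\<^sup>+y. ennreal ((cmod (h y -
          frac_fourier_integral \<alpha> (\<lambda>t. indicator {- real n..real n} t * f t) y))\<^sup>2) \<partial>lebesgue) \<longlonglongrightarrow> 0))"

definition window :: "real \<Rightarrow> nat \<Rightarrow> nat \<Rightarrow> real \<Rightarrow> complex" where
  "window a N j = frac_fourier (pi * real j / real N) (dilated_gaussian a)"

definition ambiguity_sum :: "real \<Rightarrow> nat \<Rightarrow> real \<times> real \<Rightarrow> complex" where
  "ambiguity_sum a N z = (\<Sum>j=1..N. ambiguity (window a N j) z)"

definition spectrogram :: "real \<Rightarrow> nat \<Rightarrow> (real \<Rightarrow> complex) \<Rightarrow> nat \<Rightarrow> real \<times> real \<Rightarrow> complex" where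
  "spectrogram a N f j z = complex_of_real ((cmod (stft (window a N j) f z))\<^sup>2)"

text \<open>The function \<open>A\<close> (respectively its noisy version) obtained from measurements \<open>F\<^sub>1, \<dots>, F\<^sub>N\<close>.\<close>

definition recovered_ambiguity ::
  "real \<Rightarrow> nat \<Rightarrow> (real \<times> real) set \<Rightarrow> (nat \<Rightarrow> real \<times> real \<Rightarrow> complex) \<Rightarrow> real \<times> real \<Rightarrow> complex" where
  "recovered_ambiguity a N \<Omega> F = (\<lambda>(x, y).
     if (x, y) \<in> \<Omega> then (\<Sum>j=1..N. fourier2 (F j) (y, - x)) / ambiguity_sum a N (x, y) else 0)"

definition synthesis :: "(real \<times> real \<Rightarrow> complex) \<Rightarrow> real \<Rightarrow> complex" where
  "synthesis U x = (\<integral>y. U (x, y) * cis (pi * x * y) \<partial>lebesgue)"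

text \<open>Norms take values in \<open>[0,\<infinity>]\<close>. The library has no real powers of extended nonnegative reals;
  the following is intended for exponents \<open>r > 0\<close>.\<close>

definition ennpowr :: "ennreal \<Rightarrow> real \<Rightarrow> ennreal" where
  "ennpowr x r = (if x = \<infinity> then \<infinity> else ennreal (enn2real x powr r))"

definition Lp_norm :: "real \<Rightarrow> (real \<Rightarrow> complex) \<Rightarrow> ennreal" where
  "Lp_norm p h = ennpowr (\<integral>\<^sup>+x. ennreal (cmod (h x) powr p) \<partial>lebesgue) (1 / p)"

definition mixed_norm :: "real \<Rightarrow> (real \<times> real \<Rightarrow> complex) \<Rightarrow> ennreal" where
  "mixed_norm p U =
    (\<integral>\<^sup>+y. ennpowr (\<integral>\<^sup>+x. ennreal (cmod (U (x, y)) powr p) \<partial>lebesgue) (1 / p) \<partial>lebesgue)"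

definition mixed_norm_on :: "real \<Rightarrow> (real \<times> real) set \<Rightarrow> (real \<times> real \<Rightarrow> complex) \<Rightarrow> ennreal" where
  "mixed_norm_on p E U = mixed_norm p (\<lambda>z. indicator E z * U z)"

definition L1_norm_plane :: "(real \<times> real \<Rightarrow> complex) \<Rightarrow> ennreal" where
  "L1_norm_plane G = (\<integral>\<^sup>+z. ennreal (cmod (G z)) \<partial>lebesgue)"

definition L1_norm_axis :: "(real \<times> real) set \<Rightarrow> (real \<times> real \<Rightarrow> complex) \<Rightarrow> ennreal" where
  "L1_norm_axis E U = (\<integral>\<^sup>+y\<in>{y. (0, y) \<in> E}. ennreal (cmod (U (0, y))) \<partial>lebesgue)"

end

theory Submission
  imports Defs "HOL-Probability.Characteristic_Functions"
begin

text \<open>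
The reconstruction error is controlled by two ideas: Minkowski's integral inequality moves the \<open>L\<^sup>p\<close> norm
in \<open>x\<close> inside the integral over \<open>y\<close> that defines the synthesis, and a change of the normalising constant
costs at most \<open>\<bar>1/r - 1/s\<bar> \<le> \<bar>r\<^sup>2 - s\<^sup>2\<bar> / (2 (r s)\<^bsup>3/2\<^esup>)\<close>, where the difference of squares is read off from
the synthesis at the origin. With \<open>k\<^sub>0 = ktrue\<close> one writes
\<open>f - u\<^sup>\<eta>/k\<^sup>\<eta> = (u - v)/k\<^sub>0 + v (1/k\<^sub>0 - 1/k) + v (1/k - 1/k\<^sup>\<eta>) + (v - u\<^sup>\<eta>)/k\<^sup>\<eta>\<close>,
where \<open>v\<close> is the synthesis of the noiseless \<open>A\<close>. This is \<open>reconstruction_error\<close>, which holds for any Borel function \<open>U\<close>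
in place of the ambiguity function, restricted to \<open>\<Omega>\<close> and perturbed there by an amount bounded by a constant.

To apply it, \<open>A\<close> has to be the ambiguity function of \<open>f\<close> on \<open>\<Omega>\<close>. That needs, at every point and not only
almost everywhere (the norm along the axis \<open>x = 0\<close> sees a null set of the plane), the relation
\<open>F(|V\<^sub>g f|\<^sup>2)(y, -x) = \<A>f(x, y) cnj (\<A>g(x, y))\<close>. It is proved for all \<open>L\<^sup>2\<close> windows by Gaussian summation:
for fixed \<open>x\<close>, \<open>|V\<^sub>g f(x, \<cdot>)|\<^sup>2\<close> is the Fourier transform of an autocorrelation; after damping by a dilated Gaussian
the integrals can be interchanged, the integral over \<open>x\<close> factors into the product of the two ambiguity
functions, and the dilated Gaussian becomes an approximate identity acting on that product, which is continuous
because translations act continuously on \<open>L\<^sup>2\<close>. The windows enter only through two properties: they are even, so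
their ambiguity functions are real and the sum cancels against the denominator, and they are square integrable,
by the same Gaussian summation.

A finite constant in the second estimate needs finite \<open>\<parallel>A\<parallel>\<close>, \<open>C\<^sub>p\<close> and \<open>C\<^sub>\<real>\<^sub>,\<^sub>\<Omega>\<close>. These are finite since the ambiguity
function of an \<open>L\<^sup>2\<close> function vanishes at infinity, so that \<open>\<Omega>\<close> lies in a bounded superlevel set
(\<open>ambiguity_sum_superlevel_bounded\<close>).
\<close>

section \<open>Square-integrable functions on the line\<close>

text \<open>The analysis is carried out for Borel functions and \<open>lborel\<close>, where products and Fubini's theorem are at
hand; Lebesgue measurable functions are replaced by Borel representatives only when the defining integrals over \<open>lebesgue\<close> are evaluated.\<close>

definition sq_integrable :: "(real \<Rightarrow> complex) \<Rightarrow> bool" where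
  "sq_integrable f \<longleftrightarrow> f \<in> borel_measurable borel \<and> integrable lborel (\<lambda>t. (cmod (f t))\<^sup>2)"

text \<open>The square of the \<open>L\<^sup>2\<close> norm. It is subadditive up to a factor 2, which is all that density arguments use.\<close>

definition energy :: "(real \<Rightarrow> complex) \<Rightarrow> real" where
  "energy f = (\<integral>t. (cmod (f t))\<^sup>2 \<partial>lborel)"

lemma sq_integrable_measurable [measurable_dest]: "sq_integrable f \<Longrightarrow> f \<in> borel_measurable borel"
  by (simp add: sq_integrable_def)

lemma energy_nonneg: "0 \<le> energy f"
  by (simp add: energy_def)

lemma nn_integral_energy:
  "sq_integrable f \<Longrightarrow> (\<integral>\<^sup>+t. ennreal ((cmod (f t))\<^sup>2) \<partial>lborel) = ennreal (energy f)"
  by (simp add: sq_integrable_def energy_def nn_integral_eq_integral)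

lemma sq_integrable_shift:
  assumes "sq_integrable f"
  shows "sq_integrable (\<lambda>t. f (t - x))" "energy (\<lambda>t. f (t - x)) = energy f"
proof -
  have [measurable]: "f \<in> borel_measurable borel" using assms by (rule sq_integrable_measurable)
  show "sq_integrable (\<lambda>t. f (t - x))"
    using assms lborel_integrable_real_affine[of "\<lambda>t. (cmod (f t))\<^sup>2" 1 "-x"]
    by (simp add: sq_integrable_def)
  show "energy (\<lambda>t. f (t - x)) = energy f"
    unfolding energy_def
    by (subst (2) lborel_integral_real_affine[where c=1 and t="-x"]) simp_all
qed

lemma cmod_add_square_le: "(cmod (a + b))\<^sup>2 \<le> 2 * (cmod a)\<^sup>2 + 2 * (cmod b)\<^sup>2"
proof -
  have "(cmod (a + b))\<^sup>2 \<le> (cmod a + cmod b)\<^sup>2"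
    by (intro power_mono norm_triangle_ineq) auto
  also have "\<dots> \<le> 2 * (cmod a)\<^sup>2 + 2 * (cmod b)\<^sup>2"
    using sum_squares_bound[of "cmod a" "cmod b"] by (simp add: power2_sum)
  finally show ?thesis .
qed

lemma sq_integrable_add:
  assumes "sq_integrable f" "sq_integrable g"
  shows "sq_integrable (\<lambda>t. f t + g t)"
    and "energy (\<lambda>t. f t + g t) \<le> 2 * energy f + 2 * energy g"
proof -
  have [measurable]: "f \<in> borel_measurable borel" "g \<in> borel_measurable borel"
    using assms by (auto simp: sq_integrable_def)
  have i: "integrable lborel (\<lambda>t. 2 * (cmod (f t))\<^sup>2 + 2 * (cmod (g t))\<^sup>2)"
    using assms by (auto simp: sq_integrable_def)
  have j: "integrable lborel (\<lambda>t. (cmod (f t + g t))\<^sup>2)"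
    by (rule Bochner_Integration.integrable_bound[OF i]) (auto simp: cmod_add_square_le)
  then show "sq_integrable (\<lambda>t. f t + g t)" by (simp add: sq_integrable_def)
  have "energy (\<lambda>t. f t + g t) \<le> (\<integral>t. 2 * (cmod (f t))\<^sup>2 + 2 * (cmod (g t))\<^sup>2 \<partial>lborel)"
    unfolding energy_def by (rule integral_mono[OF j i]) (rule cmod_add_square_le)
  also have "\<dots> = 2 * energy f + 2 * energy g"
    using assms by (simp add: sq_integrable_def energy_def)
  finally show "energy (\<lambda>t. f t + g t) \<le> 2 * energy f + 2 * energy g" .
qed

lemma sq_integrable_uminus:
  assumes "sq_integrable f"
  shows "sq_integrable (\<lambda>t. - f t)" "energy (\<lambda>t. - f t) = energy f"
  using assms by (auto simp: sq_integrable_def energy_def)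

lemma sq_integrable_diff:
  assumes "sq_integrable f" "sq_integrable g"
  shows "sq_integrable (\<lambda>t. f t - g t)"
    and "energy (\<lambda>t. f t - g t) \<le> 2 * energy f + 2 * energy g"
  using sq_integrable_add[OF assms(1) sq_integrable_uminus(1)[OF assms(2)]]
    sq_integrable_uminus(2)[OF assms(2)] by simp_all

lemma Cauchy_Schwarz_energy:
  assumes "sq_integrable f" "sq_integrable g"
  shows "integrable lborel (\<lambda>t. cmod (f t) * cmod (g t))"
    and "(\<integral>t. cmod (f t) * cmod (g t) \<partial>lborel) \<le> sqrt (energy f) * sqrt (energy g)"
proof -
  have [measurable]: "f \<in> borel_measurable borel" "g \<in> borel_measurable borel"
    using assms by (auto simp: sq_integrable_def)
  have i: "integrable lborel (\<lambda>t. (cmod (f t))\<^sup>2 + (cmod (g t))\<^sup>2)"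
    using assms by (auto simp: sq_integrable_def)
  show j: "integrable lborel (\<lambda>t. cmod (f t) * cmod (g t))"
  proof (rule Bochner_Integration.integrable_bound[OF i])
    have "cmod (f t) * cmod (g t) \<le> (cmod (f t))\<^sup>2 + (cmod (g t))\<^sup>2" for t
      using sum_squares_bound[of "cmod (f t)" "cmod (g t)"] mult_nonneg_nonneg[of "cmod (f t)" "cmod (g t)"]
      by (simp del: mult_nonneg_nonneg)
    then show "AE t in lborel. norm (cmod (f t) * cmod (g t)) \<le> norm ((cmod (f t))\<^sup>2 + (cmod (g t))\<^sup>2)"
      by (simp add: abs_mult)
  qed measurable
  let ?I = "\<integral>t. cmod (f t) * cmod (g t) \<partial>lborel"
  have I0: "0 \<le> ?I" by simp
  have "ennreal (?I\<^sup>2) = (\<integral>\<^sup>+t. ennreal (cmod (f t)) * ennreal (cmod (g t)) \<partial>lborel)\<^sup>2"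
    using nn_integral_eq_integral[OF j] I0 by (simp add: ennreal_mult ennreal_power)
  also have "\<dots> \<le> (\<integral>\<^sup>+t. ennreal (cmod (f t))^2 \<partial>lborel) * (\<integral>\<^sup>+t. ennreal (cmod (g t))^2 \<partial>lborel)"
    by (rule Cauchy_Schwarz_nn_integral) measurable
  also have "\<dots> = ennreal (energy f * energy g)"
    using nn_integral_energy[OF assms(1)] nn_integral_energy[OF assms(2)]
    by (simp add: ennreal_power ennreal_mult energy_nonneg)
  finally have "?I\<^sup>2 \<le> energy f * energy g"
    by (simp add: energy_nonneg)
  then have "?I \<le> sqrt (energy f * energy g)" by (rule real_le_rsqrt)
  then show "?I \<le> sqrt (energy f) * sqrt (energy g)" by (simp add: real_sqrt_mult)
qed

text \<open>Continuous functions of bounded support are dense in \<open>L\<^sup>2\<close>. A measurable \<open>f\<close> is a pointwise almost everywhere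
limit of continuous \<open>g\<^sub>n\<close>, without any control in norm; capping the modulus at \<open>m\<close> and multiplying by a cut-off
supported in \<open>[-m-1, m+1]\<close> are continuous operations that supply an integrable majorant, so dominated convergence applies
once for \<open>n\<close> and once for \<open>m\<close>.\<close>

lemma continuous_approximation_energy:
  assumes f: "sq_integrable f" and e: "0 < e"
  obtains g R B where "continuous_on UNIV g" "\<And>t. R < \<bar>t\<bar> \<Longrightarrow> g t = 0" "\<And>t. cmod (g t) \<le> B"
    "sq_integrable g" "energy (\<lambda>t. f t - g t) < e"
proof -
  have [measurable]: "f \<in> borel_measurable borel" using f by (rule sq_integrable_measurable)
  define T where "T m z = z / complex_of_real (max 1 (cmod z / m))" for m :: real and z
  define cut where "cut m t = complex_of_real (max 0 (min 1 (m + 1 - \<bar>t\<bar>)))" for m t :: real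
  have contT: "continuous_on UNIV (T m)" for m
    unfolding T_def by (cases "m = 0") (auto intro!: continuous_intros continuous_on_max)
  have contcut: "continuous_on UNIV (cut m)" for m
    unfolding cut_def by (intro continuous_intros continuous_on_max continuous_on_min)
  have [measurable]: "T m \<in> borel_measurable borel" "cut m \<in> borel_measurable borel" for m
    by (simp_all add: borel_measurable_continuous_onI contT contcut)
  have T_le: "cmod (T m z) \<le> m" if "m > 0" for m z
  proof -
    have "cmod z \<le> m * max 1 (cmod z / m)" using that by (auto simp: max_def field_simps)
    then show ?thesis by (simp add: T_def norm_divide pos_divide_le_eq)
  qed
  have T_le': "cmod (T m z) \<le> cmod z" if "m > 0" for m z
  proof -
    have "cmod z \<le> cmod z * max 1 (cmod z / m)" by (simp add: mult_le_cancel_left1)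
    then show ?thesis by (simp add: T_def norm_divide pos_divide_le_eq)
  qed
  have T_eq: "T m z = z" if "m \<ge> cmod z" "m > 0" for m z
    using that by (simp add: T_def max_def)
  have cut_le: "cmod (cut m t) \<le> 1" for m t by (simp add: cut_def)
  have cut_eq: "cut m t = 1" if "\<bar>t\<bar> \<le> m" for m t using that by (simp add: cut_def)
  have cut_0: "cut m t = 0" if "m + 1 < \<bar>t\<bar>" for m t using that by (simp add: cut_def)
  have Tx: "cmod (T m z * cut m t) \<le> cmod z" if "m > 0" for m z t
    using mult_mono[OF T_le'[OF that, of z] cut_le[of m t]] by (simp add: norm_mult)
  have Tx': "cmod (T m z * cut m t) \<le> m * indicator {- m - 1..m + 1} t" if "m > 0" for m z t
  proof (cases "m + 1 < \<bar>t\<bar>")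
    case False
    then have "t \<in> {- m - 1..m + 1}" by auto
    then show ?thesis using mult_mono[OF T_le[OF that, of z] cut_le[of m t]] that by (simp add: norm_mult)
  qed (use that in \<open>simp add: cut_0\<close>)
  have lim1: "(\<lambda>m::nat. \<integral>t. (cmod (f t - T (Suc m) (f t) * cut (Suc m) t))\<^sup>2 \<partial>lborel) \<longlonglongrightarrow> (\<integral>t. 0 \<partial>(lborel :: real measure))"
  proof (rule integral_dominated_convergence[where f="\<lambda>_. 0" and w="\<lambda>t. 4 * (cmod (f t))\<^sup>2"])
    show "integrable lborel (\<lambda>t. 4 * (cmod (f t))\<^sup>2)" using f by (simp add: sq_integrable_def)
    show "AE t in lborel. (\<lambda>m::nat. (cmod (f t - T (Suc m) (f t) * cut (Suc m) t))\<^sup>2) \<longlonglongrightarrow> 0"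
    proof (intro AE_I2 tendsto_eventually)
      fix t
      obtain n :: nat where n: "real n \<ge> max (cmod (f t)) \<bar>t\<bar>" using real_arch_simple by blast
      have "(cmod (f t - T (Suc m) (f t) * cut (Suc m) t))\<^sup>2 = 0" if "m \<ge> n" for m
      proof -
        have "real (Suc m) \<ge> real n" using that by simp
        then have "real (Suc m) \<ge> cmod (f t)" "real (Suc m) \<ge> \<bar>t\<bar>" using n by linarith+
        then show ?thesis using T_eq cut_eq by simp
      qed
      then show "\<forall>\<^sub>F m in sequentially. (cmod (f t - T (Suc m) (f t) * cut (Suc m) t))\<^sup>2 = 0"
        unfolding eventually_sequentially by blast
    qed
    show "AE t in lborel. norm ((cmod (f t - T (real (Suc m)) (f t) * cut (real (Suc m)) t))\<^sup>2)
        \<le> 4 * (cmod (f t))\<^sup>2" for m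
    proof (intro AE_I2)
      fix t
      have "(cmod (f t - T (real (Suc m)) (f t) * cut (real (Suc m)) t))\<^sup>2 \<le> (2 * cmod (f t))\<^sup>2"
        using Tx[of "real (Suc m)" "f t" t] norm_triangle_ineq4[of "f t" "T (real (Suc m)) (f t) * cut (real (Suc m)) t"]
        by (intro power_mono) auto
      then show "norm ((cmod (f t - T (real (Suc m)) (f t) * cut (real (Suc m)) t))\<^sup>2) \<le> 4 * (cmod (f t))\<^sup>2"
        by (simp add: power_mult_distrib)
    qed
  qed measurable
  have "\<forall>\<^sub>F m in sequentially. (\<integral>t. (cmod (f t - T (Suc m) (f t) * cut (Suc m) t))\<^sup>2 \<partial>lborel) < e / 4"
    using order_tendstoD(2)[OF lim1, of "e/4"] e by simp
  then obtain m0 :: nat where m0: "(\<integral>t. (cmod (f t - T (Suc m0) (f t) * cut (Suc m0) t))\<^sup>2 \<partial>lborel) < e / 4"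
    by (auto simp: eventually_sequentially)
  define m where "m = real (Suc m0)"
  have m: "m > 0" by (simp add: m_def)
  define f1 where "f1 t = T m (f t) * cut m t" for t
  have ff1: "energy (\<lambda>t. f t - f1 t) < e / 4"
    using m0 by (simp add: energy_def f1_def m_def)
  have "f measurable_on UNIV"
    by (rule lebesgue_measurable_imp_measurable_on) (auto intro: measurable_completion)
  then obtain N g where N: "negligible N" and g: "\<And>n. continuous_on UNIV (g n)"
    and gl: "\<And>x. x \<notin> N \<Longrightarrow> (\<lambda>n. g n x) \<longlonglongrightarrow> f x"
    unfolding measurable_on_def by auto
  have [measurable]: "g n \<in> borel_measurable borel" for n
    by (simp add: borel_measurable_continuous_onI g)
  have "AE x in lebesgue. x \<notin> N"
    using N unfolding negligible_iff_null_sets by (rule AE_not_in)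
  then have AEN: "AE x in lborel. x \<notin> N" by (simp add: AE_completion_iff)
  have [measurable]: "f1 \<in> borel_measurable borel" unfolding f1_def by measurable
  have int_ind: "integrable lborel (\<lambda>t. c * indicator {- m - 1..m + 1} t :: real)" for c
    by (auto intro!: integrable_mult_right integrable_real_indicator simp: emeasure_lborel_Icc_eq)
  have gx[measurable]: "(\<lambda>t. T m (g n t) * cut m t) \<in> borel_measurable borel" for n by measurable
  have lim2: "(\<lambda>n. \<integral>t. (cmod (f1 t - T m (g n t) * cut m t))\<^sup>2 \<partial>lborel) \<longlonglongrightarrow> (\<integral>t. 0 \<partial>(lborel :: real measure))"
  proof (rule integral_dominated_convergence[where f="\<lambda>_. 0" and w="\<lambda>t. (2 * m)\<^sup>2 * indicator {- m - 1..m + 1} t"])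
    show "integrable lborel (\<lambda>t. (2 * m)\<^sup>2 * indicator {- m - 1..m + 1} t :: real)" by (rule int_ind)
    show "AE t in lborel. (\<lambda>n. (cmod (f1 t - T m (g n t) * cut m t))\<^sup>2) \<longlonglongrightarrow> 0"
      using AEN
    proof eventually_elim
      fix t assume "t \<notin> N"
      then have "(\<lambda>n. T m (g n t)) \<longlonglongrightarrow> T m (f t)"
        by (intro continuous_on_tendsto_compose[OF contT gl]) auto
      then have "(\<lambda>n. (cmod (f1 t - T m (g n t) * cut m t))\<^sup>2) \<longlonglongrightarrow> (cmod (f1 t - T m (f t) * cut m t))\<^sup>2"
        by (intro tendsto_intros)
      then show "(\<lambda>n. (cmod (f1 t - T m (g n t) * cut m t))\<^sup>2) \<longlonglongrightarrow> 0" by (simp add: f1_def)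
    qed
    show "AE t in lborel. norm ((cmod (f1 t - T m (g n t) * cut m t))\<^sup>2) \<le> (2 * m)\<^sup>2 * indicator {- m - 1..m + 1} t" for n
    proof (intro AE_I2)
      fix t
      have "cmod (f1 t - T m (g n t) * cut m t) \<le> 2 * m * indicator {- m - 1..m + 1} t"
        using Tx'[OF m, of "f t" t] Tx'[OF m, of "g n t" t]
          norm_triangle_ineq4[of "f1 t" "T m (g n t) * cut m t"] by (simp add: f1_def)
      then have "(cmod (f1 t - T m (g n t) * cut m t))\<^sup>2 \<le> (2 * m * indicator {- m - 1..m + 1} t)\<^sup>2"
        by (rule power_mono) simp
      then show "norm ((cmod (f1 t - T m (g n t) * cut m t))\<^sup>2) \<le> (2 * m)\<^sup>2 * indicator {- m - 1..m + 1} t"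
        by (auto simp: indicator_def power_mult_distrib split: if_splits)
    qed
  qed measurable
  have "\<forall>\<^sub>F n in sequentially. (\<integral>t. (cmod (f1 t - T m (g n t) * cut m t))\<^sup>2 \<partial>lborel) < e / 4"
    using order_tendstoD(2)[OF lim2, of "e/4"] e by simp
  then obtain n where n: "(\<integral>t. (cmod (f1 t - T m (g n t) * cut m t))\<^sup>2 \<partial>lborel) < e / 4"
    by (auto simp: eventually_sequentially)
  define h where "h t = T m (g n t) * cut m t" for t
  have [measurable]: "h \<in> borel_measurable borel" unfolding h_def by measurable
  have sqi: "sq_integrable u" if "u \<in> borel_measurable borel" "\<And>t. cmod (u t) \<le> m * indicator {- m - 1..m + 1} t" for u
    unfolding sq_integrable_def
  proof (intro conjI that(1) Bochner_Integration.integrable_bound[OF int_ind[of "m\<^sup>2"]])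
    show "AE t in lborel. norm ((cmod (u t))\<^sup>2) \<le> norm (m\<^sup>2 * indicator {- m - 1..m + 1} t :: real)"
    proof (intro AE_I2)
      fix t
      have "(cmod (u t))\<^sup>2 \<le> (m * indicator {- m - 1..m + 1} t)\<^sup>2"
        by (rule power_mono[OF that(2)]) simp
      then show "norm ((cmod (u t))\<^sup>2) \<le> norm (m\<^sup>2 * indicator {- m - 1..m + 1} t :: real)"
        by (auto simp: indicator_def power_mult_distrib split: if_splits)
    qed
  qed (use that(1) in measurable)
  have sh: "sq_integrable h" by (rule sqi) (auto simp: h_def Tx'[OF m])
  have sf1: "sq_integrable f1" by (rule sqi) (auto simp: f1_def Tx'[OF m])
  have "energy (\<lambda>t. f t - h t) = energy (\<lambda>t. (f t - f1 t) + (f1 t - h t))" by simp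
  also have "\<dots> \<le> 2 * energy (\<lambda>t. f t - f1 t) + 2 * energy (\<lambda>t. f1 t - h t)"
    by (intro sq_integrable_add sq_integrable_diff f sh sf1)
  also have "\<dots> < e" using ff1 n by (simp add: energy_def h_def)
  finally have 1: "energy (\<lambda>t. f t - h t) < e" .
  have 2: "cmod (h t) \<le> m" for t
    using mult_mono[OF T_le[OF m, of "g n t"] cut_le[of m t]] m by (simp add: norm_mult h_def)
  have 3: "continuous_on UNIV h"
    unfolding h_def by (intro continuous_on_mult contcut continuous_on_compose2[OF contT g]) auto
  show ?thesis by (rule that[OF 3 _ 2 sh 1, of "m + 1"]) (simp add: h_def cut_0)
qed

text \<open>Dominated convergence settles the case of continuous \<open>f\<close> of bounded support; the general case follows by density, since
translations are isometries.
Both the continuity of ambiguity functions and their decay at infinity rest on this.\<close>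

lemma translation_continuous:
  assumes f: "sq_integrable f"
  shows "((\<lambda>h. energy (\<lambda>t. f (t - h) - f t)) \<longlongrightarrow> 0) (nhds 0)"
proof -
  have "((\<lambda>h. energy (\<lambda>t. f (t - h) - f t)) \<longlongrightarrow> 0) (at 0)"
  proof (unfold tendsto_at_iff_sequentially comp_def, intro allI impI)
    fix X :: "nat \<Rightarrow> real" assume X: "X \<longlonglongrightarrow> 0"
    show "(\<lambda>n. energy (\<lambda>t. f (t - X n) - f t)) \<longlonglongrightarrow> 0"
    proof (rule order_tendstoI)
      fix e :: real assume "0 < e"
      then have e: "0 < e / 12" by simp
      \<comment> \<open>An error \<open>e/12\<close> each for \<open>f - g\<close>, its translate and \<open>g\<close> adds up to \<open>4 e/12 + 4 e/12 + 2 e/12\<close>.\<close>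
      obtain g R B where g: "continuous_on UNIV g" "\<And>t. R < \<bar>t\<bar> \<Longrightarrow> g t = 0" "\<And>t. cmod (g t) \<le> B"
        and sg: "sq_integrable g" and fg: "energy (\<lambda>t. f t - g t) < e / 12"
        using continuous_approximation_energy[OF f e] by blast
      have [measurable]: "g \<in> borel_measurable borel" using sg by (rule sq_integrable_measurable)
      have ev: "\<forall>\<^sub>F n in sequentially. \<bar>X n\<bar> < 1"
        using tendstoD[OF X, of 1] by simp
      then obtain n0 where n0: "\<And>n. n \<ge> n0 \<Longrightarrow> \<bar>X n\<bar> < 1" by (auto simp: eventually_sequentially)
      have "(\<lambda>n. \<integral>t. (cmod (g (t - X (n + n0)) - g t))\<^sup>2 \<partial>lborel) \<longlonglongrightarrow> (\<integral>t. 0 \<partial>(lborel :: real measure))"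
      proof (rule integral_dominated_convergence[where f="\<lambda>_. 0" and w="\<lambda>t. (2 * B)\<^sup>2 * indicator {- R - 1..R + 1} t"])
        show "integrable lborel (\<lambda>t. (2 * B)\<^sup>2 * indicator {- R - 1..R + 1} t)"
          by (auto intro!: integrable_mult_right integrable_real_indicator simp: emeasure_lborel_Icc_eq)
        show "AE t in lborel. (\<lambda>n. (cmod (g (t - X (n + n0)) - g t))\<^sup>2) \<longlonglongrightarrow> 0"
        proof (intro AE_I2)
          fix t
          have "(\<lambda>n. t - X (n + n0)) \<longlonglongrightarrow> t - 0"
            by (intro tendsto_intros LIMSEQ_ignore_initial_segment X)
          then have "(\<lambda>n. g (t - X (n + n0))) \<longlonglongrightarrow> g t"
            using continuous_on_tendsto_compose[OF g(1)] by auto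
          then have "(\<lambda>n. (cmod (g (t - X (n + n0)) - g t))\<^sup>2) \<longlonglongrightarrow> (cmod (g t - g t))\<^sup>2"
            by (intro tendsto_intros)
          then show "(\<lambda>n. (cmod (g (t - X (n + n0)) - g t))\<^sup>2) \<longlonglongrightarrow> 0" by simp
        qed
        show "AE t in lborel. norm ((cmod (g (t - X (n + n0)) - g t))\<^sup>2) \<le> (2 * B)\<^sup>2 * indicator {- R - 1..R + 1} t" for n
        proof (intro AE_I2)
          fix t
          show "norm ((cmod (g (t - X (n + n0)) - g t))\<^sup>2) \<le> (2 * B)\<^sup>2 * indicator {- R - 1..R + 1} t"
          proof (cases "t \<in> {- R - 1..R + 1}")
            case True
            have "(cmod (g (t - X (n + n0)) - g t))\<^sup>2 \<le> (2 * B)\<^sup>2"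
              using g(3)[of t] g(3)[of "t - X (n + n0)"] norm_triangle_ineq4[of "g (t - X (n + n0))" "g t"]
              by (intro power_mono) auto
            then show ?thesis using True by simp
          next
            case False
            then have "g t = 0" "g (t - X (n + n0)) = 0" using n0[of "n + n0"] by (auto intro!: g(2))
            then show ?thesis by simp
          qed
        qed
      qed measurable
      then have "(\<lambda>n. energy (\<lambda>t. g (t - X n) - g t)) \<longlonglongrightarrow> 0"
        unfolding energy_def by (simp add: LIMSEQ_offset[of _ n0])
      then have "\<forall>\<^sub>F n in sequentially. energy (\<lambda>t. g (t - X n) - g t) < e / 12"
        using order_tendstoD(2) e by blast
      then show "\<forall>\<^sub>F n in sequentially. energy (\<lambda>t. f (t - X n) - f t) < e"
      proof eventually_elim
        fix n assume *: "energy (\<lambda>t. g (t - X n) - g t) < e / 12"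
        have d: "sq_integrable (\<lambda>t. f t - g t)" by (intro sq_integrable_diff f sg)
        note d' = sq_integrable_shift[OF d, of "X n"]
        have dg: "sq_integrable (\<lambda>t. g (t - X n) - g t)" by (intro sq_integrable_diff sq_integrable_shift sg)
        have "energy (\<lambda>t. f (t - X n) - f t)
          = energy (\<lambda>t. ((f (t - X n) - g (t - X n)) - (f t - g t)) + (g (t - X n) - g t))" by simp
        also have "\<dots> \<le> 2 * energy (\<lambda>t. (f (t - X n) - g (t - X n)) - (f t - g t)) + 2 * energy (\<lambda>t. g (t - X n) - g t)"
          by (intro sq_integrable_add sq_integrable_diff(1) d d'(1) dg)
        also have "energy (\<lambda>t. (f (t - X n) - g (t - X n)) - (f t - g t)) \<le>
           2 * energy (\<lambda>t. f t - g t) + 2 * energy (\<lambda>t. f t - g t)"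
          using sq_integrable_diff(2)[OF d'(1) d] d'(2) by simp
        finally show "energy (\<lambda>t. f (t - X n) - f t) < e" using fg * e by simp
      qed
    next
      fix a :: real assume "a < 0"
      then show "\<forall>\<^sub>F n in sequentially. a < energy (\<lambda>t. f (t - X n) - f t)"
        by (intro always_eventually allI) (use energy_nonneg order_less_le_trans in blast)
    qed
  qed
  then show ?thesis
    by (simp add: tendsto_nhds_iff energy_def)
qed

section \<open>Fourier transform and Gaussian summation\<close>

lemma borel_measurable_cis [measurable]: "cis \<in> borel_measurable borel"
  by (intro borel_measurable_continuous_onI continuous_intros)

lemma borel_measurable_cnj [measurable]: "cnj \<in> borel_measurable borel"
  by (intro borel_measurable_continuous_onI continuous_intros)

lemma norm_cis_mult [simp]: "cmod (z * cis x) = cmod z" "cmod (cis x * z) = cmod z"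
  by (simp_all add: norm_mult)

lemma integrable_mult_cis:
  fixes h :: "'a \<Rightarrow> complex"
  assumes "integrable M h" "\<theta> \<in> borel_measurable M"
  shows "integrable M (\<lambda>t. h t * cis (\<theta> t))"
  by (rule Bochner_Integration.integrable_bound[OF assms(1)]) (use assms in auto)

text \<open>Normalised so that the function equals its own Fourier transform.\<close>

definition gauss :: "real \<Rightarrow> real" where
  "gauss t = exp (- pi * t\<^sup>2)"

lemma gauss_measurable [measurable]: "gauss \<in> borel_measurable borel"
  unfolding gauss_def by measurable

lemma gauss_bounds: "0 < gauss t" "gauss t \<le> 1"
  by (simp_all add: gauss_def)

lemma gauss_eq_normal: "gauss t = sqrt (2 * pi) * std_normal_density (0 + sqrt (2 * pi) * t)"
  by (simp add: gauss_def std_normal_density_def power_mult_distrib)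

lemma has_integral_gauss: "integrable lborel gauss" "integral\<^sup>L lborel gauss = 1"
proof -
  have i: "integrable lborel std_normal_density" using integrable_std_normal_moment[of 0] by simp
  have "integral\<^sup>L lborel std_normal_density = \<bar>sqrt (2 * pi)\<bar> *\<^sub>R (\<integral>t. std_normal_density (0 + sqrt (2 * pi) * t) \<partial>lborel)"
    by (rule lborel_integral_real_affine) simp
  moreover have "integral\<^sup>L lborel std_normal_density = 1"
    using integral_std_normal_moment_even[of 0] by simp
  ultimately show "integral\<^sup>L lborel gauss = 1"
    unfolding gauss_eq_normal[abs_def] by simp
  have "integrable lborel (\<lambda>t. std_normal_density (0 + sqrt (2 * pi) * t))"
    by (rule lborel_integrable_real_affine[OF i]) simp
  then show "integrable lborel gauss"
    unfolding gauss_eq_normal[abs_def] by (rule integrable_mult_right)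
qed

definition fourier1 :: "(real \<Rightarrow> complex) \<Rightarrow> real \<Rightarrow> complex" where
  "fourier1 h \<omega> = (\<integral>t. h t * cis (- 2 * pi * t * \<omega>) \<partial>lborel)"

lemma fourier1_measurable [measurable]:
  assumes [measurable]: "h \<in> borel_measurable borel"
  shows "fourier1 h \<in> borel_measurable borel"
  unfolding fourier1_def by measurable

text \<open>A change of variables in the characteristic function of the standard normal distribution.\<close>

lemma fourier1_gauss: "fourier1 (\<lambda>t. complex_of_real (gauss t)) s = gauss s"
proof -
  let ?s = "- 2 * pi * s / sqrt (2 * pi)"
  have "char std_normal_distribution ?s = exp (- (?s\<^sup>2) / 2)"
    by (simp add: char_std_normal_distribution)
  also have "?s\<^sup>2 / 2 = pi * s\<^sup>2" by (simp add: power_divide power_mult_distrib power2_eq_square)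
  then have "exp (- (?s\<^sup>2) / 2) = gauss s" by (simp add: gauss_def)
  finally have c: "char std_normal_distribution ?s = gauss s" .
  have "char std_normal_distribution ?s = (\<integral>x. std_normal_density x *\<^sub>R cis (?s * x) \<partial>lborel)"
    unfolding char_def by (subst integral_density) (auto simp: cis_conv_exp)
  also have "\<dots> = \<bar>sqrt (2 * pi)\<bar> *\<^sub>R (\<integral>t. std_normal_density (0 + sqrt (2 * pi) * t) *\<^sub>R cis (?s * (0 + sqrt (2 * pi) * t)) \<partial>lborel)"
    by (rule lborel_integral_real_affine) simp
  also have "\<dots> = (\<integral>t. \<bar>sqrt (2 * pi)\<bar> *\<^sub>R (std_normal_density (0 + sqrt (2 * pi) * t) *\<^sub>R cis (?s * (0 + sqrt (2 * pi) * t))) \<partial>lborel)"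
    by (simp only: integral_scaleR_right)
  also have "\<dots> = fourier1 (\<lambda>t. complex_of_real (gauss t)) s"
    unfolding fourier1_def
    by (intro Bochner_Integration.integral_cong refl)
       (simp add: gauss_eq_normal scaleR_conv_of_real field_simps del: real_sqrt_mult)
  finally show ?thesis using c by simp
qed

lemma fourier1_gauss_dilated:
  assumes "0 < r"
  shows "(\<integral>\<omega>. complex_of_real (gauss (r * \<omega>)) * cis (- 2 * pi * q * \<omega>) \<partial>lborel) = gauss (q / r) / r"
proof -
  have "fourier1 (\<lambda>t. complex_of_real (gauss t)) (q / r) =
      \<bar>r\<bar> *\<^sub>R (\<integral>\<omega>. complex_of_real (gauss (0 + r * \<omega>)) * cis (- 2 * pi * (0 + r * \<omega>) * (q / r)) \<partial>lborel)"
    unfolding fourier1_def using assms by (intro lborel_integral_real_affine) auto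
  also have "(\<lambda>\<omega>. complex_of_real (gauss (0 + r * \<omega>)) * cis (- 2 * pi * (0 + r * \<omega>) * (q / r)))
     = (\<lambda>\<omega>. complex_of_real (gauss (r * \<omega>)) * cis (- 2 * pi * q * \<omega>))"
    using assms by (auto simp: field_simps)
  finally show ?thesis
    using assms by (simp add: fourier1_gauss scaleR_conv_of_real field_simps)
qed

lemma integrable_gauss_dilated:
  assumes "0 < r" shows "integrable lborel (\<lambda>\<omega>. gauss (r * \<omega>))"
  using lborel_integrable_real_affine[OF has_integral_gauss(1), of r 0] assms by simp

lemma integrable_lborel_pairI:
  fixes F :: "real \<times> real \<Rightarrow> complex"
  assumes "F \<in> borel_measurable (lborel \<Otimes>\<^sub>M lborel)"
    and "(\<integral>\<^sup>+x. \<integral>\<^sup>+y. ennreal (cmod (F (x, y))) \<partial>lborel \<partial>lborel) < \<infinity>"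
  shows "integrable (lborel \<Otimes>\<^sub>M lborel) F"
  using assms by (intro integrableI_bounded) (auto simp: lborel.nn_integral_fst[symmetric])

lemma nn_integral_reflect:
  fixes x :: real
  assumes "f \<in> borel_measurable borel"
  shows "(\<integral>\<^sup>+t. f (x - t) \<partial>lborel) = (\<integral>\<^sup>+t. f t \<partial>lborel)"
  by (subst (2) nn_integral_real_affine[where c="-1" and t="x"]) (use assms in auto)

lemma nn_integral_norm_finite:
  fixes h :: "'a \<Rightarrow> 'b::{banach, second_countable_topology}"
  shows "integrable M h \<Longrightarrow> (\<integral>\<^sup>+t. ennreal (norm (h t)) \<partial>M) < \<infinity>"
  by (auto simp: integrable_iff_bounded)

text \<open>The multiplication formula \<open>\<integral> c^ w = \<integral> c w^\<close> for the damping \<open>w(\<omega>) = gauss (r \<omega>)\<close>, rescaled so that the right-hand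
side averages \<open>c\<close> around \<open>-b\<close> against a weight independent of \<open>r\<close>. As \<open>r\<close> tends to 0 it becomes
Fourier inversion at \<open>-b\<close>.\<close>

lemma fourier1_multiplication_gauss:
  assumes c: "integrable lborel c" and r: "0 < r"
  shows "(\<integral>\<omega>. fourier1 c \<omega> * cis (- 2 * pi * \<omega> * b) * gauss (r * \<omega>) \<partial>lborel)
    = (\<integral>v. c (r * v - b) * gauss v \<partial>lborel)"
proof -
  have [measurable]: "c \<in> borel_measurable borel" using borel_measurable_integrable[OF c] by simp
  have "integrable (lborel \<Otimes>\<^sub>M lborel)
      (\<lambda>(q, \<omega>). c q * (complex_of_real (gauss (r * \<omega>)) * cis (- 2 * pi * (q + b) * \<omega>)))"
  proof (rule integrable_lborel_pairI)
    have "(\<integral>\<^sup>+q. \<integral>\<^sup>+\<omega>. ennreal (cmod (case (q, \<omega>) of (q, \<omega>) \<Rightarrow> c q * (complex_of_real (gauss (r * \<omega>)) * cis (- 2 * pi * (q + b) * \<omega>)))) \<partial>lborel \<partial>lborel)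
      = (\<integral>\<^sup>+q. ennreal (cmod (c q)) * (\<integral>\<^sup>+\<omega>. ennreal (norm (gauss (r * \<omega>))) \<partial>lborel) \<partial>lborel)"
      by (simp add: norm_mult ennreal_mult nn_integral_cmult)
    also have "\<dots> = (\<integral>\<^sup>+q. ennreal (cmod (c q)) \<partial>lborel) * (\<integral>\<^sup>+\<omega>. ennreal (norm (gauss (r * \<omega>))) \<partial>lborel)"
      by (simp add: nn_integral_multc)
    also have "\<dots> < \<infinity>"
      using nn_integral_norm_finite[OF c] nn_integral_norm_finite[OF integrable_gauss_dilated[OF r]]
      by (simp add: ennreal_mult_less_top)
    finally show "(\<integral>\<^sup>+q. \<integral>\<^sup>+\<omega>. ennreal (cmod (case (q, \<omega>) of (q, \<omega>) \<Rightarrow> c q * (complex_of_real (gauss (r * \<omega>)) * cis (- 2 * pi * (q + b) * \<omega>)))) \<partial>lborel \<partial>lborel) < \<infinity>" .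
  qed measurable
  note swap = lborel_pair.Fubini_integral[OF this]
  have "(\<integral>\<omega>. fourier1 c \<omega> * cis (- 2 * pi * \<omega> * b) * gauss (r * \<omega>) \<partial>lborel)
    = (\<integral>\<omega>. \<integral>q. c q * (complex_of_real (gauss (r * \<omega>)) * cis (- 2 * pi * (q + b) * \<omega>)) \<partial>lborel \<partial>lborel)"
    unfolding fourier1_def
    by (intro Bochner_Integration.integral_cong refl, simp flip: integral_mult_left_zero)
       (intro Bochner_Integration.integral_cong refl, simp add: cis_mult mult_ac, simp add: algebra_simps)
  also have "\<dots> = (\<integral>q. c q * (gauss ((q + b) / r) / r) \<partial>lborel)"
    unfolding swap by (simp only: integral_mult_right_zero fourier1_gauss_dilated[OF r])
  also have "\<dots> = \<bar>r\<bar> *\<^sub>R (\<integral>v. c (- b + r * v) * (gauss ((- b + r * v + b) / r) / r) \<partial>lborel)"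
    using r by (intro lborel_integral_real_affine) auto
  also have "\<dots> = (\<integral>v. \<bar>r\<bar> *\<^sub>R (c (- b + r * v) * (gauss ((- b + r * v + b) / r) / r)) \<partial>lborel)"
    by simp
  also have "\<dots> = (\<integral>v. c (r * v - b) * gauss v \<partial>lborel)"
    using r by (intro Bochner_Integration.integral_cong refl) (simp add: scaleR_conv_of_real field_simps)
  finally show ?thesis .
qed

definition autocorr :: "(real \<Rightarrow> complex) \<Rightarrow> real \<Rightarrow> complex" where
  "autocorr h q = (\<integral>t. h t * cnj (h (t - q)) \<partial>lborel)"

text \<open>The convolution theorem for \<open>h\<close> and its reflected conjugate, which turns the squared modulus of a
Fourier transform into a Fourier transform to which the multiplication formula applies.\<close>

lemma autocorr:
  assumes h: "integrable lborel h"
  shows integrable_autocorr: "integrable lborel (autocorr h)"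
    and fourier1_autocorr: "fourier1 (autocorr h) \<omega> = complex_of_real ((cmod (fourier1 h \<omega>))\<^sup>2)"
proof -
  have [measurable]: "h \<in> borel_measurable borel" using borel_measurable_integrable[OF h] by simp
  let ?F = "\<lambda>\<omega> (q, t). h t * cnj (h (t - q)) * cis (- 2 * pi * q * \<omega>)"
  have int: "integrable (lborel \<Otimes>\<^sub>M lborel) (?F \<omega>)" for \<omega>
  proof (rule integrable_lborel_pairI)
    have "(\<integral>\<^sup>+q. \<integral>\<^sup>+t. ennreal (cmod (?F \<omega> (q, t))) \<partial>lborel \<partial>lborel)
      = (\<integral>\<^sup>+q. \<integral>\<^sup>+t. ennreal (cmod (h t)) * ennreal (cmod (h (t - q))) \<partial>lborel \<partial>lborel)"
      by (simp add: norm_mult ennreal_mult)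
    also have "\<dots> = (\<integral>\<^sup>+t. \<integral>\<^sup>+q. ennreal (cmod (h t)) * ennreal (cmod (h (t - q))) \<partial>lborel \<partial>lborel)"
      by (rule lborel_pair.Fubini') measurable
    also have "\<dots> = (\<integral>\<^sup>+t. ennreal (cmod (h t)) * (\<integral>\<^sup>+q. ennreal (cmod (h q)) \<partial>lborel) \<partial>lborel)"
      by (simp add: nn_integral_cmult nn_integral_reflect[of "\<lambda>s. ennreal (cmod (h s))"])
    also have "\<dots> < \<infinity>"
      using nn_integral_norm_finite[OF h] by (simp add: nn_integral_multc ennreal_mult_less_top)
    finally show "(\<integral>\<^sup>+q. \<integral>\<^sup>+t. ennreal (cmod (?F \<omega> (q, t))) \<partial>lborel \<partial>lborel) < \<infinity>" .
  qed measurable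
  show "integrable lborel (autocorr h)"
    using lborel_pair.integrable_fst'[OF int[of 0]] by (simp add: autocorr_def[abs_def])
  have "fourier1 (autocorr h) \<omega> = (\<integral>q. \<integral>t. h t * cnj (h (t - q)) * cis (- 2 * pi * q * \<omega>) \<partial>lborel \<partial>lborel)"
    by (simp add: fourier1_def autocorr_def flip: integral_mult_left_zero)
  also have "\<dots> = (\<integral>t. \<integral>q. h t * cnj (h (t - q)) * cis (- 2 * pi * q * \<omega>) \<partial>lborel \<partial>lborel)"
    by (rule lborel_pair.Fubini_integral[symmetric]) (rule int)
  also have "\<dots> = (\<integral>t. h t * cis (- 2 * pi * t * \<omega>) * cnj (fourier1 h \<omega>) \<partial>lborel)"
  proof (intro Bochner_Integration.integral_cong refl)
    fix t
    have "(\<integral>q. h t * cnj (h (t - q)) * cis (- 2 * pi * q * \<omega>) \<partial>lborel)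
      = h t * (\<integral>q. cnj (h (t - q)) * cis (- 2 * pi * q * \<omega>) \<partial>lborel)"
      by (simp add: mult.assoc)
    also have "(\<integral>q. cnj (h (t - q)) * cis (- 2 * pi * q * \<omega>) \<partial>lborel)
      = (\<integral>q. cnj (h q) * cis (- 2 * pi * (t - q) * \<omega>) \<partial>lborel)"
      by (subst lborel_integral_real_affine[where c="-1" and t=t]) simp_all
    also have "\<dots> = (\<integral>q. cis (- 2 * pi * t * \<omega>) * cnj (h q * cis (- 2 * pi * q * \<omega>)) \<partial>lborel)"
      by (intro Bochner_Integration.integral_cong refl)
         (simp add: cis_cnj cis_mult mult.left_commute algebra_simps)
    also have "\<dots> = cis (- 2 * pi * t * \<omega>) * cnj (fourier1 h \<omega>)"
      unfolding fourier1_def by (simp only: integral_mult_right_zero Bochner_Integration.integral_cnj)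
    finally show "(\<integral>q. h t * cnj (h (t - q)) * cis (- 2 * pi * q * \<omega>) \<partial>lborel)
      = h t * cis (- 2 * pi * t * \<omega>) * cnj (fourier1 h \<omega>)" by (simp add: mult.assoc)
  qed
  also have "\<dots> = fourier1 h \<omega> * cnj (fourier1 h \<omega>)"
    by (simp add: fourier1_def)
  finally show "fourier1 (autocorr h) \<omega> = complex_of_real ((cmod (fourier1 h \<omega>))\<^sup>2)"
    by (simp add: complex_mult_cnj cmod_def)
qed

lemma autocorr_bound:
  assumes "sq_integrable h"
  shows "cmod (autocorr h q) \<le> energy h"
proof -
  have "cmod (autocorr h q) \<le> (\<integral>t. cmod (h t * cnj (h (t - q))) \<partial>lborel)"
    unfolding autocorr_def by (rule integral_norm_bound)
  also have "\<dots> \<le> sqrt (energy h) * sqrt (energy (\<lambda>t. h (t - q)))"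
    using Cauchy_Schwarz_energy(2)[OF assms sq_integrable_shift(1)[OF assms]] by (simp add: norm_mult)
  finally show ?thesis by (simp add: sq_integrable_shift[OF assms] energy_nonneg)
qed

lemma gauss_dilated_limit: "(\<lambda>n. gauss (1 / real (Suc n) * \<omega>)) \<longlonglongrightarrow> 1"
proof -
  have "(\<lambda>n. gauss (1 / real (Suc n) * \<omega>)) \<longlonglongrightarrow> exp (- pi * (0 * \<omega>)\<^sup>2)"
    unfolding gauss_def by (intro tendsto_intros LIMSEQ_Suc lim_1_over_n)
  then show ?thesis by simp
qed

text \<open>Damping by \<open>gauss (r \<omega>)\<close> turns the left-hand side into an average of the autocorrelation, which is bounded by its
value at 0, the energy of \<open>h\<close>; Fatou's lemma removes the damping.\<close>

lemma Plancherel_le: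
  assumes h: "integrable lborel h"
  shows "(\<integral>\<^sup>+\<omega>. ennreal ((cmod (fourier1 h \<omega>))\<^sup>2) \<partial>lborel) \<le> (\<integral>\<^sup>+t. ennreal ((cmod (h t))\<^sup>2) \<partial>lborel)"
proof (cases "(\<integral>\<^sup>+t. ennreal ((cmod (h t))\<^sup>2) \<partial>lborel) = \<infinity>")
  case False
  have [measurable]: "h \<in> borel_measurable borel" using borel_measurable_integrable[OF h] by simp
  have sh: "sq_integrable h"
    using False by (auto simp: sq_integrable_def integrable_iff_bounded less_top)
  let ?r = "\<lambda>n. 1 / real (Suc n)"
  let ?u = "\<lambda>n \<omega>. ennreal ((cmod (fourier1 h \<omega>))\<^sup>2 * gauss (?r n * \<omega>))"
  have bd: "cmod (fourier1 h \<omega>) \<le> (\<integral>t. cmod (h t) \<partial>lborel)" for \<omega>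
    unfolding fourier1_def using integral_norm_bound[of lborel "\<lambda>t. h t * cis (- 2 * pi * t * \<omega>)"] by simp
  have le: "(\<integral>\<^sup>+\<omega>. ?u n \<omega> \<partial>lborel) \<le> ennreal (energy h)" for n
  proof -
    have i: "integrable lborel (\<lambda>\<omega>. (cmod (fourier1 h \<omega>))\<^sup>2 * gauss (?r n * \<omega>))"
    proof (rule Bochner_Integration.integrable_bound)
      show "integrable lborel (\<lambda>\<omega>. (\<integral>t. cmod (h t) \<partial>lborel)\<^sup>2 * gauss (?r n * \<omega>))"
        by (intro integrable_mult_right integrable_gauss_dilated) simp
      show "AE \<omega> in lborel. norm ((cmod (fourier1 h \<omega>))\<^sup>2 * gauss (?r n * \<omega>))
          \<le> norm ((\<integral>t. cmod (h t) \<partial>lborel)\<^sup>2 * gauss (?r n * \<omega>))"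
        using bd by (intro AE_I2) (auto simp: abs_mult intro!: mult_right_mono power_mono)
    qed measurable
    have "complex_of_real (\<integral>\<omega>. (cmod (fourier1 h \<omega>))\<^sup>2 * gauss (?r n * \<omega>) \<partial>lborel)
      = (\<integral>\<omega>. fourier1 (autocorr h) \<omega> * cis (- 2 * pi * \<omega> * 0) * gauss (?r n * \<omega>) \<partial>lborel)"
      by (simp add: fourier1_autocorr[OF h] flip: integral_complex_of_real)
    also have "\<dots> = (\<integral>v. autocorr h (?r n * v - 0) * gauss v \<partial>lborel)"
      by (rule fourier1_multiplication_gauss[OF integrable_autocorr[OF h]]) simp
    finally have eq: "complex_of_real (\<integral>\<omega>. (cmod (fourier1 h \<omega>))\<^sup>2 * gauss (?r n * \<omega>) \<partial>lborel)
      = (\<integral>v. autocorr h (?r n * v - 0) * gauss v \<partial>lborel)" .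
    have "cmod (complex_of_real (\<integral>\<omega>. (cmod (fourier1 h \<omega>))\<^sup>2 * gauss (?r n * \<omega>) \<partial>lborel))
       \<le> (\<integral>v. cmod (autocorr h (?r n * v - 0) * gauss v) \<partial>lborel)"
      unfolding eq by (rule integral_norm_bound)
    also have "\<dots> \<le> (\<integral>v. energy h * gauss v \<partial>lborel)"
    proof (rule integral_mono')
      show "integrable lborel (\<lambda>v. energy h * gauss v)" by (intro integrable_mult_right has_integral_gauss)
      show "cmod (autocorr h (?r n * v - 0) * gauss v) \<le> energy h * gauss v" for v
        using gauss_bounds(1)[of v] autocorr_bound[OF sh] by (simp add: norm_mult)
    qed (simp add: energy_nonneg gauss_bounds less_imp_le)
    finally have "(\<integral>\<omega>. (cmod (fourier1 h \<omega>))\<^sup>2 * gauss (?r n * \<omega>) \<partial>lborel) \<le> energy h"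
      by (simp add: has_integral_gauss)
    then show ?thesis
      by (subst nn_integral_eq_integral[OF i]) (auto simp: gauss_bounds less_imp_le intro!: ennreal_leI)
  qed
  have "(\<integral>\<^sup>+\<omega>. ennreal ((cmod (fourier1 h \<omega>))\<^sup>2) \<partial>lborel) = (\<integral>\<^sup>+\<omega>. liminf (\<lambda>n. ?u n \<omega>) \<partial>lborel)"
  proof (intro nn_integral_cong)
    fix \<omega>
    have "(\<lambda>n. ?u n \<omega>) \<longlonglongrightarrow> ennreal ((cmod (fourier1 h \<omega>))\<^sup>2 * 1)"
      by (intro tendsto_intros gauss_dilated_limit)
    then show "ennreal ((cmod (fourier1 h \<omega>))\<^sup>2) = liminf (\<lambda>n. ?u n \<omega>)"
      by (simp add: lim_imp_Liminf)
  qed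
  also have "\<dots> \<le> liminf (\<lambda>n. \<integral>\<^sup>+\<omega>. ?u n \<omega> \<partial>lborel)"
    by (rule nn_integral_liminf) measurable
  also have "\<dots> \<le> ennreal (energy h)"
    using le by (intro Liminf_le) auto
  finally show ?thesis by (simp add: nn_integral_energy[OF sh])
qed simp

section \<open>Short-time Fourier transforms\<close>

text \<open>The Fourier transform of \<open>windowed g f x\<close> is the row \<open>V\<^sub>g f (x, \<cdot>)\<close> of the short-time Fourier transform.\<close>

definition windowed :: "(real \<Rightarrow> complex) \<Rightarrow> (real \<Rightarrow> complex) \<Rightarrow> real \<Rightarrow> real \<Rightarrow> complex" where
  "windowed g f x t = f t * cnj (g (t - x))"

lemma norm_integral_le_nn_integral:
  fixes F :: "'a \<Rightarrow> complex"
  shows "ennreal (cmod (\<integral>t. F t \<partial>M)) \<le> (\<integral>\<^sup>+t. ennreal (cmod (F t)) \<partial>M)"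
  using integral_norm_bound_ennreal[of M F] by (cases "integrable M F") (auto simp: not_integrable_integral_eq)

lemma windowed_integrable:
  assumes "sq_integrable f" "sq_integrable g"
  shows "integrable lborel (windowed g f x)"
    and "(\<integral>t. cmod (windowed g f x t) \<partial>lborel) \<le> sqrt (energy f) * sqrt (energy g)"
proof -
  have [measurable]: "f \<in> borel_measurable borel" "g \<in> borel_measurable borel"
    using assms by (auto simp: sq_integrable_def)
  note cs = Cauchy_Schwarz_energy[OF assms(1) sq_integrable_shift(1)[OF assms(2), of x]]
  show "integrable lborel (windowed g f x)"
    by (rule Bochner_Integration.integrable_bound[OF cs(1)]) (auto simp: windowed_def[abs_def] norm_mult)
  show "(\<integral>t. cmod (windowed g f x t) \<partial>lborel) \<le> sqrt (energy f) * sqrt (energy g)"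
    using cs(2) by (simp add: windowed_def norm_mult sq_integrable_shift[OF assms(2)])
qed

lemma norm_fourier1_le:
  "cmod (fourier1 h \<omega>) \<le> (\<integral>t. cmod (h t) \<partial>lborel)"
  unfolding fourier1_def using integral_norm_bound[of lborel "\<lambda>t. h t * cis (- 2 * pi * t * \<omega>)"] by simp

lemma norm_fourier1_windowed:
  assumes "sq_integrable f" "sq_integrable g"
  shows "cmod (fourier1 (windowed g f x) \<omega>) \<le> sqrt (energy f) * sqrt (energy g)"
  using norm_fourier1_le windowed_integrable(2)[OF assms] order_trans by blast

lemma windowed_measurable [measurable]:
  assumes [measurable]: "f \<in> borel_measurable borel" "g \<in> borel_measurable borel"
  shows "windowed g f x \<in> borel_measurable borel"
  unfolding windowed_def[abs_def] by measurable

lemma fourier1_windowed_measurable [measurable]: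
  assumes [measurable]: "f \<in> borel_measurable borel" "g \<in> borel_measurable borel"
  shows "(\<lambda>(x, \<omega>). fourier1 (windowed g f x) \<omega>) \<in> borel_measurable (borel \<Otimes>\<^sub>M borel)"
  unfolding fourier1_def windowed_def by measurable

lemma autocorr_windowed_measurable [measurable]:
  assumes [measurable]: "f \<in> borel_measurable borel" "g \<in> borel_measurable borel"
  shows "(\<lambda>(x, q). autocorr (windowed g f x) q) \<in> borel_measurable (borel \<Otimes>\<^sub>M borel)"
  unfolding autocorr_def windowed_def by measurable

text \<open>Absolute convergence for the interchanges that involve \<open>x\<close>: integrating over \<open>x\<close> first separates the factors of \<open>f\<close> from those
of \<open>g\<close>, and each group is bounded by the Cauchy-Schwarz inequality.\<close>

lemma autocorr_windowed_L1:
  assumes f: "sq_integrable f" and g: "sq_integrable g"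
  shows "(\<integral>\<^sup>+x. \<integral>\<^sup>+t. ennreal (cmod (windowed g f x t * cnj (windowed g f x (t - q)))) \<partial>lborel \<partial>lborel)
    \<le> ennreal (energy f * energy g)"
proof -
  have [measurable]: "f \<in> borel_measurable borel" "g \<in> borel_measurable borel"
    using assms by (auto simp: sq_integrable_def)
  \<comment> \<open>oriented with \<open>q\<close> fixed, so that rewriting terminates\<close>
  have comm: "s - q - y = s - y - q" for s y by simp
  have cs: "(\<integral>\<^sup>+t. ennreal (cmod (u t)) * ennreal (cmod (u (t - q))) \<partial>lborel) \<le> ennreal (energy u)"
    if "sq_integrable u" for u
  proof -
    note c = Cauchy_Schwarz_energy[OF that sq_integrable_shift(1)[OF that, of q]]
    have "(\<integral>\<^sup>+t. ennreal (cmod (u t)) * ennreal (cmod (u (t - q))) \<partial>lborel)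
      = ennreal (\<integral>t. cmod (u t) * cmod (u (t - q)) \<partial>lborel)"
      by (subst nn_integral_eq_integral[OF c(1), symmetric]) (auto simp: ennreal_mult)
    also have "\<dots> \<le> ennreal (energy u)"
      using c(2) by (intro ennreal_leI) (simp add: sq_integrable_shift[OF that] energy_nonneg)
    finally show ?thesis .
  qed
  have "(\<integral>\<^sup>+x. \<integral>\<^sup>+t. ennreal (cmod (windowed g f x t * cnj (windowed g f x (t - q)))) \<partial>lborel \<partial>lborel)
    = (\<integral>\<^sup>+x. \<integral>\<^sup>+t. (ennreal (cmod (f t)) * ennreal (cmod (f (t - q))))
        * (ennreal (cmod (g (t - x))) * ennreal (cmod (g (t - x - q)))) \<partial>lborel \<partial>lborel)"
    by (intro nn_integral_cong) (simp add: windowed_def norm_mult ennreal_mult mult_ac comm)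
  also have "\<dots> = (\<integral>\<^sup>+t. \<integral>\<^sup>+x. (ennreal (cmod (f t)) * ennreal (cmod (f (t - q))))
        * (ennreal (cmod (g (t - x))) * ennreal (cmod (g (t - x - q)))) \<partial>lborel \<partial>lborel)"
    by (rule lborel_pair.Fubini') measurable
  also have "\<dots> = (\<integral>\<^sup>+t. (ennreal (cmod (f t)) * ennreal (cmod (f (t - q))))
        * (\<integral>\<^sup>+v. ennreal (cmod (g v)) * ennreal (cmod (g (v - q))) \<partial>lborel) \<partial>lborel)"
    using nn_integral_reflect[of "\<lambda>v. ennreal (cmod (g v)) * ennreal (cmod (g (v - q)))"]
    by (simp add: nn_integral_cmult)
  also have "\<dots> = (\<integral>\<^sup>+t. ennreal (cmod (f t)) * ennreal (cmod (f (t - q))) \<partial>lborel)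
        * (\<integral>\<^sup>+v. ennreal (cmod (g v)) * ennreal (cmod (g (v - q))) \<partial>lborel)"
    by (rule nn_integral_multc) measurable
  also have "\<dots> \<le> ennreal (energy f) * ennreal (energy g)"
    by (intro mult_mono cs f g) auto
  finally show ?thesis by (simp add: ennreal_mult energy_nonneg)
qed

text \<open>The factorisation behind the relation between spectrogram and ambiguity functions: in the autocorrelation
of \<open>f(t) cnj (g(t - x))\<close> the substitution \<open>v = t - x\<close> decouples the integral over \<open>x\<close> from the one over \<open>t\<close>.\<close>

lemma integral_autocorr_windowed:
  assumes f: "sq_integrable f" and g: "sq_integrable g"
  shows "(\<integral>x. cis (- 2 * pi * x * a) * autocorr (windowed g f x) q \<partial>lborel)
    = fourier1 (windowed f f q) a * cnj (fourier1 (windowed g g q) a)"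
proof -
  have [measurable]: "f \<in> borel_measurable borel" "g \<in> borel_measurable borel"
    using assms by (auto simp: sq_integrable_def)
  have comm: "s - q - y = s - y - q" for s y by simp
  let ?F = "\<lambda>(x, t). cis (- 2 * pi * x * a) * (windowed g f x t * cnj (windowed g f x (t - q)))"
  have "integrable (lborel \<Otimes>\<^sub>M lborel) ?F"
  proof (rule integrable_lborel_pairI)
    show "?F \<in> borel_measurable (lborel \<Otimes>\<^sub>M lborel)"
      unfolding windowed_def by measurable
    show "(\<integral>\<^sup>+x. \<integral>\<^sup>+t. ennreal (cmod (?F (x, t))) \<partial>lborel \<partial>lborel) < \<infinity>"
      using order_le_less_trans[OF autocorr_windowed_L1[OF f g, of q]] by simp
  qed
  note swap = lborel_pair.Fubini_integral[OF this]
  have "(\<integral>x. cis (- 2 * pi * x * a) * autocorr (windowed g f x) q \<partial>lborel)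
    = (\<integral>x. \<integral>t. cis (- 2 * pi * x * a) * (windowed g f x t * cnj (windowed g f x (t - q))) \<partial>lborel \<partial>lborel)"
    by (simp only: autocorr_def integral_mult_right_zero)
  also have "\<dots> = (\<integral>t. \<integral>x. cis (- 2 * pi * x * a) * (windowed g f x t * cnj (windowed g f x (t - q))) \<partial>lborel \<partial>lborel)"
    by (rule swap[symmetric])
  also have "\<dots> = (\<integral>t. windowed f f q t * cis (- 2 * pi * t * a) * cnj (fourier1 (windowed g g q) a) \<partial>lborel)"
  proof (intro Bochner_Integration.integral_cong refl)
    fix t
    have "(\<integral>x. cis (- 2 * pi * x * a) * (windowed g f x t * cnj (windowed g f x (t - q))) \<partial>lborel)
      = (\<integral>x. windowed f f q t * (cis (- 2 * pi * x * a) * cnj (g (t - x)) * g (t - x - q)) \<partial>lborel)"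
      by (intro Bochner_Integration.integral_cong refl) (simp add: windowed_def mult_ac comm)
    also have "\<dots> = windowed f f q t * (\<integral>x. cis (- 2 * pi * x * a) * cnj (g (t - x)) * g (t - x - q) \<partial>lborel)"
      by (simp only: integral_mult_right_zero)
    also have "(\<integral>x. cis (- 2 * pi * x * a) * cnj (g (t - x)) * g (t - x - q) \<partial>lborel)
      = (\<integral>v. cis (- 2 * pi * (t - v) * a) * cnj (g v) * g (v - q) \<partial>lborel)"
      by (subst lborel_integral_real_affine[where c="-1" and t=t]) simp_all
    also have "\<dots> = (\<integral>v. cis (- 2 * pi * t * a) * cnj (windowed g g q v * cis (- 2 * pi * v * a)) \<partial>lborel)"
    proof (intro Bochner_Integration.integral_cong refl)
      fix v
      have "cis (- 2 * pi * (t - v) * a) = cis (- 2 * pi * t * a) * cnj (cis (- 2 * pi * v * a))"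
        by (simp add: cis_cnj cis_mult algebra_simps)
      then show "cis (- 2 * pi * (t - v) * a) * cnj (g v) * g (v - q)
        = cis (- 2 * pi * t * a) * cnj (windowed g g q v * cis (- 2 * pi * v * a))"
        by (simp add: windowed_def mult_ac)
    qed
    also have "\<dots> = cis (- 2 * pi * t * a) * cnj (fourier1 (windowed g g q) a)"
      unfolding fourier1_def by (simp only: integral_mult_right_zero Bochner_Integration.integral_cnj)
    finally show "(\<integral>x. cis (- 2 * pi * x * a) * (windowed g f x t * cnj (windowed g f x (t - q))) \<partial>lborel)
      = windowed f f q t * cis (- 2 * pi * t * a) * cnj (fourier1 (windowed g g q) a)"
      by (simp add: mult.assoc)
  qed
  also have "\<dots> = fourier1 (windowed f f q) a * cnj (fourier1 (windowed g g q) a)"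
    unfolding fourier1_def by (simp only: integral_mult_left_zero)
  finally show ?thesis .
qed

lemma fourier1_windowed_diff_le:
  assumes f: "sq_integrable f"
  shows "cmod (fourier1 (windowed f f q) a - fourier1 (windowed f f q') a)
    \<le> sqrt (energy f) * sqrt (energy (\<lambda>t. f (t - (q - q')) - f t))"
proof -
  have d: "sq_integrable (\<lambda>t. f (t - q) - f (t - q'))"
    by (intro sq_integrable_diff sq_integrable_shift f)
  have "energy (\<lambda>t. f (t - q) - f (t - q')) = energy (\<lambda>t. f (t - (q - q')) - f t)"
    using sq_integrable_shift(2)[of "\<lambda>t. f (t - (q - q')) - f t" q'] 
    by (simp add: sq_integrable_diff sq_integrable_shift f)
  moreover have "fourier1 (windowed f f q) a - fourier1 (windowed f f q') a
    = (\<integral>t. f t * cnj (f (t - q) - f (t - q')) * cis (- 2 * pi * t * a) \<partial>lborel)"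
    unfolding fourier1_def
    by (subst Bochner_Integration.integral_diff[symmetric])
       (auto intro!: integrable_mult_cis windowed_integrable[unfolded windowed_def[abs_def]] f
          Bochner_Integration.integral_cong simp: windowed_def ring_distribs)
  moreover have "cmod (\<integral>t. f t * cnj (f (t - q) - f (t - q')) * cis (- 2 * pi * t * a) \<partial>lborel)
    \<le> (\<integral>t. cmod (f t * cnj (f (t - q) - f (t - q')) * cis (- 2 * pi * t * a)) \<partial>lborel)"
    by (rule integral_norm_bound)
  moreover have "(\<integral>t. cmod (f t * cnj (f (t - q) - f (t - q')) * cis (- 2 * pi * t * a)) \<partial>lborel)
     = (\<integral>t. cmod (f t) * cmod (f (t - q) - f (t - q')) \<partial>lborel)"
    by (simp only: norm_cis_mult norm_mult complex_mod_cnj norm_cis mult_1_right)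
  ultimately show ?thesis
    using Cauchy_Schwarz_energy(2)[OF f d] by simp
qed

lemma continuous_fourier1_windowed:
  assumes f: "sq_integrable f"
  shows "isCont (\<lambda>q. fourier1 (windowed f f q) a) q'"
proof -
  have "((\<lambda>q. energy (\<lambda>t. f (t - (q - q')) - f t)) \<longlongrightarrow> 0) (at q')"
  proof (rule filterlim_compose[OF translation_continuous[OF f]])
    show "((\<lambda>q. q - q') \<longlongrightarrow> 0) (at q')" by (auto intro!: tendsto_eq_intros)
  qed
  then have "((\<lambda>q. sqrt (energy f) * sqrt (energy (\<lambda>t. f (t - (q - q')) - f t))) \<longlongrightarrow> sqrt (energy f) * sqrt 0) (at q')"
    by (intro tendsto_intros)
  then have "((\<lambda>q. sqrt (energy f) * sqrt (energy (\<lambda>t. f (t - (q - q')) - f t))) \<longlongrightarrow> 0) (at q')"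
    by simp
  then have "((\<lambda>q. fourier1 (windowed f f q) a - fourier1 (windowed f f q') a) \<longlongrightarrow> 0) (at q')"
    by (rule Lim_null_comparison[rotated]) (auto intro!: always_eventually fourier1_windowed_diff_le[OF f])
  then show ?thesis unfolding isCont_def by (simp add: LIM_zero_iff)
qed

text \<open>Apply the Plancherel inequality on each vertical line; the resulting integral of \<open>|f(t)|\<^sup>2 |g(t - x)|\<^sup>2\<close> factors.\<close>

lemma stft_square_integrable:
  assumes f: "sq_integrable f" and g: "sq_integrable g"
  shows "integrable (lborel \<Otimes>\<^sub>M lborel) (\<lambda>(x, \<omega>). complex_of_real ((cmod (fourier1 (windowed g f x) \<omega>))\<^sup>2))"
proof (rule integrable_lborel_pairI)
  have [measurable]: "f \<in> borel_measurable borel" "g \<in> borel_measurable borel"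
    using assms by (auto simp: sq_integrable_def)
  show "(\<lambda>(x, \<omega>). complex_of_real ((cmod (fourier1 (windowed g f x) \<omega>))\<^sup>2)) \<in> borel_measurable (lborel \<Otimes>\<^sub>M lborel)"
    unfolding fourier1_def windowed_def by measurable
  have "(\<integral>\<^sup>+x. \<integral>\<^sup>+\<omega>. ennreal ((cmod (fourier1 (windowed g f x) \<omega>))\<^sup>2) \<partial>lborel \<partial>lborel)
    \<le> (\<integral>\<^sup>+x. \<integral>\<^sup>+t. ennreal ((cmod (windowed g f x t))\<^sup>2) \<partial>lborel \<partial>lborel)"
    by (intro nn_integral_mono Plancherel_le windowed_integrable f g)
  also have "\<dots> = (\<integral>\<^sup>+x. \<integral>\<^sup>+t. ennreal ((cmod (f t))\<^sup>2) * ennreal ((cmod (g (t - x)))\<^sup>2) \<partial>lborel \<partial>lborel)"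
    by (simp add: windowed_def norm_mult power_mult_distrib ennreal_mult)
  also have "\<dots> = (\<integral>\<^sup>+t. \<integral>\<^sup>+x. ennreal ((cmod (f t))\<^sup>2) * ennreal ((cmod (g (t - x)))\<^sup>2) \<partial>lborel \<partial>lborel)"
    by (rule lborel_pair.Fubini') measurable
  also have "\<dots> = (\<integral>\<^sup>+t. ennreal ((cmod (f t))\<^sup>2) * ennreal (energy g) \<partial>lborel)"
    using nn_integral_reflect[of "\<lambda>v. ennreal ((cmod (g v))\<^sup>2)"]
    by (simp add: nn_integral_cmult nn_integral_energy[OF g])
  also have "\<dots> = ennreal (energy f) * ennreal (energy g)"
    by (simp add: nn_integral_multc nn_integral_energy[OF f])
  also have "\<dots> < \<infinity>" by (simp add: ennreal_mult_less_top)
  finally show "(\<integral>\<^sup>+x. \<integral>\<^sup>+\<omega>. ennreal (cmod (case (x, \<omega>) of (x, \<omega>) \<Rightarrow>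
      complex_of_real ((cmod (fourier1 (windowed g f x) \<omega>))\<^sup>2))) \<partial>lborel \<partial>lborel) < \<infinity>"
    by (simp add: norm_power)
qed

text \<open>With the damping \<open>gauss (r\<^sub>n \<omega>)\<close> the integral equals the average \<open>\<integral> gauss v H(r\<^sub>n v - b) dv\<close> of the product \<open>H\<close>
of the two transforms on the right. As \<open>r\<^sub>n\<close> tends to 0 the left-hand side converges because the squared modulus is integrable, and the
average converges to \<open>H(-b)\<close> because \<open>H\<close> is bounded and continuous.\<close>

lemma fourier_spectrogram:
  assumes f: "sq_integrable f" and g: "sq_integrable g"
  shows "(\<integral>(x, \<omega>). (cmod (fourier1 (windowed g f x) \<omega>))\<^sup>2 * cis (- 2 * pi * (x * a + \<omega> * b)) \<partial>(lborel \<Otimes>\<^sub>M lborel))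
    = fourier1 (windowed f f (- b)) a * cnj (fourier1 (windowed g g (- b)) a)"
proof -
  have fm[measurable]: "f \<in> borel_measurable borel" "g \<in> borel_measurable borel"
    using assms by (auto simp: sq_integrable_def)
  note [measurable] = fourier1_windowed_measurable[OF fm] autocorr_windowed_measurable[OF fm]
  define V where "V = (\<lambda>(x, \<omega>). complex_of_real ((cmod (fourier1 (windowed g f x) \<omega>))\<^sup>2))"
  define H where "H q = fourier1 (windowed f f q) a * cnj (fourier1 (windowed g g q) a)" for q
  define r where "r n = 1 / real (Suc n)" for n
  have r: "0 < r n" for n by (simp add: r_def)
  have V: "integrable (lborel \<Otimes>\<^sub>M lborel) V"
    unfolding V_def by (rule stft_square_integrable[OF f g])
  have [measurable]: "V \<in> borel_measurable (lborel \<Otimes>\<^sub>M lborel)"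
    using V by (rule borel_measurable_integrable)
  define G where "G n z = V z * cis (- 2 * pi * (fst z * a + snd z * b)) * gauss (r n * snd z)" for n and z :: "real \<times> real"
  have Gm[measurable]: "G n \<in> borel_measurable (lborel \<Otimes>\<^sub>M lborel)" for n
    unfolding G_def by measurable
  have Gint: "integrable (lborel \<Otimes>\<^sub>M lborel) (G n)" for n
    by (rule Bochner_Integration.integrable_bound[OF V])
       (auto simp: G_def norm_mult gauss_bounds less_imp_le intro!: mult_left_le)
  have Heq: "(\<integral>z. G n z \<partial>(lborel \<Otimes>\<^sub>M lborel)) = (\<integral>v. gauss v * H (r n * v - b) \<partial>lborel)" for n
  proof -
    have "(\<integral>z. G n z \<partial>(lborel \<Otimes>\<^sub>M lborel)) = (\<integral>x. \<integral>\<omega>. G n (x, \<omega>) \<partial>lborel \<partial>lborel)"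
      by (rule lborel_pair.integral_fst'[symmetric, OF Gint])
    also have "\<dots> = (\<integral>x. cis (- 2 * pi * x * a) * (\<integral>v. autocorr (windowed g f x) (r n * v - b) * gauss v \<partial>lborel) \<partial>lborel)"
    proof (intro Bochner_Integration.integral_cong refl)
      fix x
      have w: "integrable lborel (windowed g f x)" by (rule windowed_integrable[OF f g])
      have "(\<integral>\<omega>. G n (x, \<omega>) \<partial>lborel) = (\<integral>\<omega>. cis (- 2 * pi * x * a) *
          (fourier1 (autocorr (windowed g f x)) \<omega> * cis (- 2 * pi * \<omega> * b) * gauss (r n * \<omega>)) \<partial>lborel)"
      proof (intro Bochner_Integration.integral_cong refl)
        fix \<omega>
        have "cis (- 2 * pi * (x * a + \<omega> * b)) = cis (- 2 * pi * x * a) * cis (- 2 * pi * \<omega> * b)"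
          by (simp add: cis_mult algebra_simps)
        then show "G n (x, \<omega>) = cis (- 2 * pi * x * a) *
          (fourier1 (autocorr (windowed g f x)) \<omega> * cis (- 2 * pi * \<omega> * b) * gauss (r n * \<omega>))"
          by (simp add: G_def V_def fourier1_autocorr[OF w])
      qed
      also have "\<dots> = cis (- 2 * pi * x * a) * (\<integral>v. autocorr (windowed g f x) (r n * v - b) * gauss v \<partial>lborel)"
        by (simp only: integral_mult_right_zero fourier1_multiplication_gauss[OF integrable_autocorr[OF w] r])
      finally show "(\<integral>\<omega>. G n (x, \<omega>) \<partial>lborel)
        = cis (- 2 * pi * x * a) * (\<integral>v. autocorr (windowed g f x) (r n * v - b) * gauss v \<partial>lborel)" .
    qed
    also have "\<dots> = (\<integral>x. \<integral>v. gauss v * (cis (- 2 * pi * x * a) * autocorr (windowed g f x) (r n * v - b)) \<partial>lborel \<partial>lborel)"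
      by (intro Bochner_Integration.integral_cong refl, subst integral_mult_right_zero[symmetric])
         (intro Bochner_Integration.integral_cong refl, simp)
    also have "\<dots> = (\<integral>v. \<integral>x. gauss v * (cis (- 2 * pi * x * a) * autocorr (windowed g f x) (r n * v - b)) \<partial>lborel \<partial>lborel)"
    proof (rule lborel_pair.Fubini_integral)
      let ?F = "\<lambda>(v, x). gauss v * (cis (- 2 * pi * x * a) * autocorr (windowed g f x) (r n * v - b))"
      show "integrable (lborel \<Otimes>\<^sub>M lborel) ?F"
      proof (rule integrable_lborel_pairI)
        show "?F \<in> borel_measurable (lborel \<Otimes>\<^sub>M lborel)" 
          unfolding autocorr_def windowed_def by measurable
        have "(\<integral>\<^sup>+v. \<integral>\<^sup>+x. ennreal (cmod (?F (v, x))) \<partial>lborel \<partial>lborel)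
          \<le> (\<integral>\<^sup>+v. ennreal (gauss v) * ennreal (energy f * energy g) \<partial>lborel)"
        proof (rule nn_integral_mono)
          fix v
          have "(\<integral>\<^sup>+x. ennreal (cmod (autocorr (windowed g f x) (r n * v - b))) \<partial>lborel)
            \<le> (\<integral>\<^sup>+x. \<integral>\<^sup>+t. ennreal (cmod (windowed g f x t * cnj (windowed g f x (t - (r n * v - b))))) \<partial>lborel \<partial>lborel)"
            unfolding autocorr_def by (intro nn_integral_mono norm_integral_le_nn_integral)
          also have "\<dots> \<le> ennreal (energy f * energy g)"
            by (rule autocorr_windowed_L1[OF f g])
          finally have "(\<integral>\<^sup>+x. ennreal (cmod (autocorr (windowed g f x) (r n * v - b))) \<partial>lborel) \<le> ennreal (energy f * energy g)" .
          then have "ennreal (gauss v) * (\<integral>\<^sup>+x. ennreal (cmod (autocorr (windowed g f x) (r n * v - b))) \<partial>lborel)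
             \<le> ennreal (gauss v) * ennreal (energy f * energy g)" by (rule mult_left_mono) simp
          moreover have "(\<integral>\<^sup>+x. ennreal (cmod (?F (v, x))) \<partial>lborel)
             = ennreal (gauss v) * (\<integral>\<^sup>+x. ennreal (cmod (autocorr (windowed g f x) (r n * v - b))) \<partial>lborel)"
            by (subst nn_integral_cmult[symmetric])
               (auto simp: norm_mult gauss_bounds less_imp_le ennreal_mult)
          ultimately show "(\<integral>\<^sup>+x. ennreal (cmod (?F (v, x))) \<partial>lborel) \<le> ennreal (gauss v) * ennreal (energy f * energy g)"
            by simp
        qed
        also have "\<dots> = (\<integral>\<^sup>+v. ennreal (gauss v) \<partial>lborel) * ennreal (energy f * energy g)"
          by (simp add: nn_integral_multc)
        also have "\<dots> < \<infinity>"
          by (subst nn_integral_eq_integral[OF has_integral_gauss(1)])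
             (auto simp: gauss_bounds less_imp_le ennreal_mult_less_top)
        finally show "(\<integral>\<^sup>+v. \<integral>\<^sup>+x. ennreal (cmod (?F (v, x))) \<partial>lborel \<partial>lborel) < \<infinity>" .
      qed
    qed
    also have "\<dots> = (\<integral>v. gauss v * H (r n * v - b) \<partial>lborel)"
      by (simp only: integral_mult_right_zero integral_autocorr_windowed[OF f g] H_def)
    finally show ?thesis .
  qed
  have lim1: "(\<lambda>n. \<integral>z. G n z \<partial>(lborel \<Otimes>\<^sub>M lborel)) \<longlonglongrightarrow> (\<integral>z. V z * cis (- 2 * pi * (fst z * a + snd z * b)) \<partial>(lborel \<Otimes>\<^sub>M lborel))"
  proof (rule integral_dominated_convergence[where w="\<lambda>z. cmod (V z)"])
    show "AE z in lborel \<Otimes>\<^sub>M lborel. (\<lambda>n. G n z) \<longlonglongrightarrow> V z * cis (- 2 * pi * (fst z * a + snd z * b))"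
    proof (intro AE_I2)
      fix z
      have "(\<lambda>n. G n z) \<longlonglongrightarrow> V z * cis (- 2 * pi * (fst z * a + snd z * b)) * complex_of_real 1"
        unfolding G_def r_def by (intro tendsto_intros gauss_dilated_limit)
      then show "(\<lambda>n. G n z) \<longlonglongrightarrow> V z * cis (- 2 * pi * (fst z * a + snd z * b))" by simp
    qed
    show "AE z in lborel \<Otimes>\<^sub>M lborel. cmod (G n z) \<le> cmod (V z)" for n
      by (auto simp: G_def norm_mult gauss_bounds less_imp_le intro!: mult_left_le)
  qed (use V in auto)
  have Hcont: "isCont H q" for q
    unfolding H_def by (intro continuous_intros continuous_fourier1_windowed f g)
  have [measurable]: "H \<in> borel_measurable borel"
    by (intro borel_measurable_continuous_onI continuous_at_imp_continuous_on ballI Hcont)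
  define B where "B = energy f * energy g"
  have HB: "cmod (H q) \<le> B" for q
    using mult_mono[OF norm_fourier1_windowed[OF f f, of q a] norm_fourier1_windowed[OF g g, of q a]]
    by (simp add: H_def norm_mult B_def energy_nonneg)
  have "(\<lambda>n. \<integral>v. gauss v * H (r n * v - b) \<partial>lborel) \<longlonglongrightarrow> (\<integral>v. gauss v * H (- b) \<partial>lborel)"
  proof (rule integral_dominated_convergence[where w="\<lambda>v. gauss v * B"])
    show "integrable lborel (\<lambda>v. gauss v * B)" by (intro integrable_mult_left has_integral_gauss)
    show "AE v in lborel. (\<lambda>n. complex_of_real (gauss v) * H (r n * v - b)) \<longlonglongrightarrow> gauss v * H (- b)"
    proof (intro AE_I2 tendsto_intros isCont_tendsto_compose[OF Hcont])
      fix v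
      have "(\<lambda>n. r n * v - b) \<longlonglongrightarrow> 0 * v - b"
        unfolding r_def by (intro tendsto_intros LIMSEQ_Suc lim_1_over_n)
      then show "(\<lambda>n. r n * v - b) \<longlonglongrightarrow> - b" by simp
    qed
    show "AE v in lborel. cmod (complex_of_real (gauss v) * H (r n * v - b)) \<le> gauss v * B" for n
      using HB by (auto simp: norm_mult gauss_bounds less_imp_le intro!: mult_left_mono)
  qed measurable
  moreover have "(\<integral>v. gauss v * H (- b) \<partial>lborel) = H (- b)"
    by (simp add: has_integral_gauss)
  ultimately have "(\<lambda>n. \<integral>z. G n z \<partial>(lborel \<Otimes>\<^sub>M lborel)) \<longlonglongrightarrow> H (- b)"
    by (simp only: Heq)
  then have "(\<integral>z. V z * cis (- 2 * pi * (fst z * a + snd z * b)) \<partial>(lborel \<Otimes>\<^sub>M lborel)) = H (- b)"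
    using lim1 LIMSEQ_unique by blast
  then show ?thesis by (simp add: V_def H_def case_prod_beta')
qed

section \<open>Ambiguity functions and the windows\<close>

lemma AE_lborel_affine:
  fixes c x :: real
  assumes "c \<noteq> 0" "AE t in lborel. P t"
  shows "AE t in lborel. P (x + c * t)"
proof -
  obtain N where N: "N \<in> null_sets lborel" "{t. \<not> P t} \<subseteq> N"
    using assms(2) by (auto simp: eventually_ae_filter)
  have "AE t in lborel. t \<notin> N" using N(1) by (rule AE_not_in)
  moreover have "Measurable.pred borel (\<lambda>t. t \<notin> N)"
    using N(1) by (auto simp: null_sets_def)
  ultimately have "AE t in lborel. x + c * t \<notin> N"
    using AE_borel_affine[OF assms(1)] by blast
  then show ?thesis by eventually_elim (use N(2) in auto)
qed

lemma lebesgue_borel_representative: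
  fixes h :: "'a::euclidean_space \<Rightarrow> complex"
  assumes "h \<in> borel_measurable lebesgue"
  obtains h' where "h' \<in> borel_measurable borel" "AE t in lborel. h t = h' t"
proof -
  have "(\<lambda>t. Re (h t)) \<in> borel_measurable lebesgue" "(\<lambda>t. Im (h t)) \<in> borel_measurable lebesgue"
    using assms by measurable
  then obtain u v where uv: "u \<in> borel_measurable lborel" "v \<in> borel_measurable lborel"
    "AE t in lborel. Re (h t) = u t" "AE t in lborel. Im (h t) = v t"
    using completion_ex_borel_measurable_real by metis
  show ?thesis
  proof (rule that)
    show "(\<lambda>t. Complex (u t) (v t)) \<in> borel_measurable borel"
      using uv(1,2) by (simp add: borel_measurable_complex_iff)
    show "AE t in lborel. h t = Complex (u t) (v t)"
      using uv(3,4) by eventually_elim (simp add: complex_eq_iff)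
  qed
qed

text \<open>The link between the integrals over \<open>lebesgue\<close> in the definitions and Borel functions.\<close>

lemma lebesgue_representative:
  fixes h :: "'a::euclidean_space \<Rightarrow> complex"
  assumes h': "h' \<in> borel_measurable borel" and ae: "AE t in lborel. h t = h' t"
  shows "h \<in> borel_measurable lebesgue"
    and "integral\<^sup>L lebesgue h = integral\<^sup>L lborel h'"
    and "integrable lebesgue h \<longleftrightarrow> integrable lborel h'"
proof -
  have ae': "AE t in lebesgue. h' t = h t"
    using ae by (simp add: AE_completion_iff eq_commute)
  have m: "h' \<in> borel_measurable lebesgue" using h' by (simp add: measurable_completion)
  show hm: "h \<in> borel_measurable lebesgue" by (rule borel_measurable_AE[OF m ae'])
  have "integral\<^sup>L lebesgue h = integral\<^sup>L lebesgue h'"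
    using ae' by (intro integral_cong_AE hm m) auto
  then show "integral\<^sup>L lebesgue h = integral\<^sup>L lborel h'"
    using h' by (simp add: integral_completion)
  have "integrable lebesgue h \<longleftrightarrow> integrable lebesgue h'"
    using ae' by (intro integrable_cong_AE hm m) auto
  then show "integrable lebesgue h \<longleftrightarrow> integrable lborel h'"
    using h' by (simp add: integrable_completion)
qed

lemma in_L2_representative:
  assumes "in_L2 f"
  obtains f' where "sq_integrable f'" "AE t in lborel. f t = f' t"
proof -
  obtain f' where f': "f' \<in> borel_measurable borel" "AE t in lborel. f t = f' t"
    using lebesgue_borel_representative assms in_L2_def by blast
  have "integrable lebesgue (\<lambda>t. complex_of_real ((cmod (f t))\<^sup>2))"
    using assms unfolding in_L2_def by (intro integrable_of_real) simp
  moreover have "AE t in lborel. complex_of_real ((cmod (f t))\<^sup>2) = complex_of_real ((cmod (f' t))\<^sup>2)"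
    using f'(2) by eventually_elim simp
  ultimately have "integrable lborel (\<lambda>t. complex_of_real ((cmod (f' t))\<^sup>2))"
    using lebesgue_representative(3)[of "\<lambda>t. complex_of_real ((cmod (f' t))\<^sup>2)"] f'(1) by simp
  then have "integrable lborel (\<lambda>t. (cmod (f' t))\<^sup>2)"
    using integrable_Re by fastforce
  then show ?thesis using f' that by (auto simp: sq_integrable_def)
qed

lemma ambiguity_eq:
  assumes f': "sq_integrable f'" and ae: "AE t in lborel. f t = f' t"
  shows "ambiguity f (x, y) = cis (pi * x * y) * fourier1 (windowed f' f' x) y"
proof -
  have [measurable]: "f' \<in> borel_measurable borel" using f' by (rule sq_integrable_measurable)
  have "ambiguity f (x, y) = (\<integral>t. f' (t + x / 2) * cnj (f' (t - x / 2)) * cis (- 2 * pi * t * y) \<partial>lborel)"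
    unfolding ambiguity_def prod.case
  proof (rule lebesgue_representative(2))
    show "AE t in lborel. f (t + x / 2) * cnj (f (t - x / 2)) * cis (- 2 * pi * t * y) =
                  f' (t + x / 2) * cnj (f' (t - x / 2)) * cis (- 2 * pi * t * y)"
      using AE_lborel_affine[OF _ ae, of 1 "x/2"] AE_lborel_affine[OF _ ae, of 1 "-x/2"]
      by (auto simp: add.commute)
  qed measurable
  also have "\<dots> = (\<integral>s. f' s * cnj (f' (s - x)) * cis (- 2 * pi * (s - x / 2) * y) \<partial>lborel)"
    by (subst lborel_integral_real_affine[where c=1 and t="-x/2"]) (simp_all add: algebra_simps)
  also have "\<dots> = (\<integral>s. cis (pi * x * y) * (windowed f' f' x s * cis (- 2 * pi * s * y)) \<partial>lborel)"
  proof (intro Bochner_Integration.integral_cong refl)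
    fix s
    have "cis (- 2 * pi * (s - x / 2) * y) = cis (pi * x * y) * cis (- 2 * pi * s * y)"
      by (simp add: cis_mult algebra_simps)
    then show "f' s * cnj (f' (s - x)) * cis (- 2 * pi * (s - x / 2) * y)
      = cis (pi * x * y) * (windowed f' f' x s * cis (- 2 * pi * s * y))"
      by (simp add: windowed_def)
  qed
  finally show ?thesis unfolding fourier1_def by (simp only: integral_mult_right_zero)
qed

lemma stft_eq:
  assumes f': "sq_integrable f'" and ae: "AE t in lborel. f t = f' t" and g: "sq_integrable g"
  shows "stft g f (x, y) = fourier1 (windowed g f' x) y"
  unfolding stft_def prod.case fourier1_def windowed_def
proof (rule lebesgue_representative(2))
  have [measurable]: "f' \<in> borel_measurable borel" "g \<in> borel_measurable borel"
    using f' g by (auto simp: sq_integrable_def)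
  show "(\<lambda>t. f' t * cnj (g (t - x)) * cis (- 2 * pi * t * y)) \<in> borel_measurable borel" by measurable
  show "AE t in lborel. f t * cnj (g (t - x)) * cis (- 2 * pi * t * y) =
      f' t * cnj (g (t - x)) * cis (- 2 * pi * t * y)" using ae by eventually_elim simp
qed

lemma fourier2_lborel:
  assumes "G' \<in> borel_measurable borel" "AE z in lborel. G z = G' z"
  shows "fourier2 G (a, b) = (\<integral>z. G' z * cis (- 2 * pi * (fst z * a + snd z * b)) \<partial>lborel)"
  unfolding fourier2_def
proof (rule lebesgue_representative(2))
  show "(\<lambda>z. G' z * cis (- 2 * pi * (fst z * a + snd z * b))) \<in> borel_measurable borel"
    by (intro borel_measurable_times assms(1) borel_measurable_continuous_onI continuous_intros)
  show "AE z in lborel. G z * cis (- 2 * pi * (z \<bullet> (a, b))) = G' z * cis (- 2 * pi * (fst z * a + snd z * b))"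
    using assms(2) by eventually_elim (simp add: inner_prod_def)
qed

text \<open>The phase factors that distinguish \<open>\<A>f\<close> from \<open>V\<^sub>f f\<close> cancel in the product.\<close>

lemma fourier2_spectrogram:
  assumes f': "sq_integrable f'" and ae: "AE t in lborel. f t = f' t" and g: "sq_integrable g"
  shows "integrable lebesgue (\<lambda>z. complex_of_real ((cmod (stft g f z))\<^sup>2))"
    and "fourier2 (\<lambda>z. complex_of_real ((cmod (stft g f z))\<^sup>2)) (y, - x)
      = ambiguity f (x, y) * cnj (ambiguity g (x, y))"
proof -
  have [measurable]: "f' \<in> borel_measurable borel" "g \<in> borel_measurable borel"
    using f' g by (auto simp: sq_integrable_def)
  let ?V = "\<lambda>(x, \<omega>). complex_of_real ((cmod (fourier1 (windowed g f' x) \<omega>))\<^sup>2)"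
  have eq: "(\<lambda>z. complex_of_real ((cmod (stft g f z))\<^sup>2)) = ?V"
    by (auto simp: stft_eq[OF f' ae g] fun_eq_iff)
  have V: "integrable lborel ?V"
    using stft_square_integrable[OF f' g] by (simp add: lborel_prod)
  then have m: "?V \<in> borel_measurable borel" using borel_measurable_integrable by force
  show "integrable lebesgue (\<lambda>z. complex_of_real ((cmod (stft g f z))\<^sup>2))"
    unfolding eq using V m by (simp add: integrable_completion)
  have "fourier2 ?V (y, - x) = (\<integral>z. ?V z * cis (- 2 * pi * (fst z * y + snd z * (- x))) \<partial>lborel)"
    by (rule fourier2_lborel[OF m]) simp
  also have "\<dots> = (\<integral>(x', \<omega>). (cmod (fourier1 (windowed g f' x') \<omega>))\<^sup>2 * cis (- 2 * pi * (x' * y + \<omega> * (- x))) \<partial>(lborel \<Otimes>\<^sub>M lborel))"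
    by (simp add: lborel_prod case_prod_beta')
  also have "\<dots> = fourier1 (windowed f' f' x) y * cnj (fourier1 (windowed g g x) y)"
    by (subst fourier_spectrogram[OF f' g]) simp
  also have "\<dots> = ambiguity f (x, y) * cnj (ambiguity g (x, y))"
  proof -
    have "cis (pi * x * y) * cnj (cis (pi * x * y)) = 1" by (simp add: cis_cnj cis_mult)
    moreover have "ambiguity f (x, y) * cnj (ambiguity g (x, y))
      = (cis (pi * x * y) * cnj (cis (pi * x * y))) * (fourier1 (windowed f' f' x) y * cnj (fourier1 (windowed g g x) y))"
      unfolding ambiguity_eq[OF f' ae] ambiguity_eq[OF g AE_I2[OF refl]] complex_cnj_mult by (simp only: mult_ac)
    ultimately show ?thesis by simp
  qed
  finally show "fourier2 (\<lambda>z. complex_of_real ((cmod (stft g f z))\<^sup>2)) (y, - x)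
      = ambiguity f (x, y) * cnj (ambiguity g (x, y))"
    unfolding eq .
qed

lemma ambiguity_measurable:
  assumes "sq_integrable f'" "AE t in lborel. f t = f' t"
  shows "ambiguity f \<in> borel_measurable borel"
proof -
  have [measurable]: "f' \<in> borel_measurable borel" using assms(1) by (rule sq_integrable_measurable)
  have "ambiguity f = (\<lambda>(x, y). cis (pi * x * y) * fourier1 (windowed f' f' x) y)"
    using ambiguity_eq[OF assms] by (auto simp: fun_eq_iff)
  moreover have "\<dots> \<in> borel_measurable (borel \<Otimes>\<^sub>M borel)"
    unfolding fourier1_def windowed_def by measurable
  ultimately show ?thesis by (simp add: borel_prod)
qed

text \<open>Conjugation amounts to the substitution \<open>t \<mapsto> -t\<close>.\<close>

lemma ambiguity_even_real:
  assumes g[measurable]: "g \<in> borel_measurable borel" and even: "\<And>t. g (- t) = g t"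
  shows "cnj (ambiguity g (x, y)) = ambiguity g (x, y)"
proof -
  have eq: "ambiguity g (x, y) = (\<integral>t. g (t + x / 2) * cnj (g (t - x / 2)) * cis (- 2 * pi * t * y) \<partial>lborel)"
    unfolding ambiguity_def prod.case by (rule lebesgue_representative(2)) auto
  have "cnj (ambiguity g (x, y)) = (\<integral>t. cnj (g (t + x / 2) * cnj (g (t - x / 2)) * cis (- 2 * pi * t * y)) \<partial>lborel)"
    unfolding eq by (rule Bochner_Integration.integral_cnj[symmetric])
  also have "\<dots> = (\<integral>t. cnj (g (- t + x / 2) * cnj (g (- t - x / 2)) * cis (- 2 * pi * (- t) * y)) \<partial>lborel)"
    by (subst lborel_integral_real_affine[where c="-1" and t=0]) simp_all
  also have "\<dots> = ambiguity g (x, y)"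
    unfolding eq
  proof (intro Bochner_Integration.integral_cong refl)
    fix t
    have "g (- t + x / 2) = g (t - x / 2)" "g (- t - x / 2) = g (t + x / 2)"
      using even[of "t - x / 2"] even[of "t + x / 2"] by (simp_all add: algebra_simps)
    then show "cnj (g (- t + x / 2) * cnj (g (- t - x / 2)) * cis (- 2 * pi * (- t) * y))
      = g (t + x / 2) * cnj (g (t - x / 2)) * cis (- 2 * pi * t * y)"
      by (simp add: cis_cnj)
  qed
  finally show ?thesis .
qed

lemma fourier1_shift:
  assumes [measurable]: "h \<in> borel_measurable borel"
  shows "fourier1 (\<lambda>t. h (t - \<delta>)) \<omega> = cis (- 2 * pi * \<delta> * \<omega>) * fourier1 h \<omega>"
proof -
  have "fourier1 (\<lambda>t. h (t - \<delta>)) \<omega> = (\<integral>t. h t * cis (- 2 * pi * (t + \<delta>) * \<omega>) \<partial>lborel)"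
    unfolding fourier1_def by (subst lborel_integral_real_affine[where c=1 and t=\<delta>]) (simp_all add: add.commute)
  also have "\<dots> = (\<integral>t. cis (- 2 * pi * \<delta> * \<omega>) * (h t * cis (- 2 * pi * t * \<omega>)) \<partial>lborel)"
  proof (intro Bochner_Integration.integral_cong refl)
    fix t
    have "cis (- 2 * pi * (t + \<delta>) * \<omega>) = cis (- 2 * pi * \<delta> * \<omega>) * cis (- 2 * pi * t * \<omega>)"
      by (simp add: cis_mult algebra_simps)
    then show "h t * cis (- 2 * pi * (t + \<delta>) * \<omega>) = cis (- 2 * pi * \<delta> * \<omega>) * (h t * cis (- 2 * pi * t * \<omega>))"
      by simp
  qed
  finally show ?thesis unfolding fourier1_def by (simp only: integral_mult_right_zero)
qed

text \<open>Translating by half a period \<open>1/(2 \<omega>)\<close> changes the sign of the Fourier coefficient at \<open>\<omega>\<close>, so the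
coefficient is half that of a difference of translates. The bound does not depend on \<open>x\<close>, which makes the
Riemann-Lebesgue lemma uniform.\<close>

lemma fourier1_windowed_half_period:
  assumes f: "sq_integrable f" and "\<omega> \<noteq> 0"
  shows "cmod (fourier1 (windowed f f x) \<omega>)
    \<le> sqrt (energy f) * sqrt (energy (\<lambda>t. f (t - 1 / (2 * \<omega>)) - f t))"
proof -
  define \<delta> where "\<delta> = 1 / (2 * \<omega>)"
  have [measurable]: "f \<in> borel_measurable borel" using f by (rule sq_integrable_measurable)
  define h where "h = windowed f f x"
  define d where "d t = f (t - \<delta>) - f t" for t
  have d: "sq_integrable d" unfolding d_def by (intro sq_integrable_diff sq_integrable_shift f)
  have hm[measurable]: "h \<in> borel_measurable borel" unfolding h_def by measurable
  have h: "integrable lborel h" unfolding h_def by (rule windowed_integrable[OF f f])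
  have hs: "integrable lborel (\<lambda>t. h (t - \<delta>))"
    using lborel_integrable_real_affine[OF h, of 1 "-\<delta>"] by simp
  have "cis (- 2 * pi * \<delta> * \<omega>) = - 1" using assms(2) by (simp add: \<delta>_def cis.ctr complex_eq_iff)
  then have "fourier1 (\<lambda>t. h (t - \<delta>)) \<omega> = - fourier1 h \<omega>"
    using fourier1_shift[OF hm] by simp
  moreover have "fourier1 (\<lambda>t. h (t - \<delta>) - h t) \<omega> = fourier1 (\<lambda>t. h (t - \<delta>)) \<omega> - fourier1 h \<omega>"
    unfolding fourier1_def
    by (subst Bochner_Integration.integral_diff[symmetric])
       (auto intro!: integrable_mult_cis h hs simp: ring_distribs)
  ultimately have "2 * cmod (fourier1 h \<omega>) = cmod (fourier1 (\<lambda>t. h (t - \<delta>) - h t) \<omega>)"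
    by (simp add: norm_mult flip: minus_add_distrib mult_2)
  also have "\<dots> \<le> (\<integral>t. cmod (h (t - \<delta>) - h t) \<partial>lborel)" by (rule norm_fourier1_le)
  also have "\<dots> \<le> (\<integral>t. cmod (d t) * cmod (f (t - \<delta> - x)) + cmod (f t) * cmod (d (t - x)) \<partial>lborel)"
  proof (rule integral_mono)
    show "integrable lborel (\<lambda>t. cmod (h (t - \<delta>) - h t))"
      by (intro integrable_norm Bochner_Integration.integrable_diff h hs)
    show "integrable lborel (\<lambda>t. cmod (d t) * cmod (f (t - \<delta> - x)) + cmod (f t) * cmod (d (t - x)))"
      using Cauchy_Schwarz_energy(1)[OF d sq_integrable_shift(1)[OF f, of "\<delta> + x"]]
        Cauchy_Schwarz_energy(1)[OF f sq_integrable_shift(1)[OF d, of x]]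
      by (simp add: algebra_simps)
    fix t
    have "h (t - \<delta>) - h t = d t * cnj (f (t - \<delta> - x)) + f t * cnj (d (t - x))"
      by (simp add: h_def windowed_def d_def algebra_simps)
    then show "cmod (h (t - \<delta>) - h t) \<le> cmod (d t) * cmod (f (t - \<delta> - x)) + cmod (f t) * cmod (d (t - x))"
      using norm_triangle_ineq[of "d t * cnj (f (t - \<delta> - x))" "f t * cnj (d (t - x))"] by (simp add: norm_mult)
  qed
  also have "\<dots> = (\<integral>t. cmod (d t) * cmod (f (t - (\<delta> + x))) \<partial>lborel) + (\<integral>t. cmod (f t) * cmod (d (t - x)) \<partial>lborel)"
    using Cauchy_Schwarz_energy(1)[OF d sq_integrable_shift(1)[OF f, of "\<delta> + x"]]
        Cauchy_Schwarz_energy(1)[OF f sq_integrable_shift(1)[OF d, of x]]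
    by (simp add: diff_diff_eq)
  also have "\<dots> \<le> sqrt (energy d) * sqrt (energy f) + sqrt (energy f) * sqrt (energy d)"
    using Cauchy_Schwarz_energy(2)[OF d sq_integrable_shift(1)[OF f, of "\<delta> + x"]]
        Cauchy_Schwarz_energy(2)[OF f sq_integrable_shift(1)[OF d, of x]]
    by (intro add_mono) (simp_all add: sq_integrable_shift[OF f] sq_integrable_shift[OF d])
  finally show ?thesis by (simp add: h_def d_def[abs_def] \<delta>_def)
qed

text \<open>In the direction of \<open>\<omega>\<close> this is the uniform Riemann-Lebesgue lemma. In the direction of \<open>x\<close>, replace \<open>f\<close> by a
function \<open>g\<close> supported in \<open>[-R, R]\<close>: the supports of \<open>g\<close> and its translate by \<open>x\<close> are disjoint once \<open>\<bar>x\<bar> > 2 \<bar>R\<bar>\<close>.\<close>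

lemma fourier1_windowed_vanishes:
  assumes f: "sq_integrable f" and e: "0 < e"
  obtains R where "\<And>x \<omega>. e \<le> cmod (fourier1 (windowed f f x) \<omega>) \<Longrightarrow> \<bar>x\<bar> \<le> R \<and> \<bar>\<omega>\<bar> \<le> R"
proof -
  have "((\<lambda>h. sqrt (energy f) * sqrt (energy (\<lambda>t. f (t - h) - f t))) \<longlongrightarrow> sqrt (energy f) * sqrt 0) (nhds 0)"
    by (intro tendsto_intros translation_continuous[OF f])
  then have "\<forall>\<^sub>F h in nhds 0. sqrt (energy f) * sqrt (energy (\<lambda>t. f (t - h) - f t)) < e"
    using order_tendstoD(2)[of _ "0" "nhds 0" e] e by simp
  then obtain d where d: "d > 0" "\<And>h. \<bar>h\<bar> < d \<Longrightarrow> sqrt (energy f) * sqrt (energy (\<lambda>t. f (t - h) - f t)) < e"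
    by (auto simp: eventually_nhds_metric)
  have 1: "\<bar>\<omega>\<bar> \<le> 1 / d" if "e \<le> cmod (fourier1 (windowed f f x) \<omega>)" for x \<omega>
  proof (rule ccontr)
    assume "\<not> \<bar>\<omega>\<bar> \<le> 1 / d"
    then have w: "1 < d * \<bar>\<omega>\<bar>" using d(1) by (simp add: field_simps)
    then have "\<omega> \<noteq> 0" by auto
    have "\<bar>1 / (2 * \<omega>)\<bar> < d" using w \<open>\<omega> \<noteq> 0\<close> by (simp add: field_simps)
    then show False
      using d(2) fourier1_windowed_half_period[OF f \<open>\<omega> \<noteq> 0\<close>, of x] that by fastforce
  qed
  define K where "K = sqrt (energy f) + sqrt (2 * energy f + 2) + 1"
  have K: "K > 0" using energy_nonneg[of f] by (simp add: K_def add_nonneg_pos)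
  \<comment> \<open>\<open>K\<close> exceeds the sum of the norms of \<open>f\<close> and \<open>g\<close> as soon as \<open>f - g\<close> has energy at most 1.\<close>
  define e' where "e' = min 1 ((e / K)\<^sup>2)"
  have e': "e' > 0" "e' \<le> 1" "e' \<le> (e / K)\<^sup>2" using e K by (auto simp: e'_def)
  obtain g R B where g: "continuous_on UNIV g" "\<And>t. R < \<bar>t\<bar> \<Longrightarrow> g t = 0" "\<And>t. cmod (g t) \<le> B"
    "sq_integrable g" "energy (\<lambda>t. f t - g t) < e'"
    using continuous_approximation_energy[OF f e'(1)] by blast
  define u where "u t = f t - g t" for t
  have u: "sq_integrable u" unfolding u_def by (intro sq_integrable_diff f g)
  have Eu: "energy u < e'" using g(5) by (simp add: u_def[abs_def])
  have su: "sqrt (energy u) \<le> e / K"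
    using Eu e'(3) e K by (intro real_le_lsqrt) (auto simp: energy_nonneg)
  have "energy g = energy (\<lambda>t. f t - u t)" by (simp add: u_def[abs_def])
  also have "\<dots> \<le> 2 * energy f + 2 * energy u" by (rule sq_integrable_diff(2)[OF f u])
  also have "\<dots> \<le> 2 * energy f + 2" using Eu e'(2) by simp
  finally have sg: "sqrt (energy g) \<le> sqrt (2 * energy f + 2)" by simp
  have 2: "\<bar>x\<bar> \<le> 2 * \<bar>R\<bar>" if le: "e \<le> cmod (fourier1 (windowed f f x) \<omega>)" for x \<omega>
  proof (rule ccontr)
    assume x: "\<not> \<bar>x\<bar> \<le> 2 * \<bar>R\<bar>"
    note c1 = Cauchy_Schwarz_energy[OF u sq_integrable_shift(1)[OF f, of x]]
    note c2 = Cauchy_Schwarz_energy[OF g(4) sq_integrable_shift(1)[OF u, of x]]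
    have "e \<le> (\<integral>t. cmod (windowed f f x t) \<partial>lborel)"
      using le norm_fourier1_le order_trans by blast
    also have "\<dots> \<le> (\<integral>t. cmod (u t) * cmod (f (t - x)) + cmod (g t) * cmod (u (t - x)) \<partial>lborel)"
    proof (rule integral_mono)
      show "integrable lborel (\<lambda>t. cmod (windowed f f x t))"
        by (intro integrable_norm windowed_integrable f)
      show "integrable lborel (\<lambda>t. cmod (u t) * cmod (f (t - x)) + cmod (g t) * cmod (u (t - x)))"
        by (intro Bochner_Integration.integrable_add c1 c2)
      fix t
      have "R < \<bar>t\<bar> \<or> R < \<bar>t - x\<bar>" using x by linarith
      then have "g t * cnj (g (t - x)) = 0" using g(2)[of t] g(2)[of "t - x"] by auto
      then have "windowed f f x t = u t * cnj (f (t - x)) + g t * cnj (u (t - x))"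
        by (simp add: windowed_def u_def algebra_simps)
      then show "cmod (windowed f f x t) \<le> cmod (u t) * cmod (f (t - x)) + cmod (g t) * cmod (u (t - x))"
        using norm_triangle_ineq[of "u t * cnj (f (t - x))" "g t * cnj (u (t - x))"] by (simp add: norm_mult)
    qed
    also have "\<dots> \<le> sqrt (energy u) * sqrt (energy f) + sqrt (energy g) * sqrt (energy u)"
      using c1 c2 by (simp add: sq_integrable_shift[OF f] sq_integrable_shift[OF u])
    also have "\<dots> \<le> sqrt (energy u) * (sqrt (energy f) + sqrt (2 * energy f + 2))"
      using mult_left_mono[OF sg, of "sqrt (energy u)"] by (simp add: algebra_simps energy_nonneg)
    also have "\<dots> \<le> e / K * (K - 1)"
      using su mult_right_mono[OF su, of "K - 1"] energy_nonneg[of f] by (simp add: K_def)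
    also have "\<dots> < e" using e K by (simp add: field_simps)
    finally show False by simp
  qed
  show ?thesis
  proof (rule that[of "max (1 / d) (2 * \<bar>R\<bar>)"])
    fix x \<omega> assume "e \<le> cmod (fourier1 (windowed f f x) \<omega>)"
    from 1[OF this] 2[OF this] show "\<bar>x\<bar> \<le> max (1 / d) (2 * \<bar>R\<bar>) \<and> \<bar>\<omega>\<bar> \<le> max (1 / d) (2 * \<bar>R\<bar>)" by auto
  qed
qed

lemma dilated_gaussian_integrable:
  assumes "a > 0"
  shows "integrable lborel (dilated_gaussian a)" "sq_integrable (dilated_gaussian a)"
proof -
  have [measurable]: "dilated_gaussian a \<in> borel_measurable borel"
    unfolding dilated_gaussian_def by measurable
  have eq: "dilated_gaussian a = (\<lambda>t. complex_of_real (a powr (1/4) * gauss (sqrt a * t)))"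
    using assms by (auto simp: dilated_gaussian_def gauss_def fun_eq_iff power_mult_distrib mult_ac)
  show "integrable lborel (dilated_gaussian a)"
    unfolding eq using assms
    by (intro integrable_of_real integrable_mult_right integrable_gauss_dilated) simp
  have "integrable lborel (\<lambda>t. (a powr (1/4))\<^sup>2 * gauss (sqrt (2 * a) * t))"
    using assms by (intro integrable_mult_right integrable_gauss_dilated) simp
  also have "(\<lambda>t. (a powr (1/4))\<^sup>2 * gauss (sqrt (2 * a) * t)) = (\<lambda>t. (cmod (dilated_gaussian a t))\<^sup>2)"
  proof
    fix t
    have "gauss (sqrt (2 * a) * t) = (gauss (sqrt a * t))\<^sup>2"
      using assms by (simp add: gauss_def power_mult_distrib algebra_simps flip: exp_double)
    then show "(a powr (1/4))\<^sup>2 * gauss (sqrt (2 * a) * t) = (cmod (dilated_gaussian a t))\<^sup>2"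
      using gauss_bounds(1)[of "sqrt a * t"] by (simp add: eq norm_mult power_mult_distrib)
  qed
  finally show "sq_integrable (dilated_gaussian a)" by (simp add: sq_integrable_def)
qed

lemma frac_fourier_integral_eq:
  assumes [measurable]: "\<phi> \<in> borel_measurable borel"
  shows "frac_fourier_integral \<alpha> \<phi> y = csqrt (1 - \<i> * complex_of_real (cot \<alpha>)) * cis (pi * y\<^sup>2 * cot \<alpha>) *
      fourier1 (\<lambda>t. \<phi> t * cis (pi * t\<^sup>2 * cot \<alpha>)) (y / sin \<alpha>)"
proof -
  have "(\<integral>t. \<phi> t * cis (pi * t\<^sup>2 * cot \<alpha>) * cis (- 2 * pi * t * y / sin \<alpha>) \<partial>lebesgue)
    = fourier1 (\<lambda>t. \<phi> t * cis (pi * t\<^sup>2 * cot \<alpha>)) (y / sin \<alpha>)"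
    unfolding fourier1_def by (rule lebesgue_representative(2)) auto
  then show ?thesis by (simp add: frac_fourier_integral_def)
qed

text \<open>Up to factors of constant modulus this is the Fourier transform of a chirped \<open>\<phi>\<close>, evaluated at a multiple of \<open>y\<close>.\<close>

lemma frac_fourier_integral_sq_integrable:
  assumes \<phi>: "integrable lborel \<phi>" "sq_integrable \<phi>" and s: "sin \<alpha> \<noteq> 0"
  shows "sq_integrable (frac_fourier_integral \<alpha> \<phi>)"
proof -
  have [measurable]: "\<phi> \<in> borel_measurable borel" using \<phi>(2) by (rule sq_integrable_measurable)
  define h where "h t = \<phi> t * cis (pi * t\<^sup>2 * cot \<alpha>)" for t
  have hm[measurable]: "h \<in> borel_measurable borel" unfolding h_def by measurable
  have h: "integrable lborel h" unfolding h_def by (intro integrable_mult_cis \<phi>) simp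
  have "(\<integral>\<^sup>+\<omega>. ennreal ((cmod (fourier1 h \<omega>))\<^sup>2) \<partial>lborel) \<le> (\<integral>\<^sup>+t. ennreal ((cmod (h t))\<^sup>2) \<partial>lborel)"
    by (rule Plancherel_le[OF h])
  also have "\<dots> = ennreal (energy \<phi>)" by (simp add: h_def nn_integral_energy[OF \<phi>(2)])
  finally have "integrable lborel (\<lambda>\<omega>. (cmod (fourier1 h \<omega>))\<^sup>2)"
    by (auto simp: integrable_iff_bounded intro: order_le_less_trans)
  then have "integrable lborel (\<lambda>y. (cmod (fourier1 h (0 + 1 / sin \<alpha> * y)))\<^sup>2)"
    by (rule lborel_integrable_real_affine) (use s in simp)
  then have "integrable lborel (\<lambda>y. (cmod (csqrt (1 - \<i> * complex_of_real (cot \<alpha>))))\<^sup>2 * (cmod (fourier1 h (y / sin \<alpha>)))\<^sup>2)"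
    by simp
  then have "integrable lborel (\<lambda>y. (cmod (frac_fourier_integral \<alpha> \<phi> y))\<^sup>2)"
    by (simp add: frac_fourier_integral_eq h_def[abs_def] norm_mult power_mult_distrib)
  moreover have "frac_fourier_integral \<alpha> \<phi> \<in> borel_measurable borel"
    unfolding frac_fourier_integral_eq[OF \<open>\<phi> \<in> borel_measurable borel\<close>, abs_def] by measurable
  ultimately show ?thesis by (simp add: sq_integrable_def)
qed

lemma frac_fourier_integral_even:
  assumes [measurable]: "\<phi> \<in> borel_measurable borel" and even: "\<And>t. \<phi> (- t) = \<phi> t"
  shows "frac_fourier_integral \<alpha> \<phi> (- y) = frac_fourier_integral \<alpha> \<phi> y"
proof -
  have "fourier1 (\<lambda>t. \<phi> t * cis (pi * t\<^sup>2 * cot \<alpha>)) (- y / sin \<alpha>)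
    = fourier1 (\<lambda>t. \<phi> t * cis (pi * t\<^sup>2 * cot \<alpha>)) (y / sin \<alpha>)"
    unfolding fourier1_def
    by (subst lborel_integral_real_affine[where c="-1" and t=0]) (simp_all add: even)
  then show ?thesis by (simp add: frac_fourier_integral_eq)
qed

text \<open>All three cases of the definition that a Gaussian can reach, the identity, the reflection and the
integral, preserve both properties.\<close>

lemma window_sq_integrable_even:
  assumes "a > 0"
  shows "sq_integrable (window a N j)" "window a N j (- t) = window a N j t"
proof -
  let ?\<phi> = "dilated_gaussian a" and ?\<alpha> = "pi * real j / real N"
  note \<phi> = dilated_gaussian_integrable[OF assms]
  have \<phi>m: "?\<phi> \<in> borel_measurable borel" using \<phi>(2) by (rule sq_integrable_measurable)
  have ev: "?\<phi> (- t) = ?\<phi> t" for t by (simp add: dilated_gaussian_def)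
  have L: "integrable lebesgue ?\<phi>" using \<phi>(1) \<phi>m by (simp add: integrable_completion)
  have s: "sin ?\<alpha> \<noteq> 0" if "\<not> (\<exists>k::int. even k \<and> ?\<alpha> = of_int k * pi)" "\<not> (\<exists>k::int. odd k \<and> ?\<alpha> = of_int k * pi)"
    using that sin_zero_iff_int2[of ?\<alpha>] by blast
  have w: "window a N j = ?\<phi> \<or> (sin ?\<alpha> \<noteq> 0 \<and> window a N j = frac_fourier_integral ?\<alpha> ?\<phi>)"
    unfolding window_def frac_fourier_def using L s ev by auto
  show "sq_integrable (window a N j)"
    using w \<phi> frac_fourier_integral_sq_integrable[OF \<phi>] by auto
  show "window a N j (- t) = window a N j t"
    using w ev frac_fourier_integral_even[OF \<phi>m ev] by auto
qed

lemma ambiguity_sum_measurable: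
  assumes "a > 0"
  shows "ambiguity_sum a N \<in> borel_measurable borel"
  unfolding ambiguity_sum_def
  by (intro borel_measurable_sum ambiguity_measurable[OF window_sq_integrable_even(1)[OF assms] AE_I2[OF refl]])

lemma ambiguity_sum_real:
  assumes "a > 0"
  shows "(\<Sum>j=1..N. cnj (ambiguity (window a N j) z)) = ambiguity_sum a N z"
proof (cases z)
  case (Pair x y)
  have "window a N j \<in> borel_measurable borel" for j
    using window_sq_integrable_even(1)[OF assms] by (rule sq_integrable_measurable)
  then show ?thesis
    unfolding ambiguity_sum_def Pair
    by (intro sum.cong refl ambiguity_even_real window_sq_integrable_even(2)[OF assms])
qed

text \<open>Where the sum exceeds \<open>\<epsilon>\<close>, one of its \<open>N\<close> terms is at least \<open>\<epsilon>/N\<close>, and each term vanishes at infinity.\<close>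

lemma ambiguity_sum_superlevel_bounded:
  assumes a: "a > 0" and e: "\<epsilon> > 0"
  obtains R where "\<And>x y. \<epsilon> < Re (ambiguity_sum a N (x, y)) \<Longrightarrow> \<bar>x\<bar> \<le> R \<and> \<bar>y\<bar> \<le> R"
proof (cases "N = 0")
  case True
  then show ?thesis using e that[of 0] by (simp add: ambiguity_sum_def)
next
  case False
  let ?w = "window a N"
  note w = window_sq_integrable_even(1)[OF a]
  have "\<exists>R. \<forall>x y. \<epsilon> / N \<le> cmod (ambiguity (?w j) (x, y)) \<longrightarrow> \<bar>x\<bar> \<le> R \<and> \<bar>y\<bar> \<le> R" for j
  proof -
    have "0 < \<epsilon> / N" using e False by simp
    from fourier1_windowed_vanishes[OF w[of N j] this] obtain R
      where R: "\<And>x \<omega>. \<epsilon> / N \<le> cmod (fourier1 (windowed (?w j) (?w j) x) \<omega>) \<Longrightarrow> \<bar>x\<bar> \<le> R \<and> \<bar>\<omega>\<bar> \<le> R" by blast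
    show ?thesis using R by (intro exI[of _ R]) (auto simp: ambiguity_eq[OF w AE_I2[OF refl]])
  qed
  then obtain R where R: "\<And>j x y. \<epsilon> / N \<le> cmod (ambiguity (?w j) (x, y)) \<Longrightarrow> \<bar>x\<bar> \<le> R j \<and> \<bar>y\<bar> \<le> R j"
    by metis
  show ?thesis
  proof (rule that[of "\<Sum>j=1..N. \<bar>R j\<bar>"])
    fix x y assume gt: "\<epsilon> < Re (ambiguity_sum a N (x, y))"
    have "\<exists>j\<in>{1..N}. \<epsilon> / N \<le> cmod (ambiguity (?w j) (x, y))"
    proof (rule ccontr)
      assume "\<not> ?thesis"
      then have "Re (ambiguity (?w j) (x, y)) \<le> \<epsilon> / N" if "j \<in> {1..N}" for j
        using that complex_Re_le_cmod[of "ambiguity (?w j) (x, y)"] by force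
      then have "Re (ambiguity_sum a N (x, y)) \<le> (\<Sum>j=1..N. \<epsilon> / N)"
        unfolding ambiguity_sum_def Re_sum by (intro sum_mono)
      then show False using gt False by simp
    qed
    then obtain j where j: "j \<in> {1..N}" "\<epsilon> / N \<le> cmod (ambiguity (?w j) (x, y))" by blast
    have "R j \<le> (\<Sum>j=1..N. \<bar>R j\<bar>)" using j(1) member_le_sum[of j "{1..N}" "\<lambda>j. \<bar>R j\<bar>"] by auto
    then show "\<bar>x\<bar> \<le> (\<Sum>j=1..N. \<bar>R j\<bar>) \<and> \<bar>y\<bar> \<le> (\<Sum>j=1..N. \<bar>R j\<bar>)" using R[OF j(2)] by auto
  qed
qed

section \<open>Minkowski's integral inequality for extended nonnegative functions\<close>

lemma ennpowr_ennreal: "0 \<le> r \<Longrightarrow> ennpowr (ennreal r) p = ennreal (r powr p)"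
  by (simp add: ennpowr_def)

lemma ennpowr_simps [simp]: "ennpowr top p = top" "ennpowr 0 p = 0" "ennpowr x 1 = x"
  by (cases x; simp add: ennpowr_def)+

lemma ennpowr_eq_0_iff: "ennpowr x p = 0 \<longleftrightarrow> x = 0"
  by (cases x) (auto simp: ennpowr_ennreal)

lemma ennpowr_mono: "0 \<le> p \<Longrightarrow> x \<le> y \<Longrightarrow> ennpowr x p \<le> ennpowr y p"
  by (cases x; cases y) (auto simp: ennpowr_ennreal top_unique intro!: ennreal_leI powr_mono2)

lemma ennpowr_mult: "ennpowr (x * y) p = ennpowr x p * ennpowr y p"
proof (cases "x = top \<or> y = top")
  case True
  then show ?thesis by (auto simp: ennreal_top_mult ennreal_mult_top ennpowr_eq_0_iff)
next
  case False
  then obtain r s where "x = ennreal r" "0 \<le> r" "y = ennreal s" "0 \<le> s"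
    by (cases x; cases y) auto
  then show ?thesis by (simp add: ennpowr_ennreal powr_mult flip: ennreal_mult)
qed

lemma ennpowr_ennpowr: "ennpowr (ennpowr x a) b = ennpowr x (a * b)"
  by (cases x) (auto simp: ennpowr_ennreal powr_powr)

lemma ennpowr_measurable [measurable]: "(\<lambda>x. ennpowr x p) \<in> borel_measurable borel"
  unfolding ennpowr_def by measurable

text \<open>The graph of \<open>x \<mapsto> x\<^sup>p\<close> lies above its tangent at \<open>t\<close>; written without subtraction it survives infinite values of \<open>x\<close>.\<close>

lemma Young_ennpowr:
  assumes p: "1 \<le> p" and t: "0 \<le> t"
  shows "ennreal (p * t powr (p - 1)) * x \<le> ennpowr x p + ennreal ((p - 1) * t powr p)"
proof (cases x)
  case (real s)
  have "p * t powr (p - 1) * s \<le> s powr p + (p - 1) * t powr p"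
  proof (cases "s = 0 \<or> t = 0")
    case False
    then have st: "0 < s" "0 < t" using real t by auto
    have "p * t powr (p - 1) * (s - t) \<le> s powr p - t powr p"
    proof (rule convex_on_imp_above_tangent[OF powr_convex[OF p]])
      show "((\<lambda>x. x powr p) has_real_derivative p * t powr (p - 1)) (at t within {0<..})"
        by (rule has_field_derivative_at_within, rule has_real_derivative_powr) (use st in simp)
    qed (use st in \<open>auto simp: interior_open\<close>)
    moreover have "t powr (p - 1) * t = t powr p" using st by (simp add: powr_diff)
    then have "p * t powr (p - 1) * (s - t) = p * t powr (p - 1) * s - p * t powr p"
      by (simp add: right_diff_distrib mult.assoc)
    ultimately show ?thesis by (simp add: left_diff_distrib)
  qed (use p in auto)
  then show ?thesis
    using real p by (simp add: ennpowr_ennreal flip: ennreal_mult ennreal_plus)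
qed simp

text \<open>Integrate the tangent inequality against \<open>N\<close> and take for \<open>t\<close> the mean of \<open>f\<close>. If the mean is infinite, \<open>t = 1\<close>
shows that the right-hand side is infinite.\<close>

lemma Jensen_ennpowr:
  assumes p: "1 \<le> p" and [measurable]: "f \<in> borel_measurable M" "N \<in> borel_measurable M"
    and N: "(\<integral>\<^sup>+y. N y \<partial>M) = 1"
  shows "ennpowr (\<integral>\<^sup>+y. f y * N y \<partial>M) p \<le> (\<integral>\<^sup>+y. ennpowr (f y) p * N y \<partial>M)"
    (is "ennpowr ?m p \<le> ?I")
proof -
  have young: "ennreal (p * t powr (p - 1)) * ?m \<le> ?I + ennreal ((p - 1) * t powr p)" if t: "0 \<le> t" for t
  proof -
    have "ennreal (p * t powr (p - 1)) * ?m = (\<integral>\<^sup>+y. (ennreal (p * t powr (p - 1)) * f y) * N y \<partial>M)"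
      by (simp add: nn_integral_cmult[symmetric] mult.assoc)
    also have "\<dots> \<le> (\<integral>\<^sup>+y. (ennpowr (f y) p + ennreal ((p - 1) * t powr p)) * N y \<partial>M)"
      by (intro nn_integral_mono mult_right_mono Young_ennpowr p t) auto
    also have "\<dots> = ?I + ennreal ((p - 1) * t powr p)"
      by (simp add: distrib_right nn_integral_add nn_integral_cmult N)
    finally show ?thesis .
  qed
  show ?thesis
  proof (cases ?m)
    case (real t)
    show ?thesis
    proof (cases ?I)
      case I: (real i)
      have tt: "t powr (p - 1) * t = t powr p"
        using real p by (cases "t = 0") (auto simp: powr_diff)
      have "ennreal (p * t powr (p - 1) * t) \<le> ennreal (i + (p - 1) * t powr p)"
        using young[OF real(1), unfolded real(2) I(2)] real(1) I(1) p
        by (subst ennreal_mult', simp, subst ennreal_plus) auto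
      then have "p * t powr (p - 1) * t \<le> i + (p - 1) * t powr p"
        using I p by (subst (asm) ennreal_le_iff) auto
      moreover have "p * t powr (p - 1) * t = p * t powr p" using tt by (simp add: mult.assoc)
      ultimately have "t powr p \<le> i" by (simp add: left_diff_distrib)
      then show ?thesis using real I by (simp add: ennpowr_ennreal ennreal_leI)
    qed simp
  next
    case top
    have "ennreal p * ?m \<le> ?I + ennreal (p - 1)" using young[of 1] by simp
    then have "?I = top" using top p by (auto simp: ennreal_mult_top top_unique)
    then show ?thesis by simp
  qed
qed

text \<open>The integrand takes values in \<open>[0,\<infinity>]\<close>, because Minkowski's inequality is applied to integrals that may diverge.\<close>

definition eLp_norm :: "real \<Rightarrow> 'a measure \<Rightarrow> ('a \<Rightarrow> ennreal) \<Rightarrow> ennreal" where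
  "eLp_norm p M h = ennpowr (\<integral>\<^sup>+x. ennpowr (h x) p \<partial>M) (1 / p)"

lemma eLp_norm_mono_AE:
  assumes "0 < p" "AE x in M. h x \<le> h' x"
  shows "eLp_norm p M h \<le> eLp_norm p M h'"
proof -
  have "AE x in M. ennpowr (h x) p \<le> ennpowr (h' x) p"
    using assms(2) by eventually_elim (use assms(1) in \<open>simp add: ennpowr_mono\<close>)
  then show ?thesis
    unfolding eLp_norm_def using assms(1) by (intro ennpowr_mono nn_integral_mono_AE) simp_all
qed

lemma eLp_norm_cmult:
  assumes "0 < p" "h \<in> borel_measurable M"
  shows "eLp_norm p M (\<lambda>x. c * h x) = c * eLp_norm p M h"
  using assms by (simp add: eLp_norm_def ennpowr_mult nn_integral_cmult ennpowr_ennpowr)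

text \<open>Let \<open>N(y)\<close> be the norm of the slice \<open>W(\<cdot>, y)\<close> and \<open>R\<close> its integral. Then \<open>\<integral> W(x, y) dy\<close> is the mean of
\<open>R W(x, y) / N(y)\<close> for the probability density \<open>N / R\<close>, so Jensen's inequality bounds its \<open>p\<close>-th power, and
every slice of \<open>R W / N\<close> has norm at most \<open>R\<close>.\<close>

lemma (in pair_sigma_finite) Minkowski_integral_inequality:
  assumes p: "1 \<le> p" and W[measurable]: "W \<in> borel_measurable (M1 \<Otimes>\<^sub>M M2)"
  shows "eLp_norm p M1 (\<lambda>x. \<integral>\<^sup>+y. W (x, y) \<partial>M2) \<le> (\<integral>\<^sup>+y. eLp_norm p M1 (\<lambda>x. W (x, y)) \<partial>M2)"
proof -
  define N where "N y = eLp_norm p M1 (\<lambda>x. W (x, y))" for y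
  have N[measurable]: "N \<in> borel_measurable M2" unfolding N_def eLp_norm_def by measurable
  have Np: "(\<integral>\<^sup>+x. ennpowr (W (x, y)) p \<partial>M1) = ennpowr (N y) p" for y
    using p by (simp add: N_def eLp_norm_def ennpowr_ennpowr)
  define R where "R = (\<integral>\<^sup>+y. N y \<partial>M2)"
  have W0: "AE x in M1. W (x, y) = 0" if "N y = 0" "y \<in> space M2" for y
  proof -
    have [measurable]: "(\<lambda>x. W (x, y)) \<in> borel_measurable M1" using that(2) by measurable
    have "AE x in M1. ennpowr (W (x, y)) p = 0"
      using Np[of y] that by (subst nn_integral_0_iff_AE[symmetric]) auto
    then show ?thesis by (simp add: ennpowr_eq_0_iff)
  qed
  consider "R = top" | "R = 0" | "R \<noteq> 0" "R \<noteq> top" by blast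
  then show ?thesis
  proof cases
    case 1
    then show ?thesis by (simp add: R_def N_def)
  next
    case 2
    then have "AE y in M2. N y = 0" by (simp add: R_def nn_integral_0_iff_AE)
    with AE_space[of M2] have "AE y in M2. AE x in M1. W (x, y) = 0"
      by eventually_elim (rule W0)
    then have "AE x in M1. AE y in M2. W (x, y) = 0"
      by (subst AE_commute) auto
    then have "AE x in M1. (\<integral>\<^sup>+y. W (x, y) \<partial>M2) \<le> 0"
    proof (rule AE_mp[OF _ AE_I2], intro impI)
      fix x assume "AE y in M2. W (x, y) = 0"
      then have "(\<integral>\<^sup>+y. W (x, y) \<partial>M2) = (\<integral>\<^sup>+y. 0 \<partial>M2)" by (rule nn_integral_cong_AE)
      then show "(\<integral>\<^sup>+y. W (x, y) \<partial>M2) \<le> 0" by simp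
    qed
    then have "eLp_norm p M1 (\<lambda>x. \<integral>\<^sup>+y. W (x, y) \<partial>M2) \<le> eLp_norm p M1 (\<lambda>x. 0)"
      using p by (intro eLp_norm_mono_AE) auto
    then show ?thesis by (simp add: eLp_norm_def)
  next
    case 3
    have fin: "AE y in M2. N y \<noteq> top"
      using nn_integral_PInf_AE[OF N] 3 by (simp add: R_def)
    let ?f = "\<lambda>x y. R / N y * W (x, y)"
    have cancel: "R / n * w * (n / R) = w" if n: "n \<noteq> 0" "n \<noteq> top" for n w :: ennreal
    proof -
      obtain r s where rs: "R = ennreal r" "n = ennreal s" "r > 0" "s > 0"
        using 3 n by (cases R; cases n) (auto simp: order_le_less)
      have "R / n * w * (n / R) = w * (R / n * (n / R))" by (simp add: mult_ac)
      also have "R / n * (n / R) = 1"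
        using rs by (simp add: divide_ennreal ennreal_mult[symmetric])
      finally show ?thesis by simp
    qed
    have "AE y in M2. AE x in M1. ?f x y * (N y / R) = W (x, y)"
      using fin AE_space[of M2]
    proof eventually_elim
      fix y assume y: "N y \<noteq> top" "y \<in> space M2"
      show "AE x in M1. ?f x y * (N y / R) = W (x, y)"
      proof (cases "N y = 0")
        case True
        from W0[OF this y(2)] show ?thesis by eventually_elim simp
      next
        case False
        then show ?thesis using cancel y(1) by simp
      qed
    qed
    then have eq: "AE x in M1. AE y in M2. ?f x y * (N y / R) = W (x, y)"
      by (subst AE_commute) auto
    have w1: "(\<integral>\<^sup>+y. N y / R \<partial>M2) = 1"
      using 3 by (simp add: nn_integral_divide R_def[symmetric] ennreal_divide_self less_top)
    have "(\<integral>\<^sup>+x. ennpowr (\<integral>\<^sup>+y. W (x, y) \<partial>M2) p \<partial>M1)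
      \<le> (\<integral>\<^sup>+x. \<integral>\<^sup>+y. ennpowr (?f x y) p * (N y / R) \<partial>M2 \<partial>M1)"
    proof (rule nn_integral_mono_AE)
      show "AE x in M1. ennpowr (\<integral>\<^sup>+y. W (x, y) \<partial>M2) p \<le> (\<integral>\<^sup>+y. ennpowr (?f x y) p * (N y / R) \<partial>M2)"
        using eq AE_space[of M1]
      proof eventually_elim
        fix x assume x: "AE y in M2. ?f x y * (N y / R) = W (x, y)" "x \<in> space M1"
        have "(\<integral>\<^sup>+y. W (x, y) \<partial>M2) = (\<integral>\<^sup>+y. ?f x y * (N y / R) \<partial>M2)"
          using x(1) by (intro nn_integral_cong_AE) (auto simp: eq_commute)
        then show "ennpowr (\<integral>\<^sup>+y. W (x, y) \<partial>M2) p \<le> (\<integral>\<^sup>+y. ennpowr (?f x y) p * (N y / R) \<partial>M2)"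
          using x(2) Jensen_ennpowr[OF p, of "?f x" M2 "\<lambda>y. N y / R"] w1 by simp
      qed
    qed
    also have "\<dots> = (\<integral>\<^sup>+y. \<integral>\<^sup>+x. ennpowr (?f x y) p * (N y / R) \<partial>M1 \<partial>M2)"
      by (rule Fubini'[symmetric]) measurable
    also have "\<dots> \<le> (\<integral>\<^sup>+y. ennpowr R p * (N y / R) \<partial>M2)"
    proof (rule nn_integral_mono_AE)
      show "AE y in M2. (\<integral>\<^sup>+x. ennpowr (?f x y) p * (N y / R) \<partial>M1) \<le> ennpowr R p * (N y / R)"
        using fin AE_space[of M2]
      proof eventually_elim
        fix y assume y: "N y \<noteq> top" "y \<in> space M2"
        then have [measurable]: "(\<lambda>x. W (x, y)) \<in> borel_measurable M1" by measurable
        have "(\<integral>\<^sup>+x. ennpowr (?f x y) p * (N y / R) \<partial>M1) = ennpowr (R / N y * N y) p * (N y / R)"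
          by (simp add: ennpowr_mult nn_integral_cmult nn_integral_multc Np mult.assoc)
        also have "R / N y * N y \<le> R"
          using y(1) 3 by (cases "N y = 0") (auto simp: ennreal_divide_times ennreal_divide_self less_top)
        then have "ennpowr (R / N y * N y) p * (N y / R) \<le> ennpowr R p * (N y / R)"
          using p by (intro mult_right_mono ennpowr_mono) auto
        finally show "(\<integral>\<^sup>+x. ennpowr (?f x y) p * (N y / R) \<partial>M1) \<le> ennpowr R p * (N y / R)" .
      qed
    qed
    also have "\<dots> = ennpowr R p" by (simp add: nn_integral_cmult w1)
    finally have "eLp_norm p M1 (\<lambda>x. \<integral>\<^sup>+y. W (x, y) \<partial>M2) \<le> ennpowr (ennpowr R p) (1 / p)"
      unfolding eLp_norm_def using p by (intro ennpowr_mono) auto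
    also have "\<dots> = R" using p by (simp add: ennpowr_ennpowr)
    finally show ?thesis by (simp add: R_def N_def)
  qed
qed

text \<open>Minkowski's integral inequality for a two-point measure space.\<close>

lemma eLp_norm_triangle:
  assumes M: "sigma_finite_measure M" and p: "1 \<le> p"
    and [measurable]: "g \<in> borel_measurable M" "h \<in> borel_measurable M"
  shows "eLp_norm p M (\<lambda>x. g x + h x) \<le> eLp_norm p M g + eLp_norm p M h"
proof -
  interpret M: sigma_finite_measure M by (rule M)
  interpret B: sigma_finite_measure "count_space (UNIV :: bool set)"
    by (rule sigma_finite_measure_count_space_finite) simp
  interpret pair_sigma_finite M "count_space (UNIV :: bool set)" ..
  have "(\<lambda>z. if snd z then g (fst z) else h (fst z)) \<in> borel_measurable (M \<Otimes>\<^sub>M count_space (UNIV :: bool set))"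
    by measurable
  from Minkowski_integral_inequality[OF p this] show ?thesis
    by (simp add: nn_integral_count_space_finite UNIV_bool add.commute)
qed

lemma Minkowski_linear_combination:
  fixes w1 w2 w3 :: "real \<times> real \<Rightarrow> ennreal"
  assumes p: "1 \<le> p"
    and w: "w1 \<in> borel_measurable borel" "w2 \<in> borel_measurable borel" "w3 \<in> borel_measurable borel"
  shows "eLp_norm p lborel (\<lambda>x. a1 * (\<integral>\<^sup>+y. w1 (x, y) \<partial>lborel) + a2 * (\<integral>\<^sup>+y. w2 (x, y) \<partial>lborel) + a3 * (\<integral>\<^sup>+y. w3 (x, y) \<partial>lborel))
    \<le> a1 * (\<integral>\<^sup>+y. eLp_norm p lborel (\<lambda>x. w1 (x, y)) \<partial>lborel)
      + a2 * (\<integral>\<^sup>+y. eLp_norm p lborel (\<lambda>x. w2 (x, y)) \<partial>lborel)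
      + a3 * (\<integral>\<^sup>+y. eLp_norm p lborel (\<lambda>x. w3 (x, y)) \<partial>lborel)"
proof -
  have [measurable]: "w1 \<in> borel_measurable (borel \<Otimes>\<^sub>M borel)" "w2 \<in> borel_measurable (borel \<Otimes>\<^sub>M borel)"
    "w3 \<in> borel_measurable (borel \<Otimes>\<^sub>M borel)" using w by (simp_all add: borel_prod)
  have part: "eLp_norm p lborel (\<lambda>x. a * (\<integral>\<^sup>+y. w (x, y) \<partial>lborel)) \<le> a * (\<integral>\<^sup>+y. eLp_norm p lborel (\<lambda>x. w (x, y)) \<partial>lborel)"
    if [measurable]: "w \<in> borel_measurable (borel \<Otimes>\<^sub>M borel)" for a and w :: "real \<times> real \<Rightarrow> ennreal"
  proof -
    have "eLp_norm p lborel (\<lambda>x. a * (\<integral>\<^sup>+y. w (x, y) \<partial>lborel)) = a * eLp_norm p lborel (\<lambda>x. \<integral>\<^sup>+y. w (x, y) \<partial>lborel)"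
      using p by (intro eLp_norm_cmult) auto
    also have "\<dots> \<le> a * (\<integral>\<^sup>+y. eLp_norm p lborel (\<lambda>x. w (x, y)) \<partial>lborel)"
      by (intro mult_left_mono lborel_pair.Minkowski_integral_inequality p) auto
    finally show ?thesis .
  qed
  show ?thesis
    by (intro order_trans[OF eLp_norm_triangle] add_mono part p lborel.sigma_finite_measure_axioms) measurable
qed

section \<open>Synthesis, mixed norms and recovered ambiguity functions\<close>

text \<open>Fubini's theorem applies to a Borel null set outside which \<open>P\<close> holds, which gives both orders even for non-measurable \<open>P\<close>.\<close>

lemma AE_lborel_sections:
  fixes P :: "real \<times> real \<Rightarrow> bool"
  assumes "AE z in lborel. P z"
  shows "AE x in lborel. AE y in lborel. P (x, y)" and "AE y in lborel. AE x in lborel. P (x, y)"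
proof -
  obtain N where N: "N \<in> null_sets lborel" "{z. \<not> P z} \<subseteq> N"
    using assms by (auto simp: eventually_ae_filter)
  have [measurable]: "N \<in> sets (lborel \<Otimes>\<^sub>M lborel)"
    using N(1) unfolding lborel_prod by auto
  have "AE z in lborel \<Otimes>\<^sub>M lborel. z \<notin> N"
    unfolding lborel_prod using N(1) by (rule AE_not_in)
  then have x: "AE x in lborel. AE y in lborel. (x, y) \<notin> N" by (rule lborel_pair.AE_pair)
  have "(AE x in lborel. AE y in lborel. (x, y) \<notin> N) \<longleftrightarrow> (AE y in lborel. AE x in lborel. (x, y) \<notin> N)"
    by (rule lborel_pair.AE_commute) measurable
  with x have y: "AE y in lborel. AE x in lborel. (x, y) \<notin> N" by simp
  have imp: "(x, y) \<notin> N \<longrightarrow> P (x, y)" for x y using N(2) by auto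
  show "AE x in lborel. AE y in lborel. P (x, y)"
    using x by eventually_elim (erule AE_mp, use imp in simp)
  show "AE y in lborel. AE x in lborel. P (x, y)"
    using y by eventually_elim (erule AE_mp, use imp in simp)
qed

lemma lebesgue_set_representative:
  fixes S :: "'a::euclidean_space set"
  assumes "S \<in> sets lebesgue"
  obtains S' where "S' \<in> sets borel" "AE z in lborel. z \<in> S \<longleftrightarrow> z \<in> S'"
proof -
  obtain T N N' where S: "S = T \<union> N" "N \<subseteq> N'" "N' \<in> null_sets lborel" "T \<in> sets lborel"
    using assms by (rule sets_completionE)
  have "AE z in lborel. z \<notin> N'" using S(3) by (rule AE_not_in)
  then have "AE z in lborel. z \<in> S \<longleftrightarrow> z \<in> T" by eventually_elim (use S in auto)
  with S(4) show ?thesis using that by auto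
qed

lemma lebesgue_set_sections:
  assumes "AE z in lborel. z \<in> \<Omega> \<longleftrightarrow> z \<in> \<Omega>'" and "\<Omega>' \<in> sets (borel :: (real \<times> real) measure)"
  shows "AE x in lborel. {y. (x, y) \<in> \<Omega>} \<in> sets lebesgue"
proof -
  have [measurable]: "\<Omega>' \<in> sets (borel \<Otimes>\<^sub>M borel)" using assms(2) unfolding borel_prod .
  show ?thesis using AE_lborel_sections(1)[OF assms(1)]
  proof eventually_elim
    fix x :: real assume ae: "AE y in lborel. (x, y) \<in> \<Omega> \<longleftrightarrow> (x, y) \<in> \<Omega>'"
    have "(\<lambda>y. indicator \<Omega> (x, y) :: complex) \<in> borel_measurable lebesgue"
    proof (rule lebesgue_representative(1))
      show "(\<lambda>y. indicator \<Omega>' (x, y) :: complex) \<in> borel_measurable borel" by measurable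
      show "AE y in lborel. (indicator \<Omega> (x, y) :: complex) = indicator \<Omega>' (x, y)"
        using ae by eventually_elim (simp add: indicator_def)
    qed
    then have "{y \<in> space lebesgue. (indicator \<Omega> (x, y) :: complex) \<in> {1}} \<in> sets lebesgue"
      by (rule measurable_sets_Collect) simp
    then show "{y. (x, y) \<in> \<Omega>} \<in> sets lebesgue" by (simp add: indicator_eq_1_iff)
  qed
qed

text \<open>If the right-hand side is finite, the two synthesis integrands differ by an integrable function; hence either
both are integrable or neither is, and in the second case both integrals have the default value 0.\<close>

lemma synthesis_diff_le:
  assumes U: "(\<lambda>y. U (x, y)) \<in> borel_measurable lebesgue" and V: "(\<lambda>y. V (x, y)) \<in> borel_measurable lebesgue"
  shows "ennreal (cmod (synthesis U x - synthesis V x)) \<le> (\<integral>\<^sup>+y. ennreal (cmod (U (x, y) - V (x, y))) \<partial>lebesgue)"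
proof (cases "(\<integral>\<^sup>+y. ennreal (cmod (U (x, y) - V (x, y))) \<partial>lebesgue) = top")
  case False
  let ?u = "\<lambda>y. U (x, y) * cis (pi * x * y)" and ?v = "\<lambda>y. V (x, y) * cis (pi * x * y)"
  have cm: "(\<lambda>y. cis (pi * x * y)) \<in> borel_measurable lebesgue"
    by (rule measurable_completion) measurable
  have m: "?u \<in> borel_measurable lebesgue" "?v \<in> borel_measurable lebesgue"
    by (intro borel_measurable_times U V cm)+
  have norm: "cmod (?u y - ?v y) = cmod (U (x, y) - V (x, y))" for y
    by (simp flip: left_diff_distrib)
  have d: "integrable lebesgue (\<lambda>y. ?u y - ?v y)"
    using False m by (intro integrableI_bounded borel_measurable_diff) (simp_all add: norm less_top)
  have iff: "integrable lebesgue ?u \<longleftrightarrow> integrable lebesgue ?v"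
    using Bochner_Integration.integrable_diff[OF _ d, of ?u] Bochner_Integration.integrable_add[OF _ d, of ?v] by auto
  show ?thesis
  proof (cases "integrable lebesgue ?u")
    case True
    then have "synthesis U x - synthesis V x = (\<integral>y. ?u y - ?v y \<partial>lebesgue)"
      using iff by (simp add: synthesis_def)
    then show ?thesis using norm_integral_le_nn_integral[of lebesgue "\<lambda>y. ?u y - ?v y"] by (simp add: norm)
  next
    case False
    then show ?thesis using iff by (simp add: synthesis_def not_integrable_integral_eq)
  qed
qed simp

text \<open>\<open>\<bar>r - s\<bar> = \<bar>r\<^sup>2 - s\<^sup>2\<bar> / (r + s)\<close> with \<open>r + s \<ge> 2 sqrt (r s)\<close>.\<close>

lemma inverse_sqrt_diff_le:
  fixes v w :: complex
  assumes "v \<noteq> 0" "w \<noteq> 0"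
  defines "r \<equiv> sqrt (cmod v)" and "s \<equiv> sqrt (cmod w)"
  shows "\<bar>1 / r - 1 / s\<bar> \<le> cmod (v - w) / (2 * (r * s) powr (3 / 2))"
proof -
  have rs: "0 < r" "0 < s" using assms by auto
  define m where "m = sqrt (r * s)"
  have m: "0 < m" "m * m = r * s" using rs by (auto simp: m_def)
  have "2 * m \<le> r + s"
    using arith_geo_mean_sqrt[of r s] rs by (simp add: m_def)
  have "(r * s) powr (3 / 2) = (r * s) powr (1 + 1 / 2)" by simp
  also have "\<dots> = r * s * m"
    by (subst powr_add) (use rs in \<open>simp add: m_def powr_half_sqrt\<close>)
  finally have pw: "(r * s) powr (3 / 2) = r * s * m" .
  have "\<bar>r - s\<bar> * (2 * m) \<le> \<bar>r - s\<bar> * (r + s)"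
    using \<open>2 * m \<le> r + s\<close> by (intro mult_left_mono) auto
  also have "\<dots> = \<bar>(r - s) * (r + s)\<bar>" using rs by (simp add: abs_mult)
  also have "(r - s) * (r + s) = r\<^sup>2 - s\<^sup>2" by (simp add: power2_eq_square algebra_simps)
  also have "\<dots> = cmod v - cmod w" by (simp add: r_def s_def)
  also have "\<bar>\<dots>\<bar> \<le> cmod (v - w)" by (rule norm_triangle_ineq3)
  finally have le: "\<bar>r - s\<bar> \<le> cmod (v - w) / (2 * m)" using m by (simp add: pos_le_divide_eq)
  have "1 / r - 1 / s = (s - r) / (r * s)" using rs by (simp add: field_simps)
  then have "\<bar>1 / r - 1 / s\<bar> = \<bar>r - s\<bar> / (r * s)"
    using rs by (simp add: abs_mult abs_minus_commute)
  also have "\<dots> \<le> cmod (v - w) / (2 * m) / (r * s)"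
    using le rs by (intro divide_right_mono) auto
  also have "\<dots> = cmod (v - w) / (2 * (r * s) powr (3 / 2))"
    by (simp add: pw mult_ac)
  finally show ?thesis .
qed

lemma mixed_norm_representative:
  assumes "AE y in lborel. AE x in lborel. ennreal (cmod (U (x, y))) = w (x, y)"
  shows "mixed_norm p U = (\<integral>\<^sup>+y. eLp_norm p lborel (\<lambda>x. w (x, y)) \<partial>lborel)"
  unfolding mixed_norm_def eLp_norm_def nn_integral_completion
proof (rule nn_integral_cong_AE)
  show "AE y in lborel. ennpowr (\<integral>\<^sup>+x. ennreal (cmod (U (x, y)) powr p) \<partial>lborel) (1 / p) =
      ennpowr (\<integral>\<^sup>+x. ennpowr (w (x, y)) p \<partial>lborel) (1 / p)"
    using assms
  proof eventually_elim
    fix y assume "AE x in lborel. ennreal (cmod (U (x, y))) = w (x, y)"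
    then have "AE x in lborel. ennreal (cmod (U (x, y)) powr p) = ennpowr (w (x, y)) p"
      by eventually_elim (simp add: ennpowr_ennreal[symmetric])
    then show "ennpowr (\<integral>\<^sup>+x. ennreal (cmod (U (x, y)) powr p) \<partial>lborel) (1 / p) =
      ennpowr (\<integral>\<^sup>+x. ennpowr (w (x, y)) p \<partial>lborel) (1 / p)"
      by (simp cong: nn_integral_cong_AE)
  qed
qed

lemma mixed_norm_bounded_finite:
  assumes p: "1 \<le> p" and B: "\<And>z. cmod (U z) \<le> B"
    and supp: "\<And>x y. U (x, y) \<noteq> 0 \<Longrightarrow> \<bar>x\<bar> \<le> R \<and> \<bar>y\<bar> \<le> R"
  shows "mixed_norm p U < top"
proof -
  have B0: "0 \<le> B" using B[of undefined] norm_ge_zero order_trans by blast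
  define c where "c = ennpowr (ennreal (B powr p) * emeasure lborel {- R..R}) (1 / p)"
  have c: "c < top"
    unfolding c_def by (cases "- R \<le> R") (auto simp: ennpowr_ennreal simp flip: ennreal_mult)
  have "mixed_norm p U \<le> (\<integral>\<^sup>+y. c * indicator {- R..R} y \<partial>lborel)"
    unfolding mixed_norm_def nn_integral_completion
  proof (rule nn_integral_mono)
    fix y
    show "ennpowr (\<integral>\<^sup>+x. ennreal (cmod (U (x, y)) powr p) \<partial>lborel) (1 / p) \<le> c * indicator {- R..R} y"
    proof (cases "y \<in> {- R..R}")
      case True
      have "(\<integral>\<^sup>+x. ennreal (cmod (U (x, y)) powr p) \<partial>lborel) \<le> (\<integral>\<^sup>+x. ennreal (B powr p) * indicator {- R..R} x \<partial>lborel)"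
      proof (rule nn_integral_mono)
        fix x
        show "ennreal (cmod (U (x, y)) powr p) \<le> ennreal (B powr p) * indicator {- R..R} x"
          using B[of "(x, y)"] supp[of x y] p
          by (cases "U (x, y) = 0") (auto simp: indicator_def intro!: ennreal_leI powr_mono2)
      qed
      also have "\<dots> = ennreal (B powr p) * emeasure lborel {- R..R}"
        by (rule nn_integral_cmult_indicator) simp
      finally show ?thesis using True p unfolding c_def by (simp add: ennpowr_mono)
    next
      case False
      then have "U (x, y) = 0" for x using supp[of x y] by (force simp: abs_le_iff)
      then show ?thesis by simp
    qed
  qed
  also have "\<dots> = c * emeasure lborel {- R..R}"
    by (rule nn_integral_cmult_indicator) simp
  also have "\<dots> < top"
    using c by (cases "- R \<le> R") (auto simp: ennreal_mult_less_top)
  finally show ?thesis .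
qed

lemma fourier2_measurable:
  assumes "integrable lebesgue G"
  shows "(\<lambda>(x, y). fourier2 G (y, - x)) \<in> borel_measurable borel"
proof -
  have "G \<in> borel_measurable lebesgue" using assms by (rule borel_measurable_integrable)
  then obtain G' where G': "G' \<in> borel_measurable borel" "AE z in lborel. G z = G' z"
    by (rule lebesgue_borel_representative)
  have [measurable]: "G' \<in> borel_measurable (lborel \<Otimes>\<^sub>M lborel)"
    using G'(1) by (simp add: lborel_prod)
  have "(\<lambda>(x, y). \<integral>w. G' w * cis (- 2 * pi * (fst w * y + snd w * (- x))) \<partial>(lborel \<Otimes>\<^sub>M lborel))
    \<in> borel_measurable (borel \<Otimes>\<^sub>M borel)"
    by measurable
  also have "(\<lambda>(x, y). \<integral>w. G' w * cis (- 2 * pi * (fst w * y + snd w * (- x))) \<partial>(lborel \<Otimes>\<^sub>M lborel))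
    = (\<lambda>(x, y). fourier2 G (y, - x))"
    using fourier2_lborel[OF G'] by (auto simp: fun_eq_iff lborel_prod)
  finally show ?thesis by (simp add: borel_prod)
qed

lemma fourier2_integrable:
  assumes "integrable lebesgue (G :: real \<times> real \<Rightarrow> complex)"
  shows "integrable lebesgue (\<lambda>z. G z * cis (- 2 * pi * (z \<bullet> \<xi>)))"
proof (rule integrable_mult_cis[OF assms])
  show "(\<lambda>z. - 2 * pi * (z \<bullet> \<xi>)) \<in> borel_measurable lebesgue"
    by (rule measurable_completion) simp
qed

lemma fourier2_add:
  assumes "integrable lebesgue G" "integrable lebesgue H"
  shows "fourier2 (\<lambda>z. G z + H z) \<xi> = fourier2 G \<xi> + fourier2 H \<xi>"
  unfolding fourier2_def using fourier2_integrable[OF assms(1)] fourier2_integrable[OF assms(2)]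
  by (simp add: distrib_right)

lemma fourier2_sum:
  assumes "\<And>j. j \<in> I \<Longrightarrow> integrable lebesgue (G j)"
  shows "fourier2 (\<lambda>z. \<Sum>j\<in>I. G j z) \<xi> = (\<Sum>j\<in>I. fourier2 (G j) \<xi>)"
  unfolding fourier2_def using fourier2_integrable[OF assms]
  by (simp add: sum_distrib_right)

lemma norm_fourier2_le: "ennreal (cmod (fourier2 G \<xi>)) \<le> L1_norm_plane G"
  unfolding fourier2_def L1_norm_plane_def
  using norm_integral_le_nn_integral[of lebesgue "\<lambda>z. G z * cis (- 2 * pi * (z \<bullet> \<xi>))"] by simp

text \<open>The sum of the conjugated ambiguity functions of the windows is the denominator, because it is real.\<close>

lemma recovered_ambiguity_eq:
  assumes f': "sq_integrable f'" and ae: "AE t in lborel. f t = f' t" and a: "a > 0"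
    and nz: "\<And>z. z \<in> \<Omega> \<Longrightarrow> ambiguity_sum a N z \<noteq> 0"
  shows "recovered_ambiguity a N \<Omega> (spectrogram a N f) z = indicator \<Omega> z * ambiguity f z"
proof (cases z)
  case (Pair x y)
  note w = window_sq_integrable_even(1)[OF a]
  have "(\<Sum>j=1..N. fourier2 (spectrogram a N f j) (y, - x)) = ambiguity f z * ambiguity_sum a N z"
    unfolding spectrogram_def[abs_def] fourier2_spectrogram(2)[OF f' ae w] Pair
    unfolding sum_distrib_left[symmetric] ambiguity_sum_real[OF a] ..
  then show ?thesis using nz[of z] by (simp add: recovered_ambiguity_def Pair)
qed

lemma recovered_ambiguity_noise:
  assumes f': "sq_integrable f'" and ae: "AE t in lborel. f t = f' t" and a: "a > 0"
    and \<eta>: "\<And>j. j \<in> {1..N} \<Longrightarrow> integrable lebesgue (\<eta> j)"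
  shows "recovered_ambiguity a N \<Omega> (\<lambda>j z. spectrogram a N f j z + \<eta> j z) (x, y)
    = recovered_ambiguity a N \<Omega> (spectrogram a N f) (x, y)
      + indicator \<Omega> (x, y) * (fourier2 (\<lambda>z. \<Sum>j=1..N. \<eta> j z) (y, - x) / ambiguity_sum a N (x, y))"
proof -
  note w = window_sq_integrable_even(1)[OF a]
  have "fourier2 (\<lambda>z. spectrogram a N f j z + \<eta> j z) (y, - x)
     = fourier2 (spectrogram a N f j) (y, - x) + fourier2 (\<eta> j) (y, - x)" if "j \<in> {1..N}" for j
    using fourier2_spectrogram(1)[OF f' ae w[of N j]] \<eta>[OF that]
    by (intro fourier2_add) (simp_all add: spectrogram_def[abs_def])
  then have "(\<Sum>j=1..N. fourier2 (\<lambda>z. spectrogram a N f j z + \<eta> j z) (y, - x))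
    = (\<Sum>j=1..N. fourier2 (spectrogram a N f j) (y, - x)) + (\<Sum>j=1..N. fourier2 (\<eta> j) (y, - x))"
    by (simp add: sum.distrib)
  moreover have "fourier2 (\<lambda>z. \<Sum>j=1..N. \<eta> j z) (y, - x) = (\<Sum>j=1..N. fourier2 (\<eta> j) (y, - x))"
    by (rule fourier2_sum[OF \<eta>])
  ultimately show ?thesis
    unfolding recovered_ambiguity_def prod.case by (simp only:) (simp add: add_divide_distrib)
qed

section \<open>The stability estimate\<close>

lemma Lp_norm_eq: "Lp_norm p h = eLp_norm p lborel (\<lambda>x. ennreal (cmod (h x)))"
  by (simp add: Lp_norm_def eLp_norm_def nn_integral_completion ennpowr_ennreal)

text \<open>The analytic core: \<open>A\<close> is \<open>U\<close> restricted to \<open>\<Omega>\<close> and \<open>A\<eta>\<close> perturbs it on \<open>\<Omega>\<close> by at most \<open>\<delta>\<close>. The sections of \<open>\<Omega>\<close> are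
measurable for almost every \<open>x\<close>; the section at \<open>x = 0\<close>, which determines the constants \<open>k\<close> and \<open>k\<eta>\<close>, has to be
assumed measurable.\<close>

lemma reconstruction_error:
  fixes U D A A\<eta> :: "real \<times> real \<Rightarrow> complex"
  assumes p: "1 \<le> p"
    and U: "U \<in> borel_measurable borel" and D: "D \<in> borel_measurable borel"
    and \<Omega>: "\<Omega> \<in> sets lebesgue" and \<Omega>0: "{y. (0, y) \<in> \<Omega>} \<in> sets lebesgue"
    and A: "\<And>z. A z = indicator \<Omega> z * U z" and A\<eta>: "\<And>z. A\<eta> z = A z + indicator \<Omega> z * D z"
    and D_le: "\<And>z. z \<in> \<Omega> \<Longrightarrow> ennreal (cmod (D z)) \<le> \<delta>"
    and kt: "0 < kt" "kt = sqrt (cmod (synthesis U 0))" and f: "AE x in lborel. synthesis U x = f x * complex_of_real kt"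
    and k: "synthesis A 0 \<noteq> 0" "k = sqrt (cmod (synthesis A 0))"
    and k\<eta>: "synthesis A\<eta> 0 \<noteq> 0" "k\<eta> = sqrt (cmod (synthesis A\<eta> 0))"
  shows "Lp_norm p (\<lambda>x. f x - synthesis A\<eta> x / complex_of_real k\<eta>) \<le>
    ennreal (1 / kt) * mixed_norm_on p (- \<Omega>) U
    + ennreal (1 / (2 * (kt * k) powr (3 / 2))) * L1_norm_axis (- \<Omega>) U * mixed_norm p A
    + (ennreal (1 / (2 * (k * k\<eta>) powr (3 / 2))) * mixed_norm p A + ennreal (1 / k\<eta>))
        * (\<delta> * max (emeasure lebesgue {y. (0, y) \<in> \<Omega>}) (mixed_norm p (indicator \<Omega>)))"
proof -
  let ?u = "synthesis U" and ?ut = "synthesis A" and ?un = "synthesis A\<eta>"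
  let ?CR = "emeasure lebesgue {y. (0, y) \<in> \<Omega>}" and ?Cp = "mixed_norm p (indicator \<Omega>)"
  define L where "L = L1_norm_axis (- \<Omega>) U"
  define c1 where "c1 = 1 / (2 * (kt * k) powr (3 / 2))"
  define c2 where "c2 = 1 / (2 * (k * k\<eta>) powr (3 / 2))"
  have kpos: "0 < k" "0 < k\<eta>" using k k\<eta> by auto
  have cpos: "0 \<le> c1" "0 \<le> c2" by (auto simp: c1_def c2_def)
  obtain \<Omega>' where \<Omega>': "\<Omega>' \<in> sets borel" and ae: "AE z in lborel. z \<in> \<Omega> \<longleftrightarrow> z \<in> \<Omega>'"
    using lebesgue_set_representative[OF \<Omega>] by blast
  have [measurable]: "\<Omega>' \<in> sets borel" by (rule \<Omega>')
  have [measurable]: "U \<in> borel_measurable (borel \<Otimes>\<^sub>M borel)" "D \<in> borel_measurable (borel \<Otimes>\<^sub>M borel)"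
    using U D by (simp_all add: borel_prod)
  have sec: "(\<lambda>y. U (x, y)) \<in> borel_measurable lebesgue" "(\<lambda>y. D (x, y)) \<in> borel_measurable lebesgue" for x
    by (rule measurable_completion, simp)+
  \<comment> \<open>The three integrands are built from the Borel version \<open>\<Omega>'\<close>, as the product measure requires.\<close>
  define w1 where "w1 z = indicator (- \<Omega>') z * ennreal (cmod (U z))" for z
  define w2 where "w2 z = indicator \<Omega>' z * ennreal (cmod (U z))" for z
  define w3 where "w3 z = (indicator \<Omega>' z :: ennreal)" for z
  have w: "w1 \<in> borel_measurable borel" "w2 \<in> borel_measurable borel" "w3 \<in> borel_measurable borel"
    using U unfolding w1_def w2_def w3_def by measurable

  have ind_eq: "indicator {y. (x, y) \<in> \<Omega>} = (\<lambda>y. indicator \<Omega> (x, y) :: 'c::zero_neq_one)" for x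
    by (auto simp: fun_eq_iff indicator_def)
  have ind: "(\<lambda>y. indicator \<Omega> (x, y) :: 'b::{real_normed_algebra_1}) \<in> borel_measurable lebesgue"
    if "{y. (x, y) \<in> \<Omega>} \<in> sets lebesgue" for x
    using borel_measurable_indicator[OF that] unfolding ind_eq .
  have ind': "(\<lambda>y. indicator \<Omega> (x, y) :: ennreal) \<in> borel_measurable lebesgue"
    if "{y. (x, y) \<in> \<Omega>} \<in> sets lebesgue" for x
    using borel_measurable_indicator[OF that] unfolding ind_eq .
  have mA: "(\<lambda>y. A (x, y)) \<in> borel_measurable lebesgue" "(\<lambda>y. A\<eta> (x, y)) \<in> borel_measurable lebesgue"
    if "{y. (x, y) \<in> \<Omega>} \<in> sets lebesgue" for x
    unfolding A\<eta> A by (intro borel_measurable_add borel_measurable_times ind that sec)+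

  have i: "ennreal (cmod (?u x - ?ut x)) \<le> (\<integral>\<^sup>+y. indicator (- \<Omega>) (x, y) * ennreal (cmod (U (x, y))) \<partial>lebesgue)"
    if "{y. (x, y) \<in> \<Omega>} \<in> sets lebesgue" for x
  proof -
    have "ennreal (cmod (U (x, y) - A (x, y))) = indicator (- \<Omega>) (x, y) * ennreal (cmod (U (x, y)))" for y
      by (simp add: A indicator_def)
    then show ?thesis using synthesis_diff_le[OF sec(1) mA(1)[OF that]] by simp
  qed
  have ii: "ennreal (cmod (?ut x)) \<le> (\<integral>\<^sup>+y. indicator \<Omega> (x, y) * ennreal (cmod (U (x, y))) \<partial>lebesgue)"
    if "{y. (x, y) \<in> \<Omega>} \<in> sets lebesgue" for x
  proof -
    have "ennreal (cmod (A (x, y) - 0)) = indicator \<Omega> (x, y) * ennreal (cmod (U (x, y)))" for y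
      by (simp add: A indicator_def)
    moreover have "synthesis (\<lambda>z. 0) x = 0" by (simp add: synthesis_def)
    ultimately show ?thesis using synthesis_diff_le[OF mA(1)[OF that], of "\<lambda>z. 0"] by simp
  qed
  have iii: "ennreal (cmod (?ut x - ?un x)) \<le> \<delta> * (\<integral>\<^sup>+y. indicator \<Omega> (x, y) \<partial>lebesgue)"
    if "{y. (x, y) \<in> \<Omega>} \<in> sets lebesgue" for x
  proof -
    have "ennreal (cmod (A (x, y) - A\<eta> (x, y))) \<le> \<delta> * indicator \<Omega> (x, y)" for y
      using D_le[of "(x, y)"] by (simp add: A\<eta> norm_mult indicator_def)
    then have "(\<integral>\<^sup>+y. ennreal (cmod (A (x, y) - A\<eta> (x, y))) \<partial>lebesgue) \<le> (\<integral>\<^sup>+y. \<delta> * indicator \<Omega> (x, y) \<partial>lebesgue)"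
      by (intro nn_integral_mono) simp
    also have "\<dots> = \<delta> * (\<integral>\<^sup>+y. indicator \<Omega> (x, y) \<partial>lebesgue)"
      by (rule nn_integral_cmult[OF ind'[OF that]])
    finally show ?thesis using synthesis_diff_le[of A x A\<eta>, OF mA[OF that]] order_trans by blast
  qed

  \<comment> \<open>The changes of the normalising constant are measured on the section \<open>x = 0\<close>.\<close>
  have "ennreal \<bar>1 / kt - 1 / k\<bar> \<le> ennreal (c1 * cmod (?u 0 - ?ut 0))"
    using inverse_sqrt_diff_le[of "?u 0" "?ut 0"] kt k by (intro ennreal_leI) (auto simp: c1_def)
  also have "\<dots> = ennreal c1 * ennreal (cmod (?u 0 - ?ut 0))"
    using cpos by (simp add: ennreal_mult)
  also have "\<dots> \<le> ennreal c1 * L"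
  proof (rule mult_left_mono)
    have "(\<integral>\<^sup>+y. indicator (- \<Omega>) (0, y) * ennreal (cmod (U (0, y))) \<partial>lebesgue) = L"
      unfolding L_def L1_norm_axis_def by (intro nn_integral_cong) (simp add: indicator_def)
    then show "ennreal (cmod (?u 0 - ?ut 0)) \<le> L" using i[OF \<Omega>0] by simp
  qed simp
  finally have d1: "ennreal \<bar>1 / kt - 1 / k\<bar> \<le> ennreal c1 * L" .
  have "ennreal \<bar>1 / k - 1 / k\<eta>\<bar> \<le> ennreal (c2 * cmod (?ut 0 - ?un 0))"
    using inverse_sqrt_diff_le[of "?ut 0" "?un 0"] k k\<eta> by (intro ennreal_leI) (auto simp: c2_def)
  also have "\<dots> = ennreal c2 * ennreal (cmod (?ut 0 - ?un 0))"
    using cpos by (simp add: ennreal_mult)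
  also have "\<dots> \<le> ennreal c2 * (\<delta> * ?CR)"
  proof (rule mult_left_mono)
    have "(\<integral>\<^sup>+y. indicator \<Omega> (0, y) \<partial>lebesgue) = (\<integral>\<^sup>+y. indicator {y. (0, y) \<in> \<Omega>} y \<partial>lebesgue)"
      by (intro nn_integral_cong) (simp add: indicator_def)
    also have "\<dots> = ?CR" by (rule nn_integral_indicator[OF \<Omega>0])
    finally show "ennreal (cmod (?ut 0 - ?un 0)) \<le> \<delta> * ?CR" using iii[OF \<Omega>0] by simp
  qed simp
  finally have d2: "ennreal \<bar>1 / k - 1 / k\<eta>\<bar> \<le> ennreal c2 * (\<delta> * ?CR)" .

  define a2 where "a2 = ennreal c1 * L + ennreal c2 * (\<delta> * ?CR)"
  have pointwise: "AE x in lborel. ennreal (cmod (f x - ?un x / complex_of_real k\<eta>)) \<le>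
     ennreal (1 / kt) * (\<integral>\<^sup>+y. w1 (x, y) \<partial>lborel) + a2 * (\<integral>\<^sup>+y. w2 (x, y) \<partial>lborel)
       + (ennreal (1 / k\<eta>) * \<delta>) * (\<integral>\<^sup>+y. w3 (x, y) \<partial>lborel)"
    using f AE_lborel_sections(1)[OF ae] lebesgue_set_sections[OF ae \<Omega>']
  proof eventually_elim
    fix x
    assume fx: "?u x = f x * complex_of_real kt" and good: "{y. (x, y) \<in> \<Omega>} \<in> sets lebesgue"
      and aex: "AE y in lborel. (x, y) \<in> \<Omega> \<longleftrightarrow> (x, y) \<in> \<Omega>'"
    have X1: "(\<integral>\<^sup>+y. indicator (- \<Omega>) (x, y) * ennreal (cmod (U (x, y))) \<partial>lebesgue) = (\<integral>\<^sup>+y. w1 (x, y) \<partial>lborel)"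
      unfolding nn_integral_completion w1_def
      by (rule nn_integral_cong_AE) (use aex in eventually_elim, simp add: indicator_def)
    have X2: "(\<integral>\<^sup>+y. indicator \<Omega> (x, y) * ennreal (cmod (U (x, y))) \<partial>lebesgue) = (\<integral>\<^sup>+y. w2 (x, y) \<partial>lborel)"
      unfolding nn_integral_completion w2_def
      by (rule nn_integral_cong_AE) (use aex in eventually_elim, simp add: indicator_def)
    have X3: "(\<integral>\<^sup>+y. indicator \<Omega> (x, y) \<partial>lebesgue) = (\<integral>\<^sup>+y. w3 (x, y) \<partial>lborel)"
      unfolding nn_integral_completion w3_def
      by (rule nn_integral_cong_AE) (use aex in eventually_elim, simp add: indicator_def)
    have "f x = ?u x / complex_of_real kt" using fx kt(1) by simp
    then have "f x - ?un x / complex_of_real k\<eta> = (?u x - ?ut x) * complex_of_real (1 / kt)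
        + (?ut x * complex_of_real (1 / kt - 1 / k) + ?ut x * complex_of_real (1 / k - 1 / k\<eta>))
        + (?ut x - ?un x) * complex_of_real (1 / k\<eta>)"
      by (simp add: divide_inverse algebra_simps)
    also have "cmod \<dots> \<le> cmod ((?u x - ?ut x) * complex_of_real (1 / kt))
        + (cmod (?ut x * complex_of_real (1 / kt - 1 / k)) + cmod (?ut x * complex_of_real (1 / k - 1 / k\<eta>)))
        + cmod ((?ut x - ?un x) * complex_of_real (1 / k\<eta>))"
      by (intro norm_triangle_mono order_refl)
    also have "\<dots> = 1 / kt * cmod (?u x - ?ut x)
        + (\<bar>1 / kt - 1 / k\<bar> + \<bar>1 / k - 1 / k\<eta>\<bar>) * cmod (?ut x) + 1 / k\<eta> * cmod (?ut x - ?un x)"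
      using kt(1) kpos unfolding norm_mult norm_of_real by (simp add: algebra_simps)
    finally have "ennreal (cmod (f x - ?un x / complex_of_real k\<eta>)) \<le> ennreal (1 / kt * cmod (?u x - ?ut x)
        + (\<bar>1 / kt - 1 / k\<bar> + \<bar>1 / k - 1 / k\<eta>\<bar>) * cmod (?ut x) + 1 / k\<eta> * cmod (?ut x - ?un x))"
      by (rule ennreal_leI)
    also have "\<dots> = ennreal (1 / kt) * ennreal (cmod (?u x - ?ut x))
        + (ennreal \<bar>1 / kt - 1 / k\<bar> + ennreal \<bar>1 / k - 1 / k\<eta>\<bar>) * ennreal (cmod (?ut x))
        + ennreal (1 / k\<eta>) * ennreal (cmod (?ut x - ?un x))"
    proof -
      have "0 \<le> 1 / kt" "0 \<le> 1 / k\<eta>" using kt(1) kpos by simp_all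
      then show ?thesis
        by (simp only: ennreal_plus ennreal_mult norm_ge_zero abs_ge_zero add_nonneg_nonneg mult_nonneg_nonneg)
    qed
    also have "\<dots> \<le> ennreal (1 / kt) * (\<integral>\<^sup>+y. w1 (x, y) \<partial>lborel) + a2 * (\<integral>\<^sup>+y. w2 (x, y) \<partial>lborel)
        + ennreal (1 / k\<eta>) * (\<delta> * (\<integral>\<^sup>+y. w3 (x, y) \<partial>lborel))"
      unfolding a2_def X1[symmetric] X2[symmetric] X3[symmetric]
      by (intro add_mono mult_mono d1 d2 i ii iii good order_refl) auto
    finally show "ennreal (cmod (f x - ?un x / complex_of_real k\<eta>)) \<le>
      ennreal (1 / kt) * (\<integral>\<^sup>+y. w1 (x, y) \<partial>lborel) + a2 * (\<integral>\<^sup>+y. w2 (x, y) \<partial>lborel)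
       + (ennreal (1 / k\<eta>) * \<delta>) * (\<integral>\<^sup>+y. w3 (x, y) \<partial>lborel)"
      by (simp only: mult.assoc)
  qed

  have N1: "(\<integral>\<^sup>+y. eLp_norm p lborel (\<lambda>x. w1 (x, y)) \<partial>lborel) = mixed_norm_on p (- \<Omega>) U"
    unfolding mixed_norm_on_def
  proof (rule mixed_norm_representative[symmetric])
    show "AE y in lborel. AE x in lborel. ennreal (cmod (indicator (- \<Omega>) (x, y) * U (x, y))) = w1 (x, y)"
      using AE_lborel_sections(2)[OF ae] unfolding w1_def
      by eventually_elim (erule AE_mp, simp add: indicator_def)
  qed
  have N2: "(\<integral>\<^sup>+y. eLp_norm p lborel (\<lambda>x. w2 (x, y)) \<partial>lborel) = mixed_norm p A"
  proof (rule mixed_norm_representative[symmetric])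
    show "AE y in lborel. AE x in lborel. ennreal (cmod (A (x, y))) = w2 (x, y)"
      using AE_lborel_sections(2)[OF ae] unfolding w2_def A
      by eventually_elim (erule AE_mp, simp add: indicator_def)
  qed
  have N3: "(\<integral>\<^sup>+y. eLp_norm p lborel (\<lambda>x. w3 (x, y)) \<partial>lborel) = ?Cp"
  proof (rule mixed_norm_representative[symmetric])
    show "AE y in lborel. AE x in lborel. ennreal (cmod (indicator \<Omega> (x, y))) = w3 (x, y)"
      using AE_lborel_sections(2)[OF ae] unfolding w3_def
      by eventually_elim (erule AE_mp, simp add: indicator_def)
  qed

  have "Lp_norm p (\<lambda>x. f x - ?un x / complex_of_real k\<eta>) \<le> eLp_norm p lborel (\<lambda>x.
      ennreal (1 / kt) * (\<integral>\<^sup>+y. w1 (x, y) \<partial>lborel) + a2 * (\<integral>\<^sup>+y. w2 (x, y) \<partial>lborel)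
       + (ennreal (1 / k\<eta>) * \<delta>) * (\<integral>\<^sup>+y. w3 (x, y) \<partial>lborel))"
    unfolding Lp_norm_eq using p pointwise by (intro eLp_norm_mono_AE) auto
  also have "\<dots> \<le> ennreal (1 / kt) * mixed_norm_on p (- \<Omega>) U + a2 * mixed_norm p A
       + (ennreal (1 / k\<eta>) * \<delta>) * ?Cp"
    using Minkowski_linear_combination[OF p w] unfolding N1 N2 N3 .
  also have "\<dots> = ennreal (1 / kt) * mixed_norm_on p (- \<Omega>) U + ennreal c1 * L * mixed_norm p A
       + (ennreal c2 * mixed_norm p A * (\<delta> * ?CR) + ennreal (1 / k\<eta>) * (\<delta> * ?Cp))"
    unfolding a2_def by (simp only: distrib_right distrib_left mult_ac add_ac)
  also have "\<dots> \<le> ennreal (1 / kt) * mixed_norm_on p (- \<Omega>) U + ennreal c1 * L * mixed_norm p A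
       + (ennreal c2 * mixed_norm p A * (\<delta> * max ?CR ?Cp) + ennreal (1 / k\<eta>) * (\<delta> * max ?CR ?Cp))"
    by (intro add_mono mult_left_mono order_refl) auto
  finally show ?thesis
    unfolding c1_def c2_def L_def by (simp only: distrib_right)
qed

text \<open>The constant must be a positive real number for all arguments, hence the absolute values and the summand 1. The conversion
\<open>enn2real\<close> is faithful on finite values, and the norms to which the constant is applied are finite.\<close>

definition stability_constant :: "ennreal \<Rightarrow> real \<Rightarrow> real \<Rightarrow> real \<Rightarrow> ennreal \<Rightarrow> ennreal \<Rightarrow> real" where
  "stability_constant nA k k\<eta> kt c c' =
     1 + \<bar>1 / kt\<bar> + \<bar>1 / (2 * (kt * k) powr (3 / 2))\<bar> * enn2real nA
       + (\<bar>1 / (2 * (k * k\<eta>) powr (3 / 2))\<bar> * enn2real nA + \<bar>1 / k\<eta>\<bar>) * enn2real (max c c')"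

lemma stability_constant_pos: "0 < stability_constant nA k k\<eta> kt c c'"
  unfolding stability_constant_def by (intro add_pos_nonneg) auto

lemma stability_constant_bounds:
  assumes "0 < kt" "0 < k" "0 < k\<eta>" "nA < top" "max c c' < top"
  defines "K \<equiv> ennreal (stability_constant nA k k\<eta> kt c c')"
  shows "ennreal (1 / kt) \<le> K"
    and "ennreal (1 / (2 * (kt * k) powr (3 / 2))) * nA \<le> K"
    and "(ennreal (1 / (2 * (k * k\<eta>) powr (3 / 2))) * nA + ennreal (1 / k\<eta>)) * max c c' \<le> K"
proof -
  obtain n where n: "nA = ennreal n" "0 \<le> n" using assms(4) by (cases nA) auto
  obtain m where m: "max c c' = ennreal m" "0 \<le> m" using assms(5) by (cases "max c c'") auto
  define c1 where "c1 = 1 / (2 * (kt * k) powr (3 / 2))"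
  define c2 where "c2 = 1 / (2 * (k * k\<eta>) powr (3 / 2))"
  have pos: "0 \<le> 1 / kt" "0 \<le> c1" "0 \<le> c2" "0 \<le> 1 / k\<eta>" using assms(1-3) by (auto simp: c1_def c2_def)
  have K: "K = ennreal (1 + 1 / kt + c1 * n + (c2 * n + 1 / k\<eta>) * m)"
    unfolding K_def stability_constant_def m(1) n(1) c1_def[symmetric] c2_def[symmetric]
    using pos n(2) m(2) by simp
  have t: "0 \<le> c1 * n" "0 \<le> (c2 * n + 1 / k\<eta>) * m"
    using pos n(2) m(2) by (intro mult_nonneg_nonneg add_nonneg_nonneg; simp)+
  show "ennreal (1 / kt) \<le> K" unfolding K using pos t by (intro ennreal_leI) linarith
  have "ennreal c1 * nA = ennreal (c1 * n)" using pos n by (simp add: ennreal_mult)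
  also have "\<dots> \<le> K" unfolding K using pos t by (intro ennreal_leI) linarith
  finally show "ennreal (1 / (2 * (kt * k) powr (3 / 2))) * nA \<le> K" unfolding c1_def .
  have "(ennreal c2 * nA + ennreal (1 / k\<eta>)) * max c c' = ennreal ((c2 * n + 1 / k\<eta>) * m)"
  proof -
    have "0 \<le> c2 * n" using pos n(2) by (rule_tac mult_nonneg_nonneg)
    then show ?thesis
      using pos n m by (simp only: ennreal_mult ennreal_plus add_nonneg_nonneg)
  qed
  also have "\<dots> \<le> K" unfolding K using pos t by (intro ennreal_leI) linarith
  finally show "(ennreal (1 / (2 * (k * k\<eta>) powr (3 / 2))) * nA + ennreal (1 / k\<eta>)) * max c c' \<le> K"
    unfolding c2_def .
qed

text \<open>The hypotheses of \<open>reconstruction_error\<close> hold with \<open>\<delta> = \<parallel>\<Sum>\<^sub>j \<eta>\<^sub>j\<parallel> / \<epsilon>\<close>, since a Fourier transform is bounded by the \<open>L\<^sup>1\<close> norm and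
the denominator exceeds \<open>\<epsilon>\<close> on \<open>\<Omega>\<close>. For the second bound, \<open>\<Omega>\<close> is bounded, so every factor absorbed into the constant is finite.\<close>

lemma stability_estimate:
  fixes p a \<epsilon> :: real and N :: nat and f :: "real \<Rightarrow> complex"
    and \<eta> :: "nat \<Rightarrow> real \<times> real \<Rightarrow> complex" and \<Omega> :: "(real \<times> real) set"
  defines "U \<equiv> ambiguity f"
    and "A \<equiv> recovered_ambiguity a N \<Omega> (spectrogram a N f)"
    and "A\<eta> \<equiv> recovered_ambiguity a N \<Omega> (\<lambda>j z. spectrogram a N f j z + \<eta> j z)"
    and "noise \<equiv> L1_norm_plane (\<lambda>z. \<Sum>j=1..N. \<eta> j z)"
  defines "k \<equiv> sqrt (cmod (synthesis A 0))"
    and "k\<eta> \<equiv> sqrt (cmod (synthesis A\<eta> 0))"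
    and "kt \<equiv> sqrt (Re (synthesis U 0))"
    and "Cp \<equiv> mixed_norm p (indicator \<Omega>)"
    and "CR \<equiv> emeasure lebesgue {y. (0, y) \<in> \<Omega>}"
  assumes p: "1 \<le> p" and a1: "1 < a" and f: "in_L2 f"
    and f0: "f 0 = complex_of_real (cmod (f 0))" "0 < cmod (f 0)"
    and rec: "AE x in lebesgue. synthesis U x = f x * cnj (f 0)" "synthesis U 0 = f 0 * cnj (f 0)"
    and \<eta>: "\<forall>j\<in>{1..N}. integrable lebesgue (\<eta> j)"
    and e: "0 < \<epsilon>" and \<Omega>: "\<Omega> \<in> sets lebesgue" "{y. (0, y) \<in> \<Omega>} \<in> sets lebesgue"
    and super: "\<forall>z\<in>\<Omega>. \<epsilon> < Re (ambiguity_sum a N z)"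
    and nz: "synthesis A 0 \<noteq> 0" "synthesis A\<eta> 0 \<noteq> 0"
  shows "Lp_norm p (\<lambda>x. f x - synthesis A\<eta> x / complex_of_real k\<eta>) \<le>
      ennreal (1 / kt) * mixed_norm_on p (- \<Omega>) U
      + ennreal (1 / (2 * (kt * k) powr (3 / 2))) * L1_norm_axis (- \<Omega>) U * mixed_norm p A
      + (ennreal (1 / (2 * (k * k\<eta>) powr (3 / 2))) * mixed_norm p A + ennreal (1 / k\<eta>))
        * ennreal (1 / \<epsilon>) * max CR Cp * noise" (is ?bound)
    and "Lp_norm p (\<lambda>x. f x - synthesis A\<eta> x / complex_of_real k\<eta>) \<le>
      ennreal (stability_constant (mixed_norm p A) k k\<eta> kt CR Cp)
        * (mixed_norm_on p (- \<Omega>) U + L1_norm_axis (- \<Omega>) U + ennreal (1 / \<epsilon>) * noise)"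
proof -
  have a: "0 < a" using a1 by simp
  obtain f' where f': "sq_integrable f'" "AE t in lborel. f t = f' t"
    using in_L2_representative[OF f] by blast
  define D where "D = (\<lambda>(x, y). fourier2 (\<lambda>z. \<Sum>j=1..N. \<eta> j z) (y, - x) / ambiguity_sum a N (x, y))"
  have ge: "\<epsilon> < cmod (ambiguity_sum a N z)" if "z \<in> \<Omega>" for z
    using super that complex_Re_le_cmod[of "ambiguity_sum a N z"] by fastforce
  have U: "U \<in> borel_measurable borel"
    unfolding U_def by (rule ambiguity_measurable[OF f'])
  have "(\<lambda>z. (\<lambda>(x, y). fourier2 (\<lambda>z. \<Sum>j=1..N. \<eta> j z) (y, - x)) z / ambiguity_sum a N z) \<in> borel_measurable borel"
    by (intro borel_measurable_divide fourier2_measurable ambiguity_sum_measurable a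
        Bochner_Integration.integrable_sum) (use \<eta> in auto)
  then have D: "D \<in> borel_measurable borel" by (simp add: D_def case_prod_beta')
  have A: "A z = indicator \<Omega> z * U z" for z
    unfolding A_def U_def
  proof (rule recovered_ambiguity_eq[OF f' a])
    show "ambiguity_sum a N z \<noteq> 0" if "z \<in> \<Omega>" for z using ge[OF that] e by auto
  qed
  have A\<eta>: "A\<eta> z = A z + indicator \<Omega> z * D z" for z
    unfolding A_def A\<eta>_def D_def
    using recovered_ambiguity_noise[OF f' a, of N \<eta> \<Omega> "fst z" "snd z"] \<eta>
    by (simp add: case_prod_beta')
  have D_le: "ennreal (cmod (D z)) \<le> ennreal (1 / \<epsilon>) * noise" if "z \<in> \<Omega>" for z
  proof -
    obtain x y where z: "z = (x, y)" by (cases z)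
    let ?F = "fourier2 (\<lambda>z. \<Sum>j=1..N. \<eta> j z) (y, - x)"
    have "cmod (D z) = cmod ?F / cmod (ambiguity_sum a N z)" by (simp add: D_def z norm_divide)
    also have "\<dots> \<le> cmod ?F / \<epsilon>"
    proof (intro divide_left_mono mult_pos_pos e)
      show "\<epsilon> \<le> cmod (ambiguity_sum a N z)" "0 < cmod (ambiguity_sum a N z)"
        using ge[OF that] e by linarith+
    qed simp
    finally have "ennreal (cmod (D z)) \<le> ennreal (1 / \<epsilon> * cmod ?F)"
      by (intro ennreal_leI) simp
    also have "\<dots> = ennreal (1 / \<epsilon>) * ennreal (cmod ?F)" using e by (intro ennreal_mult) auto
    also have "\<dots> \<le> ennreal (1 / \<epsilon>) * noise"
      unfolding noise_def by (intro mult_left_mono norm_fourier2_le) simp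
    finally show ?thesis .
  qed
  have u0: "synthesis U 0 = complex_of_real ((cmod (f 0))\<^sup>2)"
    using rec(2) by (simp only: complex_norm_square)
  have kt: "kt = cmod (f 0)" "kt = sqrt (cmod (synthesis U 0))"
    by (simp_all add: kt_def u0 norm_power)
  have "cnj (f 0) = complex_of_real kt"
    using arg_cong[OF f0(1), of cnj] by (simp add: kt)
  with rec(1) have fae: "AE x in lborel. synthesis U x = f x * complex_of_real kt"
    by (simp add: AE_completion_iff)
  have kt0: "0 < kt" using f0(2) kt by simp
  have k0: "0 < k" "0 < k\<eta>" using nz by (simp_all add: k_def k\<eta>_def)
  have main: "Lp_norm p (\<lambda>x. f x - synthesis A\<eta> x / complex_of_real k\<eta>) \<le>
    ennreal (1 / kt) * mixed_norm_on p (- \<Omega>) U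
    + ennreal (1 / (2 * (kt * k) powr (3 / 2))) * L1_norm_axis (- \<Omega>) U * mixed_norm p A
    + (ennreal (1 / (2 * (k * k\<eta>) powr (3 / 2))) * mixed_norm p A + ennreal (1 / k\<eta>))
      * ((ennreal (1 / \<epsilon>) * noise) * max CR Cp)"
    unfolding CR_def Cp_def
    by (rule reconstruction_error[OF p U D \<Omega> A A\<eta> D_le kt0 kt(2) fae])
       (use nz in \<open>simp_all add: k_def k\<eta>_def\<close>)
  then show ?bound by (simp only: mult_ac)
  obtain R where R: "\<And>x y. \<epsilon> < Re (ambiguity_sum a N (x, y)) \<Longrightarrow> \<bar>x\<bar> \<le> R \<and> \<bar>y\<bar> \<le> R"
    using ambiguity_sum_superlevel_bounded[OF a e] by blast
  have box: "\<bar>x\<bar> \<le> R \<and> \<bar>y\<bar> \<le> R" if "(x, y) \<in> \<Omega>" for x y using R super that by blast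
  have Cp: "Cp < top"
    unfolding Cp_def by (rule mixed_norm_bounded_finite[OF p, of _ 1 R]) (auto simp: indicator_def dest: box)
  have nA: "mixed_norm p A < top"
  proof (rule mixed_norm_bounded_finite[OF p])
    show "cmod (A z) \<le> energy f'" for z
      using norm_fourier1_windowed[OF f'(1) f'(1), of "fst z" "snd z"] energy_nonneg[of f']
      by (cases z) (auto simp: A U_def ambiguity_eq[OF f'] indicator_def)
    show "A (x, y) \<noteq> 0 \<Longrightarrow> \<bar>x\<bar> \<le> R \<and> \<bar>y\<bar> \<le> R" for x y
      using box[of x y] by (auto simp: A indicator_def split: if_splits)
  qed
  have "CR \<le> emeasure lebesgue {- R..R}"
    unfolding CR_def by (rule emeasure_mono) (use box in \<open>fastforce simp: abs_le_iff\<close>)+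
  also have "\<dots> < top" by (cases "- R \<le> R") auto
  finally have "max CR Cp < top" using Cp by simp
  note K = stability_constant_bounds[OF kt0 k0 nA this]
  let ?K = "ennreal (stability_constant (mixed_norm p A) k k\<eta> kt CR Cp)"
  note main
  also have "ennreal (1 / kt) * mixed_norm_on p (- \<Omega>) U
      + ennreal (1 / (2 * (kt * k) powr (3 / 2))) * L1_norm_axis (- \<Omega>) U * mixed_norm p A
      + (ennreal (1 / (2 * (k * k\<eta>) powr (3 / 2))) * mixed_norm p A + ennreal (1 / k\<eta>))
        * ((ennreal (1 / \<epsilon>) * noise) * max CR Cp)
    = ennreal (1 / kt) * mixed_norm_on p (- \<Omega>) U
      + (ennreal (1 / (2 * (kt * k) powr (3 / 2))) * mixed_norm p A) * L1_norm_axis (- \<Omega>) U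
      + ((ennreal (1 / (2 * (k * k\<eta>) powr (3 / 2))) * mixed_norm p A + ennreal (1 / k\<eta>)) * max CR Cp)
        * (ennreal (1 / \<epsilon>) * noise)"
    by (simp only: mult_ac)
  also have "\<dots> \<le> ?K * mixed_norm_on p (- \<Omega>) U + ?K * L1_norm_axis (- \<Omega>) U + ?K * (ennreal (1 / \<epsilon>) * noise)"
    by (intro add_mono mult_right_mono K) auto
  finally show "Lp_norm p (\<lambda>x. f x - synthesis A\<eta> x / complex_of_real k\<eta>) \<le>
      ?K * (mixed_norm_on p (- \<Omega>) U + L1_norm_axis (- \<Omega>) U + ennreal (1 / \<epsilon>) * noise)"
    by (simp only: distrib_left)
qed

theorem proposition3p4:
  "\<exists>C :: ennreal \<Rightarrow> real \<Rightarrow> real \<Rightarrow> real \<Rightarrow> ennreal \<Rightarrow> ennreal \<Rightarrow> real.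
    (\<forall>nA k k\<eta> ktrue c c'. C nA k k\<eta> ktrue c c' > 0) \<and>
    (\<forall>(p::real) (a::real) (N::nat) (f :: real \<Rightarrow> complex) (\<eta> :: nat \<Rightarrow> real \<times> real \<Rightarrow> complex)
       (\<epsilon>::real) (\<Omega> :: (real \<times> real) set).
      let u = synthesis (ambiguity f);
          F = spectrogram a N f;
          F\<eta> = (\<lambda>j z. F j z + \<eta> j z);
          A = recovered_ambiguity a N \<Omega> F;
          A\<eta> = recovered_ambiguity a N \<Omega> F\<eta>;
          ut = synthesis A;
          ut\<eta> = synthesis A\<eta>;
          k = sqrt (cmod (ut 0));
          k\<eta> = sqrt (cmod (ut\<eta> 0));
          ktrue = sqrt (Re (u 0));
          ft\<eta> = (\<lambda>x. ut\<eta> x / complex_of_real k\<eta>);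
          Cp = mixed_norm p (indicator \<Omega>);
          CR = emeasure lebesgue {y. (0, y) \<in> \<Omega>};
          noise = L1_norm_plane (\<lambda>z. \<Sum>j=1..N. \<eta> j z)
      in
        1 \<le> p \<and> a > 1 \<and> N \<ge> 1 \<and>
        in_L2 f \<and> f 0 = complex_of_real (cmod (f 0)) \<and> cmod (f 0) > 0 \<and>
        (AE x in lebesgue. u x = f x * cnj (f 0)) \<and> u 0 = f 0 * cnj (f 0) \<and>
        (\<forall>j\<in>{1..N}. integrable lebesgue (\<eta> j)) \<and>
        \<epsilon> > 0 \<and> \<Omega> \<in> sets lebesgue \<and> {y. (0, y) \<in> \<Omega>} \<in> sets lebesgue \<and>
        (\<forall>z\<in>\<Omega>. \<epsilon> < Re (ambiguity_sum a N z)) \<and>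
        ut 0 \<noteq> 0 \<and> ut\<eta> 0 \<noteq> 0
        \<longrightarrow>
        Lp_norm p (\<lambda>x. f x - ft\<eta> x) \<le>
          ennreal (1 / ktrue) * mixed_norm_on p (- \<Omega>) (ambiguity f)
          + ennreal (1 / (2 * (ktrue * k) powr (3 / 2)))
              * L1_norm_axis (- \<Omega>) (ambiguity f) * mixed_norm p A
          + (ennreal (1 / (2 * (k * k\<eta>) powr (3 / 2))) * mixed_norm p A + ennreal (1 / k\<eta>))
              * ennreal (1 / \<epsilon>) * max CR Cp * noise
        \<and>
        Lp_norm p (\<lambda>x. f x - ft\<eta> x) \<le>
          ennreal (C (mixed_norm p A) k k\<eta> ktrue CR Cp) *
            (mixed_norm_on p (- \<Omega>) (ambiguity f) + L1_norm_axis (- \<Omega>) (ambiguity f)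
             + ennreal (1 / \<epsilon>) * noise))"
  unfolding Let_def
proof (intro exI[of _ stability_constant] conjI allI impI stability_constant_pos; elim conjE)
qed (rule stability_estimate; assumption)+

end
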